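(* Let $\Gamma$ be a countable discrete group. Suppose that for some normalized 2-cocycle $\sigma:\Gamma^2\to\mathbb{R}$ with $[\sigma]\in H^2(\Gamma,\mathbb{R})\setminus\{0\}$ there is a decreasing sequence $\theta_n\in(0,1]$ with $\theta_n\to 0$ such that for each $n$ the twisted full group $C^*$-algebra $C^*(\Gamma,\sigma_{\theta_n})$ has a nonzero MF quotient. Then $\Gamma$ is not matricially stable.
   Context: A 2-cocycle $\sigma:\Gamma^2\to\mathbb{R}$ (trivial action) satisfies $\sigma(a,b)+\sigma(ab,c)=\sigma(a,bc)+\sigma(b,c)$; it is normalized if $\sigma(a,e)=\sigma(e,a)=0$. $H^2(\Gamma,\mathbb{R})$ is the group of 2-cocycles modulo coboundaries $\gamma(a)-\gamma(ab)+\gamma(b)$. For $\theta\in[0,1]$, $\sigma_\theta(s,t)=e^{2\pi i\theta\sigma(s,t)}$. The twisted full group $C^*$-algebra $C^*(\Gamma,\sigma_\theta)$ is the universal unital $C^*$-algebra generated by unitaries $u_s$, $s\in\Gamma$, with $u_su_t=\sigma_\theta(s,t)u_{st}$. A separable $C^*$-algebra is MF if it embeds in $\prod_i M_{k(i)}(\mathbb{C})/\bigoplus_i M_{k(i)}(\mathbb{C})$ for some sequence of positive integers $(k(i))_i$, where $\prod$ denotes norm-bounded sequences and $\bigoplus$ denotes sequences converging to $0$ in norm. $\Gamma$ is matricially stable if for any sequence of unital maps $\rho_n:\Gamma\to U(k_n)$ ($k_n\ge1$ arbitrary) with $\lim_{n}\|\rho_n(st)-\rho_n(s)\rho_n(t)\|=0$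 for all $s,t\in\Gamma$ (operator norm), there is a sequence of group homomorphisms $\pi_n:\Gamma\to U(k_n)$ with $\lim_n\|\rho_n(s)-\pi_n(s)\|=0$ for all $s\in\Gamma$. *)

theory Defs
  imports
    "HOL-Analysis.Abstract_Metric_Spaces"
    "HOL-Analysis.L2_Norm"
    "HOL-Algebra.QuotRing"
    "HOL-Algebra.Subrings"
    "Jordan_Normal_Form.Schur_Decomposition"
begin

section \<open>Second cohomology with real coefficients\<close>

text \<open>Cochains are functions on the whole type, but only their values on \<^term>\<open>carrier G\<close> matter:
  a cochain that vanishes there is a coboundary in the sense below, so the values elsewhere
  disappear in the quotient.\<close>

definition cocycles2 :: "('g, 'm) monoid_scheme \<Rightarrow> ('g \<Rightarrow> 'g \<Rightarrow> real) monoid" where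
  "cocycles2 G =
    \<lparr>carrier = {\<sigma>. \<forall>a\<in>carrier G. \<forall>b\<in>carrier G. \<forall>c\<in>carrier G.
        \<sigma> a b + \<sigma> (a \<otimes>\<^bsub>G\<^esub> b) c = \<sigma> a (b \<otimes>\<^bsub>G\<^esub> c) + \<sigma> b c},
     monoid.mult = (\<lambda>\<sigma> \<tau> a b. \<sigma> a b + \<tau> a b),
     one = (\<lambda>a b. 0)\<rparr>"

definition coboundaries2 :: "('g, 'm) monoid_scheme \<Rightarrow> ('g \<Rightarrow> 'g \<Rightarrow> real) set" where
  "coboundaries2 G = {\<sigma>. \<exists>\<gamma> :: 'g \<Rightarrow> real. \<forall>a\<in>carrier G. \<forall>b\<in>carrier G.
      \<sigma> a b = \<gamma> a - \<gamma> (a \<otimes>\<^bsub>G\<^esub> b) + \<gamma> b}"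

definition H2 :: "('g, 'm) monoid_scheme \<Rightarrow> ('g \<Rightarrow> 'g \<Rightarrow> real) set monoid" where
  "H2 G = cocycles2 G Mod coboundaries2 G"

definition H2_class :: "('g, 'm) monoid_scheme \<Rightarrow> ('g \<Rightarrow> 'g \<Rightarrow> real) \<Rightarrow> ('g \<Rightarrow> 'g \<Rightarrow> real) set" where
  "H2_class G \<sigma> = coboundaries2 G #>\<^bsub>cocycles2 G\<^esub> \<sigma>"

definition normalized2 :: "('g, 'm) monoid_scheme \<Rightarrow> ('g \<Rightarrow> 'g \<Rightarrow> real) \<Rightarrow> bool" where
  "normalized2 G \<sigma> \<longleftrightarrow> (\<forall>a\<in>carrier G. \<sigma> a \<one>\<^bsub>G\<^esub> = 0 \<and> \<sigma> \<one>\<^bsub>G\<^esub> a = 0)"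

definition exp_cocycle :: "('g \<Rightarrow> 'g \<Rightarrow> real) \<Rightarrow> real \<Rightarrow> 'g \<Rightarrow> 'g \<Rightarrow> complex" where
  "exp_cocycle \<sigma> \<theta> s t = exp (2 * complex_of_real pi * \<i> * complex_of_real \<theta> * complex_of_real (\<sigma> s t))"


section \<open>Unital C*-algebras\<close>

record 'a cstar = "'a ring" +
  scl :: "complex \<Rightarrow> 'a \<Rightarrow> 'a"
  star :: "'a \<Rightarrow> 'a"
  nrm :: "'a \<Rightarrow> real"

text \<open>The locale \<^locale>\<open>Metric_space\<close> constrains the distance function also outside the underlying
  set, whence the case distinction.\<close>

definition cdist :: "'a cstar \<Rightarrow> 'a \<Rightarrow> 'a \<Rightarrow> real" where
  "cdist A x y = (if x \<in> carrier A \<and> y \<in> carrier A then nrm A (x \<ominus>\<^bsub>A\<^esub> y) else 0)"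

abbreviation ctop :: "'a cstar \<Rightarrow> 'a topology" where
  "ctop A \<equiv> Metric_space.mtopology (carrier A) (cdist A)"

text \<open>The zero algebra is allowed.\<close>

locale unital_cstar_algebra = ring A for A :: "'a cstar" (structure) +
  assumes scl_closed: "x \<in> carrier A \<Longrightarrow> scl A c x \<in> carrier A"
    and scl_one: "x \<in> carrier A \<Longrightarrow> scl A 1 x = x"
    and scl_scl: "x \<in> carrier A \<Longrightarrow> scl A c (scl A d x) = scl A (c * d) x"
    and scl_add_left: "x \<in> carrier A \<Longrightarrow> scl A (c + d) x = scl A c x \<oplus> scl A d x"
    and scl_add_right: "x \<in> carrier A \<Longrightarrow> y \<in> carrier A \<Longrightarrow> scl A c (x \<oplus> y) = scl A c x \<oplus> scl A c y"
    and scl_mult_left: "x \<in> carrier A \<Longrightarrow> y \<in> carrier A \<Longrightarrow> scl A c x \<otimes> y = scl A c (x \<otimes> y)"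
    and scl_mult_right: "x \<in> carrier A \<Longrightarrow> y \<in> carrier A \<Longrightarrow> x \<otimes> scl A c y = scl A c (x \<otimes> y)"
    and star_closed: "x \<in> carrier A \<Longrightarrow> star A x \<in> carrier A"
    and star_star: "x \<in> carrier A \<Longrightarrow> star A (star A x) = x"
    and star_add: "x \<in> carrier A \<Longrightarrow> y \<in> carrier A \<Longrightarrow> star A (x \<oplus> y) = star A x \<oplus> star A y"
    and star_mult: "x \<in> carrier A \<Longrightarrow> y \<in> carrier A \<Longrightarrow> star A (x \<otimes> y) = star A y \<otimes> star A x"
    and star_scl: "x \<in> carrier A \<Longrightarrow> star A (scl A c x) = scl A (cnj c) (star A x)"
    and nrm_nonneg: "x \<in> carrier A \<Longrightarrow> 0 \<le> nrm A x"
    and nrm_eq_0_iff: "x \<in> carrier A \<Longrightarrow> nrm A x = 0 \<longleftrightarrow> x = \<zero>"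
    and nrm_add: "x \<in> carrier A \<Longrightarrow> y \<in> carrier A \<Longrightarrow> nrm A (x \<oplus> y) \<le> nrm A x + nrm A y"
    and nrm_scl: "x \<in> carrier A \<Longrightarrow> nrm A (scl A c x) = cmod c * nrm A x"
    and nrm_mult: "x \<in> carrier A \<Longrightarrow> y \<in> carrier A \<Longrightarrow> nrm A (x \<otimes> y) \<le> nrm A x * nrm A y"
    and cstar_identity: "x \<in> carrier A \<Longrightarrow> nrm A (star A x \<otimes> x) = (nrm A x)\<^sup>2"
    and complete: "Metric_space.mcomplete (carrier A) (cdist A)"
begin

lemma scl_minus_one: "x \<in> carrier A \<Longrightarrow> scl A (- 1) x = \<ominus> x"
proof -
  assume x: "x \<in> carrier A"
  have "scl A 0 x \<oplus> scl A 0 x = scl A 0 x"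
    using scl_add_left[OF x, of 0 0] by simp
  then have z: "scl A 0 x = \<zero>"
    using scl_closed[OF x] by (metis add.r_cancel_one)
  have "x \<oplus> scl A (- 1) x = \<zero>"
    using scl_add_left[OF x, of 1 "- 1"] scl_one[OF x] z by simp
  then show ?thesis
    using x scl_closed[OF x] by (metis a_comm minus_equality)
qed

lemma Metric_space_cdist: "Metric_space (carrier A) (cdist A)"
proof
  show "0 \<le> cdist A x y" for x y
    by (simp add: cdist_def nrm_nonneg)
  show "cdist A x y = cdist A y x" for x y
  proof (cases "x \<in> carrier A \<and> y \<in> carrier A")
    case True
    then have "y \<ominus> x = \<ominus> (x \<ominus> y)"
      by (simp add: minus_eq minus_add a_comm)
    then have "y \<ominus> x = scl A (- 1) (x \<ominus> y)"
      using True by (simp add: scl_minus_one)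
    then show ?thesis
      using True by (simp add: cdist_def nrm_scl)
  qed (auto simp: cdist_def)
  show "cdist A x y = 0 \<longleftrightarrow> x = y" if "x \<in> carrier A" "y \<in> carrier A" for x y
    using that by (simp add: cdist_def nrm_eq_0_iff)
  show "cdist A x z \<le> cdist A x y + cdist A y z"
    if "x \<in> carrier A" "y \<in> carrier A" "z \<in> carrier A" for x y z
  proof -
    have "(x \<ominus> y) \<oplus> (y \<ominus> z) = x \<ominus> z"
      using that by (simp add: minus_eq a_assoc) (metis a_assoc a_inv_closed l_neg l_zero)
    then show ?thesis
      using that nrm_add[of "x \<ominus> y" "y \<ominus> z"] by (simp add: cdist_def)
  qed
qed

end

definition star_hom :: "'a cstar \<Rightarrow> 'b cstar \<Rightarrow> ('a \<Rightarrow> 'b) set" where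
  "star_hom A B = {\<phi>. \<phi> \<in> carrier A \<rightarrow> carrier B \<and>
    (\<forall>x\<in>carrier A. \<forall>y\<in>carrier A. \<phi> (x \<oplus>\<^bsub>A\<^esub> y) = \<phi> x \<oplus>\<^bsub>B\<^esub> \<phi> y \<and> \<phi> (x \<otimes>\<^bsub>A\<^esub> y) = \<phi> x \<otimes>\<^bsub>B\<^esub> \<phi> y) \<and>
    (\<forall>x\<in>carrier A. \<forall>c. \<phi> (scl A c x) = scl B c (\<phi> x)) \<and>
    (\<forall>x\<in>carrier A. \<phi> (star A x) = star B (\<phi> x))}"

definition unital_star_hom :: "'a cstar \<Rightarrow> 'b cstar \<Rightarrow> ('a \<Rightarrow> 'b) set" where
  "unital_star_hom A B = {\<phi> \<in> star_hom A B. \<phi> \<one>\<^bsub>A\<^esub> = \<one>\<^bsub>B\<^esub>}"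

definition cstar_subalgebra :: "'a set \<Rightarrow> 'a cstar \<Rightarrow> bool" where
  "cstar_subalgebra S A \<longleftrightarrow> subring S A \<and> (\<forall>x\<in>S. \<forall>c. scl A c x \<in> S) \<and> (\<forall>x\<in>S. star A x \<in> S) \<and>
    closedin (ctop A) S"

text \<open>Closed two-sided ideals of a C*-algebra. Such ideals are automatically self-adjoint and closed
  under scalars; stating the former makes the involution of the quotient visibly well defined.\<close>

definition closed_ideal :: "'a set \<Rightarrow> 'a cstar \<Rightarrow> bool" where
  "closed_ideal I A \<longleftrightarrow> ideal I A \<and> (\<forall>x\<in>I. star A x \<in> I) \<and> closedin (ctop A) I"

definition cstar_quot :: "'a cstar \<Rightarrow> 'a set \<Rightarrow> 'a set cstar" where
  "cstar_quot A I =
    \<lparr>carrier = carrier (A Quot I),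
     monoid.mult = monoid.mult (A Quot I),
     one = one (A Quot I),
     zero = zero (A Quot I),
     add = add (A Quot I),
     scl = (\<lambda>c X. \<Union>x\<in>X. I +>\<^bsub>A\<^esub> scl A c x),
     star = (\<lambda>X. \<Union>x\<in>X. I +>\<^bsub>A\<^esub> star A x),
     nrm = (\<lambda>X. INF x\<in>X. nrm A x)\<rparr>"


section \<open>Twisted full group C*-algebras\<close>

definition twisted_unitary_rep ::
    "('g, 'm) monoid_scheme \<Rightarrow> ('g \<Rightarrow> 'g \<Rightarrow> complex) \<Rightarrow> 'a cstar \<Rightarrow> ('g \<Rightarrow> 'a) \<Rightarrow> bool" where
  "twisted_unitary_rep G \<omega> A u \<longleftrightarrow>
    (\<forall>s\<in>carrier G. u s \<in> carrier A \<and>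
       star A (u s) \<otimes>\<^bsub>A\<^esub> u s = \<one>\<^bsub>A\<^esub> \<and> u s \<otimes>\<^bsub>A\<^esub> star A (u s) = \<one>\<^bsub>A\<^esub>) \<and>
    (\<forall>s\<in>carrier G. \<forall>t\<in>carrier G. u s \<otimes>\<^bsub>A\<^esub> u t = scl A (\<omega> s t) (u (s \<otimes>\<^bsub>G\<^esub> t)))"

text \<open>\<^term>\<open>A\<close> with \<^term>\<open>u\<close> is the universal unital C*-algebra generated by a twisted unitary
  representation; this determines the pair up to isomorphism, and \<^term>\<open>A\<close> may live on any type.
  One cannot quantify over the type of the algebra \<^term>\<open>B\<close> in the universal property, but
  \<^typ>\<open>nat \<Rightarrow> 'g \<Rightarrow> complex\<close> is large enough. For only the C*-subalgebra generated by the
  unitaries \<^term>\<open>v s\<close> matters; its elements are limits of sequences of finite linear combinations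
  of the \<^term>\<open>v s\<close>, so a choice of such a sequence for each element injects it into that type.
  The map out of \<^term>\<open>A\<close> is unique because \<^term>\<open>A\<close> is generated by the \<^term>\<open>u s\<close>.\<close>

definition full_twisted_group_cstar ::
    "('g, 'm) monoid_scheme \<Rightarrow> ('g \<Rightarrow> 'g \<Rightarrow> complex) \<Rightarrow> 'a cstar \<Rightarrow> ('g \<Rightarrow> 'a) \<Rightarrow> bool" where
  "full_twisted_group_cstar G \<omega> A u \<longleftrightarrow>
    unital_cstar_algebra A \<and> twisted_unitary_rep G \<omega> A u \<and>
    (\<forall>S. cstar_subalgebra S A \<and> u ` carrier G \<subseteq> S \<longrightarrow> S = carrier A) \<and>
    (\<forall>(B :: (nat \<Rightarrow> 'g \<Rightarrow> complex) cstar) v.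
       unital_cstar_algebra B \<and> twisted_unitary_rep G \<omega> B v \<longrightarrow>
       (\<exists>\<phi>\<in>unital_star_hom A B. \<forall>s\<in>carrier G. \<phi> (u s) = v s))"


section \<open>Matrices, MF algebras\<close>

definition l2_norm_vec :: "complex Matrix.vec \<Rightarrow> real" where
  "l2_norm_vec v = L2_set (\<lambda>i. cmod (vec_index v i)) {..<dim_vec v}"

definition op_norm :: "complex mat \<Rightarrow> real" where
  "op_norm M = (SUP v\<in>{v \<in> carrier_vec (dim_col M). l2_norm_vec v \<le> 1}. l2_norm_vec (M *\<^sub>v v))"

definition mat_prod :: "(nat \<Rightarrow> nat) \<Rightarrow> (nat \<Rightarrow> complex mat) cstar" where
  "mat_prod k =
    \<lparr>carrier = {x. (\<forall>i. x i \<in> carrier_mat (k i) (k i)) \<and> bdd_above (range (\<lambda>i. op_norm (x i)))},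
     monoid.mult = (\<lambda>x y i. x i * y i),
     one = (\<lambda>i. 1\<^sub>m (k i)),
     zero = (\<lambda>i. 0\<^sub>m (k i) (k i)),
     add = (\<lambda>x y i. x i + y i),
     scl = (\<lambda>c x i. c \<cdot>\<^sub>m x i),
     star = (\<lambda>x i. mat_adjoint (x i)),
     nrm = (\<lambda>x. SUP i. op_norm (x i))\<rparr>"

definition mat_sum :: "(nat \<Rightarrow> nat) \<Rightarrow> (nat \<Rightarrow> complex mat) set" where
  "mat_sum k = {x \<in> carrier (mat_prod k). (\<lambda>i. op_norm (x i)) \<longlonglongrightarrow> 0}"

definition mat_corona :: "(nat \<Rightarrow> nat) \<Rightarrow> (nat \<Rightarrow> complex mat) set cstar" where
  "mat_corona k = cstar_quot (mat_prod k) (mat_sum k)"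

text \<open>The embedding need not preserve the unit.\<close>

definition MF :: "'a cstar \<Rightarrow> bool" where
  "MF A \<longleftrightarrow> separable_space (ctop A) \<and>
    (\<exists>k. (\<forall>i. 1 \<le> k i) \<and> (\<exists>\<phi>\<in>star_hom A (mat_corona k). inj_on \<phi> (carrier A)))"

definition has_nonzero_MF_quotient :: "'a cstar \<Rightarrow> bool" where
  "has_nonzero_MF_quotient A \<longleftrightarrow>
    (\<exists>I. closed_ideal I A \<and> carrier (cstar_quot A I) \<noteq> {\<zero>\<^bsub>cstar_quot A I\<^esub>} \<and> MF (cstar_quot A I))"


section \<open>Matricial stability\<close>

definition unitary_group :: "nat \<Rightarrow> complex mat monoid" where
  "unitary_group k =
    \<lparr>carrier = {M \<in> carrier_mat k k. mat_adjoint M * M = 1\<^sub>m k \<and> M * mat_adjoint M = 1\<^sub>m k},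
     monoid.mult = (*),
     one = 1\<^sub>m k\<rparr>"

definition matricially_stable :: "('g, 'm) monoid_scheme \<Rightarrow> bool" where
  "matricially_stable G \<longleftrightarrow>
    (\<forall>(k :: nat \<Rightarrow> nat) (\<rho> :: nat \<Rightarrow> 'g \<Rightarrow> complex mat).
       (\<forall>n. 1 \<le> k n) \<and>
       (\<forall>n. \<rho> n \<in> carrier G \<rightarrow> carrier (unitary_group (k n))) \<and>
       (\<forall>n. \<rho> n \<one>\<^bsub>G\<^esub> = 1\<^sub>m (k n)) \<and>
       (\<forall>s\<in>carrier G. \<forall>t\<in>carrier G.
          (\<lambda>n. op_norm (\<rho> n (s \<otimes>\<^bsub>G\<^esub> t) - \<rho> n s * \<rho> n t)) \<longlonglongrightarrow> 0) \<longrightarrow>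
       (\<exists>\<pi>. (\<forall>n. \<pi> n \<in> hom G (unitary_group (k n))) \<and>
          (\<forall>s\<in>carrier G. (\<lambda>n. op_norm (\<rho> n s - \<pi> n s)) \<longlonglongrightarrow> 0)))"

end

theory Submission
  imports Defs "HOL-Analysis.Further_Topology" "HOL-Library.Function_Algebras"
begin

text \<open>Let \<open>\<omega>\<^sub>n = exp (2\<pi>i \<theta>\<^sub>n \<sigma>)\<close>. A nonzero MF quotient of the twisted group algebra, lifted to matrices,
  provides maps \<open>\<rho>\<^sub>n\<close> from \<open>G\<close> to \<open>U(k\<^sub>n)\<close> for which
  \<open>\<rho>\<^sub>n(s) \<rho>\<^sub>n(t)\<close> is as close as desired to \<open>\<omega>\<^sub>n(s,t) \<rho>\<^sub>n(st)\<close>; since \<open>\<omega>\<^sub>n\<close> tends to \<open>1\<close>, these are asymptotically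
  multiplicative. If homomorphisms \<open>\<pi>\<^sub>n\<close> were asymptotic to \<open>\<rho>\<^sub>n\<close>, then taking \<open>log det\<close> of
  \<open>\<rho>\<^sub>n(s) \<rho>\<^sub>n(t) \<rho>\<^sub>n(st)\<^sup>*\<close> would exhibit \<open>2\<pi> k\<^sub>n \<theta>\<^sub>n \<sigma>\<close>, up to an error
  small compared to \<open>k\<^sub>n \<theta>\<^sub>n\<close>, as the coboundary of \<open>Im log det (\<rho>\<^sub>n(s) \<pi>\<^sub>n(s)\<^sup>*)\<close>. Hence \<open>\<sigma>\<close> would be a pointwise
  limit of coboundaries, and such a limit is a coboundary.\<close>

section \<open>Operator norms of complex matrices\<close>

text \<open>The dimensions k_n cannot be controlled, and in log det the error per eigenvalue gets
  multiplied by k_n. The quantity to be read off carries the same factor, so only the error per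
  eigenvalue relative to \<theta>_n matters. Hence the n-th algebra is used with its own tolerance
  \<theta>_n / (n+1), on a finite initial part of an enumeration of G. The branch of log det has to
  be additive near 1, within a distance that does not depend on the dimension. The principal
  logarithm of the determinant will not do: the determinant of a large unitary close to 1 can be
  anywhere on the unit circle. The sum of the principal logarithms of the eigenvalues works, but the
  eigenvalues of a product are not determined by those of the factors; additivity is therefore
  obtained by lifting a homotopy of determinants over a square. An MF embedding may send the unit to
  a proper projection, whose components can even vanish at some indices. Passing to unitaries thus
  requires compression to the ranges of exact projections, and indices of nonzero rank have to be
  found.\<close>

lemma l2_norm_vec_nonneg: "0 \<le> l2_norm_vec v"
  by (simp add: l2_norm_vec_def L2_set_nonneg)

lemma l2_norm_vec_sq: "(l2_norm_vec v)\<^sup>2 = (\<Sum>i<dim_vec v. (cmod (vec_index v i))\<^sup>2)"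
  by (simp add: l2_norm_vec_def L2_set_def sum_nonneg)

lemma l2_norm_vec_cscalar: "complex_of_real ((l2_norm_vec v)\<^sup>2) = v \<bullet>c v"
  by (simp add: l2_norm_vec_sq scalar_prod_def lessThan_atLeast0 complex_norm_square [symmetric])

lemma l2_norm_vec_eq_0_iff:
  "v \<in> carrier_vec n \<Longrightarrow> l2_norm_vec v = 0 \<longleftrightarrow> v = 0\<^sub>v n"
  by (metis conjugate_square_eq_0_vec l2_norm_vec_cscalar of_real_eq_0_iff power_eq_0_iff zero_neq_numeral zero_power2)

lemma l2_norm_vec_add:
  assumes "v \<in> carrier_vec n" "w \<in> carrier_vec n"
  shows "l2_norm_vec (v + w) \<le> l2_norm_vec v + l2_norm_vec w"
proof -
  have "l2_norm_vec (v + w) = L2_set (\<lambda>i. cmod (vec_index v i + vec_index w i)) {..<n}"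
    using assms by (auto simp: l2_norm_vec_def intro!: L2_set_cong)
  also have "\<dots> \<le> L2_set (\<lambda>i. cmod (vec_index v i) + cmod (vec_index w i)) {..<n}"
    by (rule L2_set_mono) (auto simp: norm_triangle_ineq)
  also have "\<dots> \<le> l2_norm_vec v + l2_norm_vec w"
    using assms L2_set_triangle_ineq[of "\<lambda>i. cmod (vec_index v i)" "\<lambda>i. cmod (vec_index w i)" "{..<n}"]
    by (simp add: l2_norm_vec_def)
  finally show ?thesis .
qed

lemma l2_norm_vec_smult: "l2_norm_vec (c \<cdot>\<^sub>v v) = cmod c * l2_norm_vec v"
proof -
  have "l2_norm_vec (c \<cdot>\<^sub>v v) = L2_set (\<lambda>i. cmod c * cmod (vec_index v i)) {..<dim_vec v}"
    by (auto simp: l2_norm_vec_def norm_mult intro!: L2_set_cong)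
  then show ?thesis
    by (simp add: l2_norm_vec_def L2_set_right_distrib)
qed

lemma cscalar_le_l2_norm:
  assumes "v \<in> carrier_vec n" "w \<in> carrier_vec n"
  shows "cmod (v \<bullet>c w) \<le> l2_norm_vec v * l2_norm_vec w"
proof -
  have "cmod (v \<bullet>c w) \<le> (\<Sum>i<n. cmod (vec_index v i * cnj (vec_index w i)))"
    using assms by (auto simp: scalar_prod_def lessThan_atLeast0 intro!: sum_norm_le)
  also have "\<dots> = (\<Sum>i<n. \<bar>cmod (vec_index v i)\<bar> * \<bar>cmod (vec_index w i)\<bar>)"
    by (simp add: norm_mult)
  also have "\<dots> \<le> L2_set (\<lambda>i. cmod (vec_index v i)) {..<n} * L2_set (\<lambda>i. cmod (vec_index w i)) {..<n}"
    by (rule L2_set_mult_ineq)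
  finally show ?thesis using assms by (simp add: l2_norm_vec_def)
qed

text \<open>Cauchy-Schwarz row by row. The crude constant serves to make the supremum in
  \<open>op_norm\<close> one over a bounded set.\<close>

lemma l2_norm_mult_mat_vec_bound:
  assumes "v \<in> carrier_vec (dim_col M)"
  shows "l2_norm_vec (M *\<^sub>v v) \<le> L2_set (\<lambda>i. l2_norm_vec (conjugate (Matrix.row M i))) {..<dim_row M} * l2_norm_vec v"
proof -
  have "l2_norm_vec (M *\<^sub>v v) = L2_set (\<lambda>i. cmod (Matrix.scalar_prod (Matrix.row M i) v)) {..<dim_row M}"
    by (auto simp: l2_norm_vec_def intro!: L2_set_cong)
  also have "\<dots> \<le> L2_set (\<lambda>i. l2_norm_vec (conjugate (Matrix.row M i)) * l2_norm_vec v) {..<dim_row M}"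
  proof (rule L2_set_mono)
    fix i assume "i \<in> {..<dim_row M}"
    have "Matrix.scalar_prod (Matrix.row M i) v = v \<bullet>c (conjugate (Matrix.row M i))"
      using assms by (simp add: comm_scalar_prod[OF row_carrier])
    then show "cmod (Matrix.scalar_prod (Matrix.row M i) v) \<le> l2_norm_vec (conjugate (Matrix.row M i)) * l2_norm_vec v"
      using cscalar_le_l2_norm[OF assms, of "conjugate (Matrix.row M i)"] by (simp add: mult.commute)
  qed auto
  also have "\<dots> = L2_set (\<lambda>i. l2_norm_vec (conjugate (Matrix.row M i))) {..<dim_row M} * l2_norm_vec v"
    by (simp add: L2_set_left_distrib l2_norm_vec_nonneg)
  finally show ?thesis .
qed

lemma op_norm_bdd: "bdd_above ((\<lambda>v. l2_norm_vec (M *\<^sub>v v)) ` {v \<in> carrier_vec (dim_col M). l2_norm_vec v \<le> 1})"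
proof (rule bdd_aboveI2)
  fix v assume "v \<in> {v \<in> carrier_vec (dim_col M). l2_norm_vec v \<le> 1}"
  then show "l2_norm_vec (M *\<^sub>v v) \<le> L2_set (\<lambda>i. l2_norm_vec (conjugate (Matrix.row M i))) {..<dim_row M}"
    using l2_norm_mult_mat_vec_bound[of v M]
    by (smt (verit) L2_set_nonneg mem_Collect_eq mult_left_le)
qed

lemma l2_norm_vec_0 [simp]: "l2_norm_vec (0\<^sub>v n) = 0"
  using l2_norm_vec_eq_0_iff[of "0\<^sub>v n" n] by simp

lemma op_norm_nonneg: "0 \<le> op_norm M"
proof -
  have "l2_norm_vec (M *\<^sub>v 0\<^sub>v (dim_col M)) \<le> op_norm M"
    unfolding op_norm_def by (rule cSUP_upper[OF _ op_norm_bdd]) auto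
  then show ?thesis using l2_norm_vec_nonneg order_trans by blast
qed

lemma l2_norm_mult_mat_vec:
  assumes "M \<in> carrier_mat m n" "v \<in> carrier_vec n"
  shows "l2_norm_vec (M *\<^sub>v v) \<le> op_norm M * l2_norm_vec v"
proof (cases "v = 0\<^sub>v n")
  case True
  have "M *\<^sub>v v = 0\<^sub>v m" using assms True by auto
  then show ?thesis using True by simp
next
  case False
  then have pos: "0 < l2_norm_vec v"
    using assms l2_norm_vec_eq_0_iff l2_norm_vec_nonneg by (metis less_eq_real_def)
  define c where "c = complex_of_real (1 / l2_norm_vec v)"
  have c: "cmod c = 1 / l2_norm_vec v"
    using pos by (simp add: c_def norm_divide)
  have "l2_norm_vec (M *\<^sub>v (c \<cdot>\<^sub>v v)) \<le> op_norm M"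
    unfolding op_norm_def
    by (rule cSUP_upper[OF _ op_norm_bdd]) (use assms pos in \<open>auto simp: l2_norm_vec_smult c\<close>)
  moreover have "M *\<^sub>v (c \<cdot>\<^sub>v v) = c \<cdot>\<^sub>v (M *\<^sub>v v)"
    using assms by (simp add: mult_mat_vec)
  ultimately show ?thesis using pos by (simp add: l2_norm_vec_smult c divide_le_eq)
qed

lemma op_norm_le:
  assumes "M \<in> carrier_mat m n" "0 \<le> c"
    and "\<And>v. v \<in> carrier_vec n \<Longrightarrow> l2_norm_vec (M *\<^sub>v v) \<le> c * l2_norm_vec v"
  shows "op_norm M \<le> c"
  unfolding op_norm_def
proof (rule cSUP_least)
  show "{v \<in> carrier_vec (dim_col M). l2_norm_vec v \<le> 1} \<noteq> {}"
    by (auto intro!: exI[of _ "0\<^sub>v (dim_col M)"])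
  fix v assume "v \<in> {v \<in> carrier_vec (dim_col M). l2_norm_vec v \<le> 1}"
  then show "l2_norm_vec (M *\<^sub>v v) \<le> c"
    using assms(1) assms(3)[of v] assms(2) l2_norm_vec_nonneg[of v]
    by (smt (verit) carrier_matD(2) mem_Collect_eq mult_left_le)
qed

lemma op_norm_add:
  assumes "A \<in> carrier_mat m n" "B \<in> carrier_mat m n"
  shows "op_norm (A + B) \<le> op_norm A + op_norm B"
proof (rule op_norm_le[of _ m n])
  fix v :: "complex Matrix.vec" assume v: "v \<in> carrier_vec n"
  have "l2_norm_vec ((A + B) *\<^sub>v v) \<le> l2_norm_vec (A *\<^sub>v v) + l2_norm_vec (B *\<^sub>v v)"
    using assms v by (simp add: add_mult_distrib_mat_vec l2_norm_vec_add[of _ m])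
  also have "\<dots> \<le> op_norm A * l2_norm_vec v + op_norm B * l2_norm_vec v"
    using assms v by (intro add_mono l2_norm_mult_mat_vec) auto
  finally show "l2_norm_vec ((A + B) *\<^sub>v v) \<le> (op_norm A + op_norm B) * l2_norm_vec v"
    by (simp add: distrib_right)
qed (use assms in \<open>auto simp: op_norm_nonneg\<close>)

lemma op_norm_mult:
  assumes "A \<in> carrier_mat m n" "B \<in> carrier_mat n p"
  shows "op_norm (A * B) \<le> op_norm A * op_norm B"
proof (rule op_norm_le[of _ m p])
  fix v :: "complex Matrix.vec" assume v: "v \<in> carrier_vec p"
  have "l2_norm_vec ((A * B) *\<^sub>v v) \<le> op_norm A * l2_norm_vec (B *\<^sub>v v)"
    using assms v by (simp add: assoc_mult_mat_vec l2_norm_mult_mat_vec)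
  also have "\<dots> \<le> op_norm A * (op_norm B * l2_norm_vec v)"
    using assms v by (intro mult_left_mono l2_norm_mult_mat_vec) (auto simp: op_norm_nonneg)
  finally show "l2_norm_vec ((A * B) *\<^sub>v v) \<le> op_norm A * op_norm B * l2_norm_vec v"
    by (simp add: mult.assoc)
qed (use assms in \<open>auto simp: op_norm_nonneg\<close>)

lemma op_norm_smult_le:
  assumes "A \<in> carrier_mat m n"
  shows "op_norm (c \<cdot>\<^sub>m A) \<le> cmod c * op_norm A"
proof (rule op_norm_le[of _ m n])
  fix v :: "complex Matrix.vec" assume v: "v \<in> carrier_vec n"
  have "(c \<cdot>\<^sub>m A) *\<^sub>v v = c \<cdot>\<^sub>v (A *\<^sub>v v)"
    using assms v by (intro eq_vecI) auto
  then show "l2_norm_vec ((c \<cdot>\<^sub>m A) *\<^sub>v v) \<le> cmod c * op_norm A * l2_norm_vec v"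
    using l2_norm_mult_mat_vec[OF assms v] by (simp add: l2_norm_vec_smult mult_left_mono mult.assoc)
qed (use assms in \<open>auto simp: op_norm_nonneg\<close>)

lemma op_norm_zero [simp]: "op_norm (0\<^sub>m m n) = 0"
proof -
  have "op_norm (0\<^sub>m m n) \<le> 0"
  proof (rule op_norm_le[of _ m n])
    fix v :: "complex Matrix.vec" assume "v \<in> carrier_vec n"
    then have "0\<^sub>m m n *\<^sub>v v = 0\<^sub>v m" by (intro eq_vecI) auto
    then show "l2_norm_vec (0\<^sub>m m n *\<^sub>v v) \<le> 0 * l2_norm_vec v" by simp
  qed auto
  then show ?thesis using op_norm_nonneg[of "0\<^sub>m m n"] by simp
qed

lemma op_norm_minus_commute:
  assumes "A \<in> carrier_mat m n" "B \<in> carrier_mat m n"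
  shows "op_norm (A - B) = op_norm (B - A)"
proof -
  have *: "op_norm (A - B) \<le> op_norm (B - A)"
    if "A \<in> carrier_mat m n" "B \<in> carrier_mat m n" for A B
  proof -
    have "A - B = (-1) \<cdot>\<^sub>m (B - A)" using that by (intro eq_matI) auto
    then show ?thesis using op_norm_smult_le[of "B - A" m n "-1"] that by (simp add: minus_carrier_mat)
  qed
  show ?thesis by (rule antisym) (rule *[OF assms], rule *[OF assms(2) assms(1)])
qed

lemma op_norm_triangle:
  assumes "A \<in> carrier_mat m n" "B \<in> carrier_mat m n" "C \<in> carrier_mat m n"
  shows "op_norm (A - C) \<le> op_norm (A - B) + op_norm (B - C)"
proof -
  have "A - C = (A - B) + (B - C)" using assms by (intro eq_matI) auto
  then show ?thesis using op_norm_add[of "A - B" m n "B - C"] assms by (simp add: minus_carrier_mat)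
qed

section \<open>Conjugate transposes and isometries\<close>

lemma mat_adjoint_carrier [simp]: "A \<in> carrier_mat m n \<Longrightarrow> mat_adjoint A \<in> carrier_mat n m"
  by (auto simp: mat_adjoint_def)

lemma mat_adjoint_dim [simp]: "dim_row (mat_adjoint A) = dim_col A" "dim_col (mat_adjoint A) = dim_row A"
  by (auto simp: mat_adjoint_def)

lemma mat_adjoint_index [simp]:
  fixes A :: "complex mat"
  shows "i < dim_col A \<Longrightarrow> j < dim_row A \<Longrightarrow> mat_adjoint A $$ (i, j) = cnj (A $$ (j, i))"
  by (simp add: mat_adjoint_def mat_of_rows_index)

lemma mat_adjoint_adjoint [simp]: "mat_adjoint (mat_adjoint A) = (A :: complex mat)"
  by (intro eq_matI) auto

lemma mat_adjoint_one [simp]: "mat_adjoint (1\<^sub>m n) = (1\<^sub>m n :: complex mat)"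
  by (intro eq_matI) auto

lemma mat_adjoint_minus:
  "A \<in> carrier_mat m n \<Longrightarrow> B \<in> carrier_mat m n \<Longrightarrow> mat_adjoint (A - B) = mat_adjoint A - (mat_adjoint B :: complex mat)"
  by (intro eq_matI) auto

lemma mat_adjoint_mult:
  assumes "A \<in> carrier_mat m n" "B \<in> carrier_mat n p"
  shows "mat_adjoint (A * B) = mat_adjoint B * mat_adjoint (A :: complex mat)"
  using assms by (intro eq_matI) (auto simp: scalar_prod_def mult.commute intro!: sum.cong)

lemma cscalar_mat_adjoint:
  fixes A :: "complex mat"
  assumes "A \<in> carrier_mat m n" "v \<in> carrier_vec n" "w \<in> carrier_vec m"
  shows "(A *\<^sub>v v) \<bullet>c w = v \<bullet>c (mat_adjoint A *\<^sub>v w)"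
proof -
  have "(A *\<^sub>v v) \<bullet>c w = (\<Sum>i<m. \<Sum>j<n. A $$ (i, j) * vec_index v j * cnj (vec_index w i))"
    using assms by (auto simp: scalar_prod_def lessThan_atLeast0 sum_distrib_right intro!: sum.cong)
  also have "\<dots> = (\<Sum>j<n. \<Sum>i<m. A $$ (i, j) * vec_index v j * cnj (vec_index w i))"
    by (rule sum.swap)
  also have "\<dots> = v \<bullet>c (mat_adjoint A *\<^sub>v w)"
    using assms by (auto simp: scalar_prod_def lessThan_atLeast0 sum_distrib_left mult_ac intro!: sum.cong)
  finally show ?thesis .
qed

text \<open>With u the adjoint of A applied to w, the square of the norm of u is the inner product
  of A u and w, at most \<open>op_norm A\<close> times the norms of u and w; cancel one norm of u.
  Applying this to the adjoint as well gives equality.\<close>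

lemma op_norm_adjoint:
  assumes "A \<in> carrier_mat m n"
  shows "op_norm (mat_adjoint A) = op_norm A"
proof -
  have *: "op_norm (mat_adjoint A) \<le> op_norm A" if A: "A \<in> carrier_mat m n" for A m n
  proof (rule op_norm_le[of _ n m])
    fix w :: "complex Matrix.vec" assume w: "w \<in> carrier_vec m"
    define u where "u = mat_adjoint A *\<^sub>v w"
    have u: "u \<in> carrier_vec n" unfolding u_def using A w by (intro mult_mat_vec_carrier[of _ n m]) auto
    have "complex_of_real ((l2_norm_vec u)\<^sup>2) = (A *\<^sub>v u) \<bullet>c w"
      unfolding cscalar_mat_adjoint[OF A u w] u_def[symmetric] by (rule l2_norm_vec_cscalar)
    then have "(l2_norm_vec u)\<^sup>2 = cmod ((A *\<^sub>v u) \<bullet>c w)"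
      by (metis abs_of_nonneg norm_of_real zero_le_power2)
    also have "\<dots> \<le> l2_norm_vec (A *\<^sub>v u) * l2_norm_vec w"
      using mult_mat_vec_carrier[OF A u] w by (rule cscalar_le_l2_norm)
    also have "\<dots> \<le> op_norm A * l2_norm_vec u * l2_norm_vec w"
      by (intro mult_right_mono l2_norm_mult_mat_vec[OF A u] l2_norm_vec_nonneg)
    finally have "l2_norm_vec u * l2_norm_vec u \<le> (op_norm A * l2_norm_vec w) * l2_norm_vec u"
      by (simp add: power2_eq_square mult_ac)
    then show "l2_norm_vec (mat_adjoint A *\<^sub>v w) \<le> op_norm A * l2_norm_vec w"
      unfolding u_def[symmetric] using l2_norm_vec_nonneg[of u] op_norm_nonneg[of A] l2_norm_vec_nonneg[of w]
      by (cases "l2_norm_vec u = 0") auto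
  qed (use A in \<open>auto simp: op_norm_nonneg\<close>)
  show ?thesis
    using *[OF assms] *[OF mat_adjoint_carrier[OF assms]] by (intro antisym) simp_all
qed

lemma op_norm_isometry_le:
  assumes V: "V \<in> carrier_mat m n" and "mat_adjoint V * V = 1\<^sub>m n"
  shows "op_norm V \<le> 1"
proof (rule op_norm_le[OF V])
  fix v :: "complex Matrix.vec" assume v: "v \<in> carrier_vec n"
  have "(V *\<^sub>v v) \<bullet>c (V *\<^sub>v v) = v \<bullet>c (mat_adjoint V *\<^sub>v (V *\<^sub>v v))"
    using V v by (intro cscalar_mat_adjoint) auto
  also have "mat_adjoint V *\<^sub>v (V *\<^sub>v v) = v"
    using assms v by (simp flip: assoc_mult_mat_vec[of _ n m _ n])
  finally have "(l2_norm_vec (V *\<^sub>v v))\<^sup>2 = (l2_norm_vec v)\<^sup>2"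
    unfolding l2_norm_vec_cscalar[symmetric] by (simp only: of_real_eq_iff)
  then show "l2_norm_vec (V *\<^sub>v v) \<le> 1 * l2_norm_vec v"
    by (simp add: l2_norm_vec_nonneg power2_eq_iff_nonneg)
qed simp

lemma op_norm_diag_le:
  assumes "0 \<le> c" "\<And>i. i < n \<Longrightarrow> cmod (d i) \<le> c"
  shows "op_norm (Matrix.mat n n (\<lambda>(i, j). if i = j then d i else 0)) \<le> c"
proof (rule op_norm_le[of _ n n])
  let ?D = "Matrix.mat n n (\<lambda>(i, j). if i = j then d i else 0)"
  fix v :: "complex Matrix.vec" assume v: "v \<in> carrier_vec n"
  have "vec_index (?D *\<^sub>v v) i = d i * vec_index v i" if "i < n" for i
  proof -
    have "vec_index (?D *\<^sub>v v) i = (\<Sum>j<n. (if i = j then d i else 0) * vec_index v j)"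
      using v that by (auto simp: scalar_prod_def lessThan_atLeast0 intro!: sum.cong)
    also have "\<dots> = (\<Sum>j<n. (if i = j then d i * vec_index v j else 0))"
      by (intro sum.cong) auto
    finally show ?thesis using that by simp
  qed
  then have "l2_norm_vec (?D *\<^sub>v v) = L2_set (\<lambda>i. cmod (d i * vec_index v i)) {..<n}"
    by (auto simp: l2_norm_vec_def intro!: L2_set_cong)
  also have "\<dots> \<le> L2_set (\<lambda>i. c * cmod (vec_index v i)) {..<n}"
    by (rule L2_set_mono) (auto simp: norm_mult assms mult_right_mono)
  also have "\<dots> = c * l2_norm_vec v"
    using v assms by (simp add: l2_norm_vec_def L2_set_right_distrib)
  finally show "l2_norm_vec (?D *\<^sub>v v) \<le> c * l2_norm_vec v" .
qed (use assms in auto)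

section \<open>The spectral theorem for Hermitian matrices\<close>

definition diag_mat_of :: "nat \<Rightarrow> (nat \<Rightarrow> complex) \<Rightarrow> complex mat" where
  "diag_mat_of n d = Matrix.mat n n (\<lambda>(i, j). if i = j then d i else 0)"

lemma diag_mat_of_carrier [simp]: "diag_mat_of n d \<in> carrier_mat n n"
  by (simp add: diag_mat_of_def)

lemma unitary_group_carrier:
  "U \<in> carrier (unitary_group n) \<longleftrightarrow>
    U \<in> carrier_mat n n \<and> mat_adjoint U * U = 1\<^sub>m n \<and> U * mat_adjoint U = 1\<^sub>m n"
  by (simp add: unitary_group_def)

lemma unitary_groupI:
  assumes "U \<in> carrier_mat n n" "mat_adjoint U * U = 1\<^sub>m n"
  shows "U \<in> carrier (unitary_group n)"
  using assms mat_mult_left_right_inverse[of "mat_adjoint U" n U] by (simp add: unitary_group_carrier)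

text \<open>The deflation step of the spectral theorem: a basis starting with \<open>v\<close> is
  orthogonalised and normalised.\<close>

lemma unitary_first_col:
  assumes v: "v \<in> carrier_vec n" and v0: "v \<noteq> 0\<^sub>v n" and n: "0 < n"
  obtains U c where "U \<in> carrier (unitary_group n)" "Matrix.col U 0 = c \<cdot>\<^sub>v v"
proof -
  interpret cof_vec_space n "TYPE(complex)" .
  define ws where "ws = gram_schmidt n (basis_completion v)"
  note b = basis_completion[OF v v0]
  from b(6,7) n obtain vs where bv: "basis_completion v = v # vs" by (cases "basis_completion v") auto
  note gs = gram_schmidt_result[OF b(2,4,5) refl, folded ws_def]
  have len: "length ws = n" using gs b by simp
  \<comment> \<open>Gram-Schmidt leaves the first vector alone, which is what ties the first column
    of \<open>U\<close> to \<open>v\<close>.\<close>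
  have hdws: "hd ws = v" unfolding ws_def bv using v by simp
  have wsi: "ws ! i \<in> carrier_vec n" if "i < n" for i using gs(3) len that by auto
  \<comment> \<open>The vectors in \<open>ws\<close> are orthogonal but not of length 1.\<close>
  define us where "us = map (\<lambda>w. complex_of_real (1 / l2_norm_vec w) \<cdot>\<^sub>v w) ws"
  define U where "U = mat_of_cols n us"
  have U: "U \<in> carrier_mat n n" by (rule carrier_matI) (simp_all add: U_def us_def len)
  have Uij: "U $$ (i, j) = complex_of_real (1 / l2_norm_vec (ws ! j)) * vec_index (ws ! j) i"
    if "i < n" "j < n" for i j
    using that wsi[of j] by (simp add: U_def us_def len mat_of_cols_index del: of_real_divide)
  have "mat_adjoint U * U = 1\<^sub>m n"
  proof (rule eq_matI)
    fix i j assume ij: "i < dim_row (1\<^sub>m n)" "j < dim_col (1\<^sub>m n)"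
    let ?a = "complex_of_real (1 / l2_norm_vec (ws ! i))" and ?b = "complex_of_real (1 / l2_norm_vec (ws ! j))"
    have "(mat_adjoint U * U) $$ (i, j) = (\<Sum>k<n. cnj (U $$ (k, i)) * U $$ (k, j))"
      using ij U by (auto simp: scalar_prod_def lessThan_atLeast0 intro!: sum.cong)
    also have "\<dots> = (\<Sum>k<n. ?a * ?b * (vec_index (ws ! j) k * cnj (vec_index (ws ! i) k)))"
      using ij Uij by (intro sum.cong) auto
    also have "\<dots> = ?a * ?b * (ws ! j \<bullet>c ws ! i)"
      using ij carrier_vecD[OF wsi[of i]] by (simp add: scalar_prod_def lessThan_atLeast0 sum_distrib_left)
    also have "\<dots> = (if i = j then 1 else 0)"
    proof (cases "i = j")
      case True
      have "ws ! i \<bullet>c ws ! i \<noteq> 0" using gs(2) ij len by (auto dest: corthogonalD)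
      then have "l2_norm_vec (ws ! i) \<noteq> 0" by (metis l2_norm_vec_cscalar of_real_0 power_zero_numeral)
      then show ?thesis using True by (simp add: l2_norm_vec_cscalar[symmetric] power2_eq_square)
    next
      case False
      then have "ws ! j \<bullet>c ws ! i = 0" using gs(2) ij len by (auto dest: corthogonalD)
      then show ?thesis using False by simp
    qed
    finally show "(mat_adjoint U * U) $$ (i, j) = 1\<^sub>m n $$ (i, j)" using ij by simp
  qed (use U in auto)
  moreover have "Matrix.col U 0 = complex_of_real (1 / l2_norm_vec v) \<cdot>\<^sub>v v"
  proof -
    have "ws ! 0 = v" using n hdws len by (cases ws) auto
    then show ?thesis using n Uij v U by (intro eq_vecI) auto
  qed
  ultimately show ?thesis using U that unitary_groupI by blast
qed

lemma adjoint_four_block: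
  assumes "A \<in> carrier_mat nr1 nc1" "B \<in> carrier_mat nr1 nc2" "C \<in> carrier_mat nr2 nc1" "D \<in> carrier_mat nr2 nc2"
  shows "mat_adjoint (four_block_mat A B C D) =
    (four_block_mat (mat_adjoint A) (mat_adjoint C) (mat_adjoint B) (mat_adjoint D) :: complex mat)"
  using assms by (intro eq_matI) auto

lemma block_diag_mult:
  assumes "A \<in> carrier_mat 1 1" "A' \<in> carrier_mat 1 1" "D \<in> carrier_mat m m" "D' \<in> carrier_mat m m"
  shows "four_block_mat A (0\<^sub>m 1 m) (0\<^sub>m m 1) D * four_block_mat A' (0\<^sub>m 1 m) (0\<^sub>m m 1) D' =
    four_block_mat (A * A') (0\<^sub>m 1 m) (0\<^sub>m m 1) (D * D' :: complex mat)"
  by (subst mult_four_block_mat[of _ 1 1 _ m _ m _ _ 1 _ m]) (use assms in auto)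

text \<open>Induction by deflation. In an orthonormal basis starting with an eigenvector, the first
  column of the conjugated matrix \<open>B\<close> is a multiple of the first unit vector;
  \<open>B\<close> is still Hermitian, so its first row vanishes likewise off the diagonal, and the
  induction hypothesis diagonalises the remaining block \<open>C\<close>.\<close>

theorem spectral_theorem_hermitian:
  assumes "A \<in> carrier_mat n n" "mat_adjoint A = A"
  obtains U d where "U \<in> carrier (unitary_group n)"
    "A = U * diag_mat_of n (\<lambda>i. complex_of_real (d i)) * mat_adjoint U"
  using assms
proof (induction n arbitrary: A thesis)
  case 0
  show ?case
    by (rule "0.prems"(1)[of "1\<^sub>m 0"]) (use "0.prems" in \<open>auto simp: unitary_group_carrier intro!: eq_matI\<close>)
next
  case (Suc m)
  note A = Suc.prems(2) and adj = Suc.prems(3)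
  obtain e where "poly (char_poly A) e = 0"
  proof -
    have "degree (char_poly A) = Suc m" using degree_monic_char_poly[OF A] by simp
    then have "\<not> constant (poly (char_poly A))" by (simp add: constant_degree)
    then show ?thesis using fundamental_theorem_of_algebra that by blast
  qed
  then obtain v where v: "v \<in> carrier_vec (Suc m)" "v \<noteq> 0\<^sub>v (Suc m)" and Av: "A *\<^sub>v v = e \<cdot>\<^sub>v v"
    using eigenvalue_root_char_poly[OF A] A by (auto simp: eigenvalue_def eigenvector_def)
  obtain U c where U': "U \<in> carrier (unitary_group (Suc m))" and col: "Matrix.col U 0 = c \<cdot>\<^sub>v v"
    using unitary_first_col[OF v] by blast
  then have U: "U \<in> carrier_mat (Suc m) (Suc m)" "mat_adjoint U * U = 1\<^sub>m (Suc m)" "U * mat_adjoint U = 1\<^sub>m (Suc m)"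
    by (auto simp: unitary_group_carrier)
  note aU = mat_adjoint_carrier[OF U(1)]
  note [simp del] = assoc_mult_mat
  note mc = mult_carrier_mat[of _ "Suc m" "Suc m" _ "Suc m"]
  define B where "B = mat_adjoint U * A * U"
  have B: "B \<in> carrier_mat (Suc m) (Suc m)" unfolding B_def using A U(1) aU by (intro mult_carrier_mat)
  have "mat_adjoint B = B"
    using A U aU adj by (simp add: B_def mc assoc_mult_mat[of _ "Suc m" "Suc m" _ "Suc m" _ "Suc m"] mat_adjoint_mult[of _ "Suc m" "Suc m" _ "Suc m"])
  then have Bsym: "B $$ (i, j) = cnj (B $$ (j, i))" if "i < Suc m" "j < Suc m" for i j
    using that B by (metis carrier_matD mat_adjoint_index)
  have "Matrix.col B 0 = mat_adjoint U *\<^sub>v (A *\<^sub>v Matrix.col U 0)"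
    using A U(1) aU col_carrier_vec[OF _ U(1), of 0]
    by (simp only: B_def mc col_mult2[of _ "Suc m" "Suc m" _ "Suc m"] assoc_mult_mat[of _ "Suc m" "Suc m" _ "Suc m" _ "Suc m"] zero_less_Suc)
  also have "A *\<^sub>v Matrix.col U 0 = e \<cdot>\<^sub>v Matrix.col U 0"
    using A v by (simp add: col mult_mat_vec Av smult_smult_assoc mult.commute)
  also have "mat_adjoint U *\<^sub>v (e \<cdot>\<^sub>v Matrix.col U 0) = e \<cdot>\<^sub>v Matrix.col (mat_adjoint U * U) 0"
    by (simp only: col_mult2[OF aU U(1)] mult_mat_vec[OF aU col_carrier_vec[OF _ U(1)]] zero_less_Suc)
  finally have col0: "Matrix.col B 0 = e \<cdot>\<^sub>v unit_vec (Suc m) 0" by (simp add: U)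
  have B0: "B $$ (i, 0) = (if i = 0 then e else 0)" if "i < Suc m" for i
    using arg_cong[OF col0, of "\<lambda>v. vec_index v i"] that B by auto
  \<comment> \<open>\<open>e\<close> is a diagonal entry of a Hermitian matrix.\<close>
  have ereal: "e = complex_of_real (Re e)"
    using Bsym[of 0 0] B0[of 0] by (metis Reals_cnj_iff of_real_Re zero_less_Suc)
  define C where "C = Matrix.mat m m (\<lambda>(i, j). B $$ (Suc i, Suc j))"
  have C: "C \<in> carrier_mat m m" by (simp add: C_def)
  have "mat_adjoint C = C"
    by (rule eq_matI) (auto simp: C_def intro!: Bsym[symmetric])
  then obtain Q d where Q': "Q \<in> carrier (unitary_group m)"
    and CQ: "C = Q * diag_mat_of m (\<lambda>i. complex_of_real (d i)) * mat_adjoint Q"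
    using Suc.IH[OF _ C] by blast
  then have Q: "Q \<in> carrier_mat m m" "mat_adjoint Q * Q = 1\<^sub>m m" by (auto simp: unitary_group_carrier)
  note aQ = mat_adjoint_carrier[OF Q(1)]
  let ?E = "Matrix.mat 1 1 (\<lambda>_. e)" and ?D = "diag_mat_of m (\<lambda>i. complex_of_real (d i))"
  define d' where "d' = (\<lambda>i. case i of 0 \<Rightarrow> Re e | Suc j \<Rightarrow> d j)"
  let ?D' = "diag_mat_of (Suc m) (\<lambda>i. complex_of_real (d' i))"
  \<comment> \<open>The diagonalising unitary of the smaller block, extended by 1 on the eigenvector
    already split off.\<close>
  define W where "W = four_block_mat (1\<^sub>m 1) (0\<^sub>m 1 m) (0\<^sub>m m 1) Q"
  have W: "W \<in> carrier_mat (Suc m) (Suc m)"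
    using Q by (intro carrier_matI) (auto simp: W_def)
  have Wadj: "mat_adjoint W = four_block_mat (1\<^sub>m 1) (0\<^sub>m 1 m) (0\<^sub>m m 1) (mat_adjoint Q)"
  proof -
    have "mat_adjoint (0\<^sub>m 1 m) = (0\<^sub>m m 1 :: complex mat)" "mat_adjoint (0\<^sub>m m 1) = (0\<^sub>m 1 m :: complex mat)"
      by (auto intro!: eq_matI)
    then show ?thesis using Q by (simp add: W_def adjoint_four_block[of _ 1 1 _ m _ m])
  qed
  have WW: "mat_adjoint W * W = 1\<^sub>m (Suc m)"
    unfolding Wadj unfolding W_def using Q aQ four_block_one_mat[of 1 m] by (simp add: block_diag_mult flip: plus_1_eq_Suc del: One_nat_def)
  have DB: "?D' = four_block_mat ?E (0\<^sub>m 1 m) (0\<^sub>m m 1) ?D"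
    by (intro eq_matI) (auto simp: diag_mat_of_def d'_def ereal[symmetric] split: nat.splits)
  have BB: "B = four_block_mat ?E (0\<^sub>m 1 m) (0\<^sub>m m 1) C"
  proof (rule eq_matI)
    fix i j assume "i < dim_row (four_block_mat ?E (0\<^sub>m 1 m) (0\<^sub>m m 1) C)"
      and "j < dim_col (four_block_mat ?E (0\<^sub>m 1 m) (0\<^sub>m m 1) C)"
    then have ij: "i < Suc m" "j < Suc m" using C by auto
    have "B $$ (0, j) = (if j = 0 then e else 0)" using Bsym[of 0 j] B0[of j] B0[of 0] Bsym[of 0 0] ij by auto
    then show "B $$ (i, j) = four_block_mat ?E (0\<^sub>m 1 m) (0\<^sub>m m 1) C $$ (i, j)"
      using ij B0[OF ij(1)] by (cases i; cases j) (auto simp: C_def)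
  qed (use B C in auto)
  have BW: "B = W * ?D' * mat_adjoint W"
    unfolding Wadj DB BB CQ unfolding W_def using Q aQ
    by (simp del: One_nat_def add: block_diag_mult mult_carrier_mat[of _ m m _ m])
  have "A = U * B * mat_adjoint U"
  proof -
    have "U * B * mat_adjoint U = (U * mat_adjoint U) * A * (U * mat_adjoint U)"
      using A U(1) aU by (simp add: B_def mc assoc_mult_mat[of _ "Suc m" "Suc m" _ "Suc m" _ "Suc m"])
    then show ?thesis using A U by simp
  qed
  also have "\<dots> = (U * W) * ?D' * mat_adjoint (U * W)"
    using U(1) aU W mat_adjoint_carrier[OF W]
    by (simp add: BW mat_adjoint_mult[OF U(1) W] mc assoc_mult_mat[of _ "Suc m" "Suc m" _ "Suc m" _ "Suc m"])
  finally have "A = (U * W) * ?D' * mat_adjoint (U * W)" .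
  moreover have "U * W \<in> carrier (unitary_group (Suc m))"
  proof (rule unitary_groupI)
    have "mat_adjoint (U * W) * (U * W) = mat_adjoint W * (mat_adjoint U * U) * W"
      using U(1) aU W mat_adjoint_carrier[OF W]
      by (simp add: mat_adjoint_mult[OF U(1) W] mc assoc_mult_mat[of _ "Suc m" "Suc m" _ "Suc m" _ "Suc m"])
    then show "mat_adjoint (U * W) * (U * W) = 1\<^sub>m (Suc m)"
      using U W WW mat_adjoint_carrier[OF W] by simp
  qed (use U W in auto)
  ultimately show ?case using Suc.prems(1) by blast
qed

section \<open>Approximate projections and unitaries\<close>

text \<open>Functional calculus in a fixed eigenbasis: for fixed unitary \<open>U\<close>,
  differences, products and adjoints of these matrices are computed pointwise on \<open>f\<close>,
  and the operator norm is the maximum of the moduli of \<open>f\<close> below \<open>n\<close>.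
  Norm estimates thus become scalar inequalities.\<close>

definition unitary_diag :: "nat \<Rightarrow> complex mat \<Rightarrow> (nat \<Rightarrow> complex) \<Rightarrow> complex mat" where
  "unitary_diag n U f = U * diag_mat_of n f * mat_adjoint U"

lemma hermitian_unitary_diag:
  assumes "A \<in> carrier_mat n n" "mat_adjoint A = A"
  obtains U d where "U \<in> carrier (unitary_group n)" "A = unitary_diag n U (\<lambda>i. complex_of_real (d i))"
  using spectral_theorem_hermitian[OF assms] unfolding unitary_diag_def .

lemma diag_mat_of_mult: "diag_mat_of n f * diag_mat_of n g = diag_mat_of n (\<lambda>i. f i * g i)"
proof (rule eq_matI)
  fix i j assume "i < dim_row (diag_mat_of n (\<lambda>i. f i * g i))" "j < dim_col (diag_mat_of n (\<lambda>i. f i * g i))"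
  then have ij: "i < n" "j < n" by (auto simp: diag_mat_of_def)
  then have "(diag_mat_of n f * diag_mat_of n g) $$ (i, j) =
      (\<Sum>k<n. (if i = k then f i else 0) * (if k = j then g k else 0))"
    by (auto simp: diag_mat_of_def scalar_prod_def lessThan_atLeast0 intro!: sum.cong)
  also have "\<dots> = (\<Sum>k<n. if i = k then f i * (if k = j then g k else 0) else 0)"
    by (intro sum.cong) auto
  also have "\<dots> = diag_mat_of n (\<lambda>i. f i * g i) $$ (i, j)"
    using ij by (simp add: diag_mat_of_def)
  finally show "(diag_mat_of n f * diag_mat_of n g) $$ (i, j) = diag_mat_of n (\<lambda>i. f i * g i) $$ (i, j)" .
qed (auto simp: diag_mat_of_def)

lemma op_norm_entry_le:
  assumes M: "M \<in> carrier_mat m n" and ij: "i < m" "j < n"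
  shows "cmod (M $$ (i, j)) \<le> op_norm M"
proof -
  have "cmod (M $$ (i, j)) = cmod (vec_index (M *\<^sub>v unit_vec n j) i)"
    using M ij by simp
  also have "\<dots> \<le> l2_norm_vec (M *\<^sub>v unit_vec n j)"
    unfolding l2_norm_vec_def using M ij by (intro member_le_L2_set) auto
  also have "\<dots> \<le> op_norm M * l2_norm_vec (unit_vec n j)"
    by (rule l2_norm_mult_mat_vec[OF M]) simp
  also have "l2_norm_vec (unit_vec n j) = 1"
  proof -
    have "(l2_norm_vec (unit_vec n j))\<^sup>2 = (\<Sum>i<n. if i = j then 1 else 0)"
      unfolding l2_norm_vec_sq using ij by (intro sum.cong) auto
    then show ?thesis using ij l2_norm_vec_nonneg[of "unit_vec n j"] by (simp add: power2_eq_1_iff)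
  qed
  finally show ?thesis by simp
qed

context
  fixes n :: nat and U :: "complex mat"
  assumes U: "U \<in> carrier (unitary_group n)"
begin

lemma unitary_carrier: "U \<in> carrier_mat n n" "mat_adjoint U \<in> carrier_mat n n"
  and unitary_eqs: "mat_adjoint U * U = 1\<^sub>m n" "U * mat_adjoint U = 1\<^sub>m n"
  using U by (auto simp: unitary_group_carrier)

lemma op_norm_unitary_le: "op_norm U \<le> 1" "op_norm (mat_adjoint U) \<le> 1"
  using op_norm_isometry_le[of U n n] op_norm_isometry_le[of "mat_adjoint U" n n] unitary_carrier unitary_eqs
  by auto

lemma unitary_diag_carrier: "unitary_diag n U f \<in> carrier_mat n n"
  unfolding unitary_diag_def using unitary_carrier by (intro mult_carrier_mat[of _ n n]) auto

lemma unitary_diag_index: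
  assumes "a < n" "b < n"
  shows "unitary_diag n U f $$ (a, b) = (\<Sum>c<n. U $$ (a, c) * f c * cnj (U $$ (b, c)))"
proof -
  have 1: "(U * diag_mat_of n f) $$ (a, c) = U $$ (a, c) * f c" if "c < n" for c
  proof -
    have "(U * diag_mat_of n f) $$ (a, c) = (\<Sum>k<n. U $$ (a, k) * (if k = c then f k else 0))"
      using assms that unitary_carrier by (auto simp: diag_mat_of_def scalar_prod_def lessThan_atLeast0 intro!: sum.cong)
    also have "\<dots> = (\<Sum>k<n. if k = c then U $$ (a, k) * f k else 0)"
      by (intro sum.cong) auto
    finally show ?thesis using that by simp
  qed
  have "unitary_diag n U f $$ (a, b) = (\<Sum>c<n. (U * diag_mat_of n f) $$ (a, c) * mat_adjoint U $$ (c, b))"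
    unfolding unitary_diag_def using assms unitary_carrier
    by (subst index_mult_mat) (auto simp: scalar_prod_def lessThan_atLeast0 diag_mat_of_def simp del: index_mult_mat(1) mat_adjoint_index intro!: sum.cong)
  also have "\<dots> = (\<Sum>c<n. U $$ (a, c) * f c * cnj (U $$ (b, c)))"
    using assms unitary_carrier by (intro sum.cong) (auto simp: 1)
  finally show ?thesis .
qed

lemma unitary_diag_minus: "unitary_diag n U f - unitary_diag n U g = unitary_diag n U (\<lambda>i. f i - g i)"
  using unitary_diag_carrier[of f] unitary_diag_carrier[of g] unitary_diag_carrier[of "\<lambda>i. f i - g i"]
  by (intro eq_matI) (auto simp: unitary_diag_index sum_subtractf algebra_simps)

lemma unitary_diag_mult: "unitary_diag n U f * unitary_diag n U g = unitary_diag n U (\<lambda>i. f i * g i)"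
proof -
  note c = unitary_carrier diag_mat_of_carrier[of n]
  note mc = mult_carrier_mat[of _ n n _ n]
  have "unitary_diag n U f * unitary_diag n U g =
      U * (diag_mat_of n f * ((mat_adjoint U * U) * (diag_mat_of n g * mat_adjoint U)))"
    unfolding unitary_diag_def using c by (simp add: mc assoc_mult_mat[of _ n n _ n _ n])
  also have "\<dots> = U * ((diag_mat_of n f * diag_mat_of n g) * mat_adjoint U)"
    unfolding unitary_eqs using c by (simp add: mc left_mult_one_mat[of _ n n] assoc_mult_mat[of _ n n _ n _ n])
  finally show ?thesis
    unfolding unitary_diag_def diag_mat_of_mult using c by (simp add: assoc_mult_mat[of _ n n _ n _ n])
qed

lemma unitary_diag_one: "unitary_diag n U (\<lambda>_. 1) = 1\<^sub>m n"
proof -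
  have "diag_mat_of n (\<lambda>_. 1) = 1\<^sub>m n"
    by (intro eq_matI) (auto simp: diag_mat_of_def)
  then show ?thesis using unitary_carrier unitary_eqs by (simp add: unitary_diag_def)
qed

lemma unitary_diag_adjoint: "mat_adjoint (unitary_diag n U f) = unitary_diag n U (\<lambda>i. cnj (f i))"
  using unitary_diag_carrier[of f] unitary_diag_carrier[of "\<lambda>i. cnj (f i)"]
  by (intro eq_matI) (auto simp: unitary_diag_index mult_ac)

lemma op_norm_unitary_diag_le:
  assumes "0 \<le> c" "\<And>i. i < n \<Longrightarrow> cmod (f i) \<le> c"
  shows "op_norm (unitary_diag n U f) \<le> c"
proof -
  have D: "op_norm (diag_mat_of n f) \<le> c" unfolding diag_mat_of_def by (rule op_norm_diag_le) (use assms in auto)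
  have "op_norm (unitary_diag n U f) \<le> op_norm (U * diag_mat_of n f) * op_norm (mat_adjoint U)"
    unfolding unitary_diag_def using unitary_carrier by (intro op_norm_mult[of _ n n _ n]) auto
  also have "\<dots> \<le> op_norm (U * diag_mat_of n f)"
    using op_norm_unitary_le by (intro mult_left_le) (auto simp: op_norm_nonneg)
  also have "\<dots> \<le> op_norm U * op_norm (diag_mat_of n f)"
    using unitary_carrier by (intro op_norm_mult[of _ n n _ n]) auto
  also have "\<dots> \<le> op_norm (diag_mat_of n f)"
    using op_norm_unitary_le by (intro mult_left_le_one_le) (auto simp: op_norm_nonneg)
  finally show ?thesis using D by simp
qed

text \<open>Conjugating back by \<open>U\<close> costs no norm and exposes f(i) as a matrix
  entry.\<close>

lemma cmod_le_op_norm_unitary_diag: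
  assumes "i < n"
  shows "cmod (f i) \<le> op_norm (unitary_diag n U f)"
proof -
  note c = unitary_carrier diag_mat_of_carrier[of n]
  note mc = mult_carrier_mat[of _ n n _ n]
  have "mat_adjoint U * unitary_diag n U f * U = (mat_adjoint U * U) * (diag_mat_of n f * (mat_adjoint U * U))"
    unfolding unitary_diag_def using c by (simp add: mc assoc_mult_mat[of _ n n _ n _ n])
  then have eq: "mat_adjoint U * unitary_diag n U f * U = diag_mat_of n f"
    using unitary_eqs by (simp add: left_mult_one_mat[of _ n n] right_mult_one_mat[of _ n n])
  have "cmod (f i) = cmod (diag_mat_of n f $$ (i, i))" using assms by (simp add: diag_mat_of_def)
  also have "\<dots> \<le> op_norm (mat_adjoint U * unitary_diag n U f * U)"
    unfolding eq using assms by (intro op_norm_entry_le) auto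
  also have "\<dots> \<le> op_norm (mat_adjoint U * unitary_diag n U f) * op_norm U"
    using c unitary_diag_carrier[of f] by (intro op_norm_mult[of _ n n _ n]) (auto simp: mc)
  also have "\<dots> \<le> op_norm (mat_adjoint U * unitary_diag n U f)"
    using op_norm_unitary_le by (intro mult_left_le) (auto simp: op_norm_nonneg)
  also have "\<dots> \<le> op_norm (mat_adjoint U) * op_norm (unitary_diag n U f)"
    using c unitary_diag_carrier[of f] by (intro op_norm_mult[of _ n n _ n]) auto
  also have "\<dots> \<le> op_norm (unitary_diag n U f)"
    using op_norm_unitary_le by (intro mult_left_le_one_le) (auto simp: op_norm_nonneg)
  finally show ?thesis .
qed

end

text \<open>Turns a sum over selected columns into a sum over all columns with weights 0 and 1, the
  form in which a spectral projection appears as a \<open>unitary_diag\<close>.\<close>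

lemma sum_nth_filter:
  "(\<Sum>j<length (filter Q [0..<n]). g (filter Q [0..<n] ! j)) = (\<Sum>c<n. if Q c then g c else 0)"
  for g :: "nat \<Rightarrow> 'b :: comm_monoid_add"
proof -
  have "(\<Sum>j<length (filter Q [0..<n]). g (filter Q [0..<n] ! j)) = sum_list (map g (filter Q [0..<n]))"
    by (simp add: sum_list_sum_nth atLeast0LessThan)
  also have "\<dots> = sum g (set (filter Q [0..<n]))"
    by (rule sum_list_distinct_conv_sum_set) simp
  also have "\<dots> = (\<Sum>c<n. if Q c then g c else 0)"
    by (intro sum.mono_neutral_cong_left) auto
  finally show ?thesis .
qed

text \<open>The projection is the spectral projection of \<open>P\<close> for the eigenvalues above
  1/2, and the columns of \<open>V\<close> are the corresponding eigenvectors. An eigenvalue d is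
  moved to 0 or 1, whichever it is closer to, and the other factor of d (d - 1) has modulus at least
  1/2; hence the constant 2. The rank \<open>r\<close> may be 0.\<close>

lemma hermitian_near_projection:
  assumes P: "P \<in> carrier_mat n n" "mat_adjoint P = P"
  obtains r V where "V \<in> carrier_mat n r" "mat_adjoint V * V = 1\<^sub>m r"
    "op_norm (V * mat_adjoint V - P) \<le> 2 * op_norm (P * P - P)"
proof -
  obtain U d where U: "U \<in> carrier (unitary_group n)"
    and PU: "P = unitary_diag n U (\<lambda>i. complex_of_real (d i))"
    using hermitian_unitary_diag[OF P] by metis
  note Uc = unitary_carrier[OF U]
  define L where "L = filter (\<lambda>j. d j > 1 / 2) [0..<n]"
  define r where "r = length L"
  have L: "L ! j < n" if "j < r" for j
    using nth_mem[of j L] that by (auto simp: L_def r_def)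
  have distL: "distinct L" by (simp add: L_def)
  define V where "V = Matrix.mat n r (\<lambda>(a, j). U $$ (a, L ! j))"
  define p where "p = (\<lambda>c. if d c > 1 / 2 then 1 else 0 :: complex)"
  have V: "V \<in> carrier_mat n r" by (simp add: V_def)
  have "mat_adjoint V * V = 1\<^sub>m r"
  proof (rule eq_matI)
    fix i j assume "i < dim_row (1\<^sub>m r)" "j < dim_col (1\<^sub>m r)"
    then have ij: "i < r" "j < r" by auto
    have "(mat_adjoint V * V) $$ (i, j) = (\<Sum>a<n. cnj (U $$ (a, L ! i)) * U $$ (a, L ! j))"
      using ij V by (auto simp: scalar_prod_def lessThan_atLeast0 V_def intro!: sum.cong)
    also have "\<dots> = (mat_adjoint U * U) $$ (L ! i, L ! j)"
      using L ij Uc by (auto simp: scalar_prod_def lessThan_atLeast0 intro!: sum.cong)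
    also have "\<dots> = (if i = j then 1 else 0)"
      using L ij distL by (simp add: unitary_eqs[OF U] nth_eq_iff_index_eq r_def)
    finally show "(mat_adjoint V * V) $$ (i, j) = 1\<^sub>m r $$ (i, j)" using ij by simp
  qed (use V in auto)
  moreover have "V * mat_adjoint V = unitary_diag n U p"
  proof (rule eq_matI)
    fix a b assume "a < dim_row (unitary_diag n U p)" "b < dim_col (unitary_diag n U p)"
    then have ab: "a < n" "b < n" using unitary_diag_carrier[OF U, of p] by auto
    have "(V * mat_adjoint V) $$ (a, b) = (\<Sum>j<r. U $$ (a, L ! j) * cnj (U $$ (b, L ! j)))"
      using ab V by (auto simp: scalar_prod_def lessThan_atLeast0 V_def intro!: sum.cong)
    also have "\<dots> = (\<Sum>c<n. if d c > 1 / 2 then U $$ (a, c) * cnj (U $$ (b, c)) else 0)"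
      unfolding r_def L_def by (rule sum_nth_filter)
    also have "\<dots> = unitary_diag n U p $$ (a, b)"
      unfolding unitary_diag_index[OF U ab] by (intro sum.cong) (auto simp: p_def)
    finally show "(V * mat_adjoint V) $$ (a, b) = unitary_diag n U p $$ (a, b)" .
  qed (use V unitary_diag_carrier[OF U, of p] in auto)
  moreover have "op_norm (unitary_diag n U p - P) \<le> 2 * op_norm (P * P - P)"
    unfolding PU unitary_diag_minus[OF U] unitary_diag_mult[OF U]
  proof (rule op_norm_unitary_diag_le[OF U])
    fix i assume i: "i < n"
    let ?e = "\<lambda>i. complex_of_real (d i) * complex_of_real (d i) - complex_of_real (d i)"
    have "cmod (?e i) \<le> op_norm (unitary_diag n U ?e)"
      by (rule cmod_le_op_norm_unitary_diag[OF U i])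
    moreover have "cmod (p i - complex_of_real (d i)) \<le> 2 * cmod (?e i)"
    proof -
      have e: "cmod (?e i) = \<bar>d i\<bar> * \<bar>d i - 1\<bar>"
      proof -
        have "?e i = complex_of_real (d i * (d i - 1))"
          by (simp only: of_real_mult of_real_diff of_real_1 right_diff_distrib mult_1_right)
        then show ?thesis by (simp only: norm_of_real abs_mult)
      qed
      show ?thesis
      proof (cases "d i > 1 / 2")
        case True
        have "cmod (p i - complex_of_real (d i)) = \<bar>d i - 1\<bar>"
          using True norm_of_real[of "1 - d i", where 'a = complex] by (simp add: p_def abs_minus_commute)
        moreover have "1 * \<bar>d i - 1\<bar> \<le> (2 * \<bar>d i\<bar>) * \<bar>d i - 1\<bar>"
          using True by (intro mult_right_mono) auto
        ultimately show ?thesis unfolding e by simp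
      next
        case False
        have "\<bar>d i\<bar> * 1 \<le> \<bar>d i\<bar> * (2 * \<bar>d i - 1\<bar>)"
          using False by (intro mult_left_mono) auto
        then show ?thesis unfolding e using False by (simp add: p_def algebra_simps)
      qed
    qed
    ultimately show "cmod (p i - complex_of_real (d i)) \<le> 2 * op_norm (unitary_diag n U ?e)"
      by linarith
  qed (simp add: op_norm_nonneg)
  ultimately show ?thesis using that[OF V] by simp
qed

lemma abs_sqrt_minus_one_le:
  assumes "0 \<le> (x :: real)"
  shows "\<bar>sqrt x - 1\<bar> \<le> \<bar>x - 1\<bar>"
proof -
  have "x - 1 = (sqrt x - 1) * (sqrt x + 1)"
    using assms by (simp add: algebra_simps)
  then have "\<bar>x - 1\<bar> = \<bar>sqrt x - 1\<bar> * (sqrt x + 1)"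
    using assms by (simp add: abs_mult)
  then show ?thesis using assms by (simp add: mult_le_cancel_left1 algebra_simps)
qed

text \<open>\<open>Y\<close> is the unitary part in the polar decomposition of \<open>X\<close>. The
  bound below 1 keeps the eigenvalues d of the adjoint of X times X positive, so that the inverse
  square root exists. As X - Y is \<open>Y\<close> times (square root minus 1), the estimate reduces
  to |sqrt d - 1| \<le> |d - 1|.\<close>

lemma near_unitary:
  assumes X: "X \<in> carrier_mat n n" and lt: "op_norm (mat_adjoint X * X - 1\<^sub>m n) < 1"
  obtains Y where "Y \<in> carrier (unitary_group n)" "op_norm (X - Y) \<le> op_norm (mat_adjoint X * X - 1\<^sub>m n)"
proof -
  note aX = mat_adjoint_carrier[OF X]
  note mc = mult_carrier_mat[of _ n n _ n]
  have sym: "mat_adjoint (mat_adjoint X * X) = mat_adjoint X * X"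
    using X aX by (simp add: mat_adjoint_mult[of _ n n _ n])
  obtain U d where U: "U \<in> carrier (unitary_group n)"
    and XU: "mat_adjoint X * X = unitary_diag n U (\<lambda>i. complex_of_real (d i))"
    by (rule hermitian_unitary_diag[OF mc[OF aX X] sym])
  let ?e = "op_norm (mat_adjoint X * X - 1\<^sub>m n)"
  note udc = unitary_diag_carrier[OF U]
  have d: "\<bar>d i - 1\<bar> \<le> ?e" if "i < n" for i
  proof -
    have "cmod (complex_of_real (d i) - 1) \<le> ?e"
      unfolding XU unitary_diag_one[OF U, symmetric] unitary_diag_minus[OF U]
      by (rule cmod_le_op_norm_unitary_diag[OF U that])
    then show ?thesis by (metis norm_of_real of_real_1 of_real_diff)
  qed
  have dpos: "0 < d i" if "i < n" for i using d[OF that] lt by linarith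
  let ?s = "unitary_diag n U (\<lambda>i. complex_of_real (sqrt (d i)))"
  \<comment> \<open>\<open>?s\<close> is the absolute value of \<open>X\<close>, and
    \<open>?t\<close> is its inverse.\<close>
  let ?t = "unitary_diag n U (\<lambda>i. complex_of_real (1 / sqrt (d i)))"
  define Y where "Y = X * ?t"
  have Y: "Y \<in> carrier_mat n n" unfolding Y_def by (rule mc[OF X udc])
  have ud_cong: "unitary_diag n U f = unitary_diag n U g" if "\<And>i. i < n \<Longrightarrow> f i = g i" for f g
    using udc[of f] udc[of g] that by (intro eq_matI) (auto simp: unitary_diag_index[OF U])
  have "mat_adjoint Y * Y = ?t * (mat_adjoint X * X) * ?t"
    unfolding Y_def using X aX udc
    by (simp add: mat_adjoint_mult[OF X udc] unitary_diag_adjoint[OF U] mc assoc_mult_mat[of _ n n _ n _ n])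
  also have "\<dots> = unitary_diag n U (\<lambda>_. 1)"
    unfolding XU unitary_diag_mult[OF U]
  proof (rule ud_cong)
    fix i assume "i < n"
    then have "1 / sqrt (d i) * d i * (1 / sqrt (d i)) = 1"
      using dpos[of i] by (simp add: field_simps)
    then show "complex_of_real (1 / sqrt (d i)) * complex_of_real (d i) * complex_of_real (1 / sqrt (d i)) = 1"
      by (metis of_real_1 of_real_mult)
  qed
  finally have YY: "mat_adjoint Y * Y = 1\<^sub>m n" by (simp add: unitary_diag_one[OF U])
  have "Y * ?s = X * (?t * ?s)"
    unfolding Y_def by (rule assoc_mult_mat[OF X udc udc])
  also have "?t * ?s = unitary_diag n U (\<lambda>_. 1)"
    unfolding unitary_diag_mult[OF U]
  proof (rule ud_cong)
    fix i assume "i < n"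
    then have "1 / sqrt (d i) * sqrt (d i) = 1" using dpos[of i] by simp
    then show "complex_of_real (1 / sqrt (d i)) * complex_of_real (sqrt (d i)) = 1"
      by (metis of_real_1 of_real_mult)
  qed
  finally have Ys: "X = Y * ?s" using X by (simp add: unitary_diag_one[OF U])
  then have "X - Y = Y * ?s - Y * 1\<^sub>m n" using Y by simp
  also have "\<dots> = Y * (?s - 1\<^sub>m n)"
    by (rule mult_minus_distrib_mat[symmetric, OF Y udc one_carrier_mat])
  finally have "op_norm (X - Y) \<le> op_norm Y * op_norm (?s - 1\<^sub>m n)"
    using op_norm_mult[OF Y, of "?s - 1\<^sub>m n" n] by (simp add: minus_carrier_mat)
  also have "\<dots> \<le> op_norm (?s - 1\<^sub>m n)"
    using op_norm_isometry_le[OF Y YY] by (intro mult_left_le_one_le) (auto simp: op_norm_nonneg)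
  also have "\<dots> \<le> ?e"
    unfolding unitary_diag_one[OF U, symmetric] unitary_diag_minus[OF U]
  proof (rule op_norm_unitary_diag_le[OF U])
    fix i assume i: "i < n"
    have "cmod (complex_of_real (sqrt (d i)) - 1) = \<bar>sqrt (d i) - 1\<bar>"
      by (metis norm_of_real of_real_1 of_real_diff)
    also have "\<dots> \<le> \<bar>d i - 1\<bar>" using dpos[OF i] by (intro abs_sqrt_minus_one_le) simp
    finally show "cmod (complex_of_real (sqrt (d i)) - 1) \<le> op_norm (mat_adjoint X * X - unitary_diag n U (\<lambda>_. 1))"
      using d[OF i] by (simp add: unitary_diag_one[OF U])
  qed (simp add: op_norm_nonneg)
  finally show ?thesis using that unitary_groupI[OF Y YY] by blast
qed

section \<open>The logarithm of the determinant near the identity\<close>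

text \<open>The difference of two lifts takes values in the integer multiples of 2 pi i, a discrete
  set, so it is constant on the connected interval.\<close>

lemma exp_lift_unique:
  fixes g h :: "real \<Rightarrow> complex"
  assumes "continuous_on {0..1} g" "continuous_on {0..1} h"
    and "\<And>x. x \<in> {0..1} \<Longrightarrow> exp (g x) = exp (h x)"
    and "g 0 = h 0" "x \<in> {0..1}"
  shows "g x = h x"
proof -
  have "(\<lambda>x. g x - h x) constant_on {0..1}"
  proof (rule continuous_discrete_range_constant)
    show "continuous_on {0..1} (\<lambda>x. g x - h x)"
      using assms by (intro continuous_intros)
    fix x :: real assume x: "x \<in> {0..1}"
    show "\<exists>e>0. \<forall>y. y \<in> {0..1} \<and> g y - h y \<noteq> g x - h x \<longrightarrow> e \<le> cmod (g y - h y - (g x - h x))"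
    proof (intro exI[of _ "2 * pi"] conjI allI impI)
      fix y assume y: "y \<in> {0..1} \<and> g y - h y \<noteq> g x - h x"
      show "2 * pi \<le> cmod (g y - h y - (g x - h x))"
      proof (rule ccontr)
        assume "\<not> 2 * pi \<le> cmod (g y - h y - (g x - h x))"
        then have "\<bar>Im (g y - h y) - Im (g x - h x)\<bar> < 2 * pi"
          using abs_Im_le_cmod[of "g y - h y - (g x - h x)"] by (simp only: minus_complex.sel)
        moreover have "exp (g y - h y) = exp (g x - h x)"
          using assms(3) x y by (simp add: exp_diff)
        ultimately show False using y exp_complex_eqI by blast
      qed
    qed simp
  qed auto
  then obtain c where "\<And>x. x \<in> {0..1} \<Longrightarrow> g x - h x = c"
    by (auto simp: constant_on_def)
  from this[of 0] this[of x] assms(4,5) show ?thesis by simp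
qed

section \<open>Eigenvalues with multiplicity and the branch of log det\<close>

definition eig_list :: "complex mat \<Rightarrow> complex list" where
  "eig_list A = (SOME es. char_poly A = (\<Prod>e\<leftarrow>es. [:- e, 1:]) \<and> length es = dim_row A)"

lemma eig_list:
  assumes "A \<in> carrier_mat n n"
  shows "char_poly A = (\<Prod>e\<leftarrow>eig_list A. [:- e, 1:])" "length (eig_list A) = n"
  using someI_ex[OF char_poly_factorized[OF assms]] assms by (auto simp: eig_list_def)

text \<open>Principal logarithms are taken eigenvalue by eigenvalue: for \<open>A\<close> near 1
  every eigenvalue is near 1, whatever the size of \<open>A\<close>, while the determinant itself
  may be far from 1.\<close>

definition log_det :: "complex mat \<Rightarrow> complex" where
  "log_det A = (\<Sum>e\<leftarrow>eig_list A. Ln e)"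

text \<open>The choice made in \<open>eig_list\<close> depends on the matrix only through its
  characteristic polynomial and its size, both of which are similarity invariants.\<close>

lemma log_det_similar: "similar_mat A B \<Longrightarrow> log_det A = log_det B"
  using similar_matD[of A B] by (auto simp: log_det_def eig_list_def char_poly_similar[of A B])

text \<open>On an eigenvector for \<open>e\<close>, the matrix A - w acts as multiplication by e -
  w.\<close>

lemma eig_list_dist:
  assumes A: "A \<in> carrier_mat n n" and e: "e \<in> set (eig_list A)"
  shows "cmod (e - w) \<le> op_norm (A - w \<cdot>\<^sub>m 1\<^sub>m n)"
proof -
  have "poly (char_poly A) e = 0"
    unfolding eig_list(1)[OF A] using e by (auto simp: poly_prod_list prod_list_zero_iff)
  then obtain v where v: "v \<in> carrier_vec n" "v \<noteq> 0\<^sub>v n" "A *\<^sub>v v = e \<cdot>\<^sub>v v"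
    using eigenvalue_root_char_poly[OF A] A by (auto simp: eigenvalue_def eigenvector_def)
  have "(A - w \<cdot>\<^sub>m 1\<^sub>m n) *\<^sub>v v = A *\<^sub>v v - (w \<cdot>\<^sub>m 1\<^sub>m n) *\<^sub>v v"
    using A v by (intro minus_mult_distrib_mat_vec) auto
  also have "(w \<cdot>\<^sub>m 1\<^sub>m n) *\<^sub>v v = w \<cdot>\<^sub>v v"
    using v by (intro eq_vecI) auto
  also have "A *\<^sub>v v - w \<cdot>\<^sub>v v = (e - w) \<cdot>\<^sub>v v"
    unfolding v(3) using v(1) by (intro eq_vecI) (auto simp: algebra_simps)
  finally have "cmod (e - w) * l2_norm_vec v \<le> op_norm (A - w \<cdot>\<^sub>m 1\<^sub>m n) * l2_norm_vec v"
    using l2_norm_mult_mat_vec[of "A - w \<cdot>\<^sub>m 1\<^sub>m n" n n v] A v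
    by (simp add: l2_norm_vec_smult minus_carrier_mat)
  moreover have "0 < l2_norm_vec v"
    using v l2_norm_vec_eq_0_iff[of v n] l2_norm_vec_nonneg[of v] by simp
  ultimately show ?thesis by simp
qed

lemma smult_one_mat [simp]: "(1 :: complex) \<cdot>\<^sub>m A = A"
  by (intro eq_matI) auto

text \<open>The similarity that makes \<open>A\<close> upper triangular with the eigenvalues on the
  diagonal does the same to every affine combination of \<open>A\<close> and 1, and the determinant
  is then the product of the diagonal.\<close>

lemma det_line:
  assumes A: "A \<in> carrier_mat n n"
  shows "Determinant.det (1\<^sub>m n + x \<cdot>\<^sub>m (A - 1\<^sub>m n)) = (\<Prod>e\<leftarrow>eig_list A. 1 + x * (e - 1))"
proof -
  obtain B P Q where dec: "schur_decomposition A (eig_list A) = (B, P, Q)"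
    by (cases "schur_decomposition A (eig_list A)")
  have sim: "similar_mat_wit A B P Q" and ut: "upper_triangular B" and dg: "diag_mat B = eig_list A"
    using schur_decomposition[OF A eig_list(1)[OF A] dec] by auto
  note w = similar_mat_witD2[OF A sim]
  define C where "C = 1\<^sub>m n + x \<cdot>\<^sub>m (B - 1\<^sub>m n)"
  have C: "C \<in> carrier_mat n n" using w by (simp add: C_def minus_carrier_mat)
  have "P * C * Q = (P * 1\<^sub>m n + P * (x \<cdot>\<^sub>m (B - 1\<^sub>m n))) * Q"
    unfolding C_def using w by (subst mult_add_distrib_mat[of _ n n _ n]) (auto simp: minus_carrier_mat)
  also have "P * (x \<cdot>\<^sub>m (B - 1\<^sub>m n)) = x \<cdot>\<^sub>m (P * (B - 1\<^sub>m n))"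
    using w by (intro mult_smult_distrib[of _ n n _ n]) (auto simp: minus_carrier_mat)
  also have "P * (B - 1\<^sub>m n) = P * B - P * 1\<^sub>m n"
    using w by (intro mult_minus_distrib_mat[of _ n n _ n]) auto
  also have "(P * 1\<^sub>m n + x \<cdot>\<^sub>m (P * B - P * 1\<^sub>m n)) * Q = P * Q + (x \<cdot>\<^sub>m (P * B - P)) * Q"
    using w by (subst add_mult_distrib_mat[of _ n n _ _ n]) (auto simp: minus_carrier_mat)
  also have "(x \<cdot>\<^sub>m (P * B - P)) * Q = x \<cdot>\<^sub>m ((P * B - P) * Q)"
    using w by (intro mult_smult_assoc_mat[of _ n n _ n]) (auto simp: minus_carrier_mat)
  also have "(P * B - P) * Q = P * B * Q - P * Q"
    using w by (intro minus_mult_distrib_mat[of _ n n _ _ n]) auto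
  finally have "1\<^sub>m n + x \<cdot>\<^sub>m (A - 1\<^sub>m n) = P * C * Q"
    using w by simp
  then have "similar_mat (1\<^sub>m n + x \<cdot>\<^sub>m (A - 1\<^sub>m n)) C"
    using w C A by (intro similar_matI[of _ _ P Q n]) (auto simp: minus_carrier_mat)
  then have "Determinant.det (1\<^sub>m n + x \<cdot>\<^sub>m (A - 1\<^sub>m n)) = Determinant.det C"
    by (rule det_similar)
  also have "\<dots> = prod_list (diag_mat C)"
    using ut w C by (intro det_upper_triangular[of _ n]) (auto simp: C_def upper_triangular_def)
  also have "diag_mat C = map (\<lambda>e. 1 + x * (e - 1)) (diag_mat B)"
    using w C by (auto simp: diag_mat_def C_def)
  finally show ?thesis by (simp add: dg)
qed

text \<open>Each eigenvalue lies in the open unit disc around 1, so the segment from 1 to it stays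
  in the right half plane, away from 0 and from the branch cut of \<open>Ln\<close>.\<close>

lemma det_line_nonzero:
  assumes A: "A \<in> carrier_mat n n" and lt: "op_norm (A - 1\<^sub>m n) < 1" and x: "x \<in> {0..1}"
  shows "Determinant.det (1\<^sub>m n + complex_of_real x \<cdot>\<^sub>m (A - 1\<^sub>m n)) \<noteq> 0"
  and "e \<in> set (eig_list A) \<Longrightarrow> 1 + complex_of_real x * (e - 1) \<notin> \<real>\<^sub>\<le>\<^sub>0"
proof -
  have pos: "1 + complex_of_real x * (e - 1) \<notin> \<real>\<^sub>\<le>\<^sub>0" if e: "e \<in> set (eig_list A)" for e
  proof -
    have "cmod (e - 1) < 1"
      using eig_list_dist[OF A e, of 1] lt by simp
    then have "x * cmod (e - 1) < 1"
      using x by (smt (verit, best) atLeastAtMost_iff mult_left_le_one_le norm_ge_zero)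
    then have "cmod (complex_of_real x * (e - 1)) < 1"
      using x by (simp add: norm_mult)
    then have "\<bar>Re (complex_of_real x * (e - 1))\<bar> < 1"
      using abs_Re_le_cmod le_less_trans by blast
    then have "0 < Re (1 + complex_of_real x * (e - 1))" by simp
    then show ?thesis by (auto simp: complex_nonpos_Reals_iff)
  qed
  then show "e \<in> set (eig_list A) \<Longrightarrow> 1 + complex_of_real x * (e - 1) \<notin> \<real>\<^sub>\<le>\<^sub>0" .
  show "Determinant.det (1\<^sub>m n + complex_of_real x \<cdot>\<^sub>m (A - 1\<^sub>m n)) \<noteq> 0"
    unfolding det_line[OF A] using pos by (force simp: prod_list_zero_iff)
qed

lemma exp_sum_list: "exp (\<Sum>x\<leftarrow>xs. f x) = (\<Prod>x\<leftarrow>xs. exp (f x))" for f :: "'b \<Rightarrow> complex"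
  by (induction xs) (auto simp: exp_add)

lemma continuous_on_sum_list:
  fixes f :: "'c \<Rightarrow> 'a :: topological_space \<Rightarrow> complex"
  assumes "\<And>e. e \<in> set es \<Longrightarrow> continuous_on S (f e)"
  shows "continuous_on S (\<lambda>x. \<Sum>e\<leftarrow>es. f e x)"
  using assms by (induction es) (auto intro!: continuous_intros)

text \<open>\<^const>\<open>log_det\<close> is the end point of the lift of the determinant along a line segment.\<close>

lemma log_det_path:
  assumes A: "A \<in> carrier_mat n n" and lt: "op_norm (A - 1\<^sub>m n) < 1"
  obtains g where "continuous_on {0..1} g" "g 0 = 0" "g 1 = log_det A"
    "\<And>x. x \<in> {0..1} \<Longrightarrow> exp (g x) = Determinant.det (1\<^sub>m n + complex_of_real x \<cdot>\<^sub>m (A - 1\<^sub>m n))"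
proof
  let ?g = "\<lambda>x. \<Sum>e\<leftarrow>eig_list A. Ln (1 + complex_of_real x * (e - 1))"
  note nz = det_line_nonzero(2)[OF A lt]
  show "continuous_on {0..1} ?g"
    by (intro continuous_on_sum_list continuous_intros) (use nz in auto)
  show "?g 0 = 0" by (simp add: sum_list_triv)
  show "?g 1 = log_det A" by (simp add: log_det_def)
  fix x :: real assume x: "x \<in> {0..1}"
  have "1 + complex_of_real x * (e - 1) \<noteq> 0" if "e \<in> set (eig_list A)" for e
    using nz[OF x that] by force
  then show "exp (?g x) = Determinant.det (1\<^sub>m n + complex_of_real x \<cdot>\<^sub>m (A - 1\<^sub>m n))"
    unfolding det_line[OF A] exp_sum_list
    by (intro arg_cong[where f = prod_list] map_cong) auto
qed

text \<open>Recognises \<open>log_det\<close> from any continuous logarithm of the determinant along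
  the segment from 1 to \<open>A\<close>, without access to eigenvalues. This is how the logarithm
  of a product becomes accessible.\<close>

lemma log_det_eqI:
  assumes A: "A \<in> carrier_mat n n" and lt: "op_norm (A - 1\<^sub>m n) < 1"
    and g: "continuous_on {0..1} g" "g 0 = 0"
    "\<And>x. x \<in> {0..1} \<Longrightarrow> exp (g x) = Determinant.det (1\<^sub>m n + complex_of_real x \<cdot>\<^sub>m (A - 1\<^sub>m n))"
  shows "g 1 = log_det A"
proof -
  obtain h where h: "continuous_on {0..1} h" "h 0 = 0" "h 1 = log_det A"
    "\<And>x. x \<in> {0..1} \<Longrightarrow> exp (h x) = Determinant.det (1\<^sub>m n + complex_of_real x \<cdot>\<^sub>m (A - 1\<^sub>m n))"
    using log_det_path[OF A lt] by blast
  have "g 1 = h 1"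
    by (rule exp_lift_unique) (use g h in auto)
  then show ?thesis using h by simp
qed

lemma continuous_on_det:
  fixes F :: "'a :: topological_space \<Rightarrow> complex mat"
  assumes "\<And>z. z \<in> S \<Longrightarrow> F z \<in> carrier_mat n n"
    and "\<And>i j. i < n \<Longrightarrow> j < n \<Longrightarrow> continuous_on S (\<lambda>z. F z $$ (i, j))"
  shows "continuous_on S (\<lambda>z. Determinant.det (F z))"
proof -
  have "continuous_on S (\<lambda>z. \<Sum>p\<in>{p. p permutes {0..<n}}. signof p * (\<Prod>i = 0..<n. F z $$ (i, p i)))"
  proof (intro continuous_intros)
    fix p i assume "p \<in> {p. p permutes {0..<n}}" "i \<in> {0..<n}"
    then have "p i < n" by (auto dest: permutes_in_image[of p _ i])
    then show "continuous_on S (\<lambda>z. F z $$ (i, p i))"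
      using assms(2) \<open>i \<in> {0..<n}\<close> by auto
  qed
  then show ?thesis
    by (rule continuous_on_eq) (simp add: det_def'[OF assms(1)])
qed

text \<open>The expansion gives 1/3 + 1/3 + 1/9 = 7/9. This is the origin of the threshold 1/3 for
  additivity of \<open>log_det\<close>.\<close>

lemma op_norm_one_plus_mult:
  assumes "A \<in> carrier_mat n n" "B \<in> carrier_mat n n" "op_norm A \<le> 1 / 3" "op_norm B \<le> 1 / 3"
  shows "op_norm ((1\<^sub>m n + A) * (1\<^sub>m n + B) - 1\<^sub>m n) < 1"
proof -
  have "(1\<^sub>m n + A) * (1\<^sub>m n + B) - 1\<^sub>m n = A + B + A * B"
  proof -
    have "(1\<^sub>m n + A) * (1\<^sub>m n + B) = (1\<^sub>m n + A) + (1\<^sub>m n + A) * B"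
      using assms by (subst mult_add_distrib_mat[of _ n n _ n]) auto
    also have "(1\<^sub>m n + A) * B = B + A * B"
      using assms by (subst add_mult_distrib_mat[of _ n n _ _ n]) auto
    finally have "(1\<^sub>m n + A) * (1\<^sub>m n + B) = (1\<^sub>m n + A) + (B + A * B)" .
    then show ?thesis using assms by (intro eq_matI) (auto simp del: index_mult_mat(1))
  qed
  then have "op_norm ((1\<^sub>m n + A) * (1\<^sub>m n + B) - 1\<^sub>m n) \<le> op_norm (A + B) + op_norm (A * B)"
    using assms op_norm_add[of "A + B" n n "A * B"] by simp
  also have "\<dots> \<le> op_norm A + op_norm B + op_norm A * op_norm B"
    using assms by (intro add_mono op_norm_add op_norm_mult) auto
  also have "op_norm A * op_norm B \<le> 1 / 3 * (1 / 3)"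
    using assms by (intro mult_mono) (auto simp: op_norm_nonneg)
  finally show ?thesis using assms by simp
qed

text \<open>Let A_t and B_t be the segments from 1 to \<open>A\<close> and \<open>B\<close>, and
  D(t, x) = det (1 + x (A_t B_t - 1)) on the unit square. It vanishes nowhere, so it has a
  continuous logarithm \<open>g\<close>. On the edges x = 0 and t = 0 it is constantly 1, hence
  \<open>g\<close> is constant there. The change of \<open>g\<close> from (0, 0) to (1, 1) is then
  read off along the edge t = 1, giving \<open>log_det\<close> of the product, and along the edge x
  = 1, where D is det A_t times det B_t, giving the sum.\<close>

lemma log_det_mult:
  assumes A: "A \<in> carrier_mat n n" "op_norm (A - 1\<^sub>m n) \<le> 1 / 3"
    and B: "B \<in> carrier_mat n n" "op_norm (B - 1\<^sub>m n) \<le> 1 / 3"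
  shows "log_det (A * B) = log_det A + log_det B"
proof -
  let ?S = "{0..1 :: real} \<times> {0..1 :: real}"
  define lin where "lin = (\<lambda>C t. 1\<^sub>m n + complex_of_real t \<cdot>\<^sub>m (C - 1\<^sub>m n))"
  have lin: "lin C t \<in> carrier_mat n n" if "C \<in> carrier_mat n n" for C t
    using that by (simp add: lin_def minus_carrier_mat)
  have lin0: "lin C 0 = 1\<^sub>m n" and lin1: "lin C 1 = C" if "C \<in> carrier_mat n n" for C
    using that by (auto simp: lin_def intro!: eq_matI)
  have lin_one: "lin (1\<^sub>m n) x = 1\<^sub>m n" for x
    by (auto simp: lin_def intro!: eq_matI)
  define M where "M = (\<lambda>t. lin A t * lin B t)"
  have M: "M t \<in> carrier_mat n n" for t
    unfolding M_def using lin A B by (intro mult_carrier_mat)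
  have M1: "M 1 = A * B" using lin1 A B by (simp add: M_def)
  have M0: "M 0 = 1\<^sub>m n" using lin0 A B by (simp add: M_def)
  have Mlt: "op_norm (M t - 1\<^sub>m n) < 1" if "t \<in> {0..1}" for t
  proof -
    have *: "op_norm (complex_of_real t \<cdot>\<^sub>m (C - 1\<^sub>m n)) \<le> 1 / 3"
      if "C \<in> carrier_mat n n" "op_norm (C - 1\<^sub>m n) \<le> 1 / 3" for C
    proof -
      have "op_norm (complex_of_real t \<cdot>\<^sub>m (C - 1\<^sub>m n)) \<le> t * op_norm (C - 1\<^sub>m n)"
        using op_norm_smult_le[of "C - 1\<^sub>m n" n n "complex_of_real t"] that \<open>t \<in> _\<close>
        by (simp add: minus_carrier_mat)
      also have "\<dots> \<le> op_norm (C - 1\<^sub>m n)"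
        using \<open>t \<in> _\<close> by (intro mult_left_le_one_le) (auto simp: op_norm_nonneg)
      finally show ?thesis using that by simp
    qed
    show ?thesis unfolding M_def lin_def
      by (rule op_norm_one_plus_mult) (use A B * in \<open>auto simp: minus_carrier_mat\<close>)
  qed
  define D where "D = (\<lambda>z. Determinant.det (lin (M (fst z)) (snd z)))"
  have contD: "continuous_on ?S D"
    unfolding D_def
  proof (rule continuous_on_det[where n = n])
    show "lin (M (fst z)) (snd z) \<in> carrier_mat n n" for z
      using lin M by blast
    fix i j assume ij: "i < n" "j < n"
    let ?l = "\<lambda>C t i j. (if i = j then 1 else 0) + complex_of_real t * (C $$ (i, j) - (if i = j then 1 else 0))"
    have l: "lin C t $$ (i, j) = ?l C t i j" if "C \<in> carrier_mat n n" "i < n" "j < n" for C t i j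
      using that by (simp add: lin_def)
    have Mt: "M t $$ (i, j) = (\<Sum>k<n. ?l A t i k * ?l B t k j)" for t
    proof -
      have "M t $$ (i, j) = (\<Sum>k<n. lin A t $$ (i, k) * lin B t $$ (k, j))"
        unfolding M_def using lin[OF A(1), of t] lin[OF B(1), of t] ij
        by (auto simp: scalar_prod_def lessThan_atLeast0 intro!: sum.cong)
      also have "\<dots> = (\<Sum>k<n. ?l A t i k * ?l B t k j)"
        using ij A B by (intro sum.cong) (simp_all only: l lessThan_iff)
      finally show ?thesis .
    qed
    show "continuous_on ?S (\<lambda>z. lin (M (fst z)) (snd z) $$ (i, j))"
      unfolding l[OF M ij] Mt by (intro continuous_intros)
  qed
  have nzD: "D z \<noteq> 0" if "z \<in> ?S" for z
    using det_line_nonzero(1)[OF M Mlt, of "fst z" "snd z"] that by (auto simp: D_def lin_def)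
  have "contractible ?S"
    by (intro convex_imp_contractible convex_Times) auto
  then obtain g where g: "continuous_on ?S g" and gD: "\<And>z. z \<in> ?S \<Longrightarrow> D z = exp (g z)"
    using continuous_logarithm_on_contractible[OF contD _ nzD] by metis
  have cont1: "continuous_on {0..1} (\<lambda>x. g (a x, b x))"
    if "continuous_on {0..1} a" "continuous_on {0..1} b" "\<And>x. x \<in> {0..1} \<Longrightarrow> (a x, b x) \<in> ?S" for a b
    by (rule continuous_on_compose2[OF g]) (use that in \<open>auto intro!: continuous_intros\<close>)
  have D0: "D (t, 0) = 1" for t using lin0[OF M] by (simp add: D_def)
  have D1: "D (0, x) = 1" for x by (simp add: D_def M0 lin_one)
  \<comment> \<open>Both constant edges compare \<open>g\<close> with a constant lift of 1.\<close>
  have g10: "g (1, 0) = g (0, 0)"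
    by (rule exp_lift_unique[of "\<lambda>t. g (t, 0)" "\<lambda>_. g (0, 0)" 1])
      (auto intro!: cont1 continuous_intros simp: gD[symmetric] D0)
  have g01: "g (0, 1) = g (0, 0)"
    by (rule exp_lift_unique[of "\<lambda>x. g (0, x)" "\<lambda>_. g (0, 0)" 1])
      (auto intro!: cont1 continuous_intros simp: gD[symmetric] D1)
  have e00: "exp (g (0, 0)) = 1" using gD[of "(0, 0)"] D0[of 0] by simp
  \<comment> \<open>Subtracting g(0, 0), an integer multiple of 2 pi i, makes the lift start at
    0.\<close>
  have "g (1, 1) - g (0, 0) = log_det (A * B)"
  proof (rule log_det_eqI[of "A * B" n "\<lambda>x. g (1, x) - g (0, 0)"])
    show "continuous_on {0..1} (\<lambda>x. g (1, x) - g (0, 0))"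
      by (intro continuous_intros cont1) auto
    show "exp (g (1, x) - g (0, 0)) = Determinant.det (1\<^sub>m n + complex_of_real x \<cdot>\<^sub>m (A * B - 1\<^sub>m n))"
      if "x \<in> {0..1}" for x
      using that gD[of "(1, x)"] by (simp add: exp_diff e00 D_def M1 lin_def)
  qed (use A B Mlt[of 1] g10 M1 in auto)
  moreover have Alt: "op_norm (A - 1\<^sub>m n) < 1" and Blt: "op_norm (B - 1\<^sub>m n) < 1"
    using A(2) B(2) by simp_all
  moreover obtain hA where hA: "continuous_on {0..1} hA" "hA 0 = 0" "hA 1 = log_det A"
    "\<And>x. x \<in> {0..1} \<Longrightarrow> exp (hA x) = Determinant.det (1\<^sub>m n + complex_of_real x \<cdot>\<^sub>m (A - 1\<^sub>m n))"
    by (rule log_det_path[OF A(1) Alt]) (rule that)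
  moreover obtain hB where hB: "continuous_on {0..1} hB" "hB 0 = 0" "hB 1 = log_det B"
    "\<And>x. x \<in> {0..1} \<Longrightarrow> exp (hB x) = Determinant.det (1\<^sub>m n + complex_of_real x \<cdot>\<^sub>m (B - 1\<^sub>m n))"
    by (rule log_det_path[OF B(1) Blt]) (rule that)
  \<comment> \<open>On the edge x = 1 the determinant is multiplicative, so the sum of the lifts for
    \<open>A\<close> and \<open>B\<close> is a lift with the same start.\<close>
  moreover have "g (1, 1) - g (0, 0) = hA 1 + hB 1"
  proof (rule exp_lift_unique[of "\<lambda>t. g (t, 1) - g (0, 0)" "\<lambda>t. hA t + hB t" 1])
    show "continuous_on {0..1} (\<lambda>t. g (t, 1) - g (0, 0))"
      by (intro continuous_intros cont1) auto
    show "continuous_on {0..1} (\<lambda>t. hA t + hB t)"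
      using hA hB by (intro continuous_intros)
    show "exp (g (t, 1) - g (0, 0)) = exp (hA t + hB t)" if "t \<in> {0..1}" for t
    proof -
      have "exp (g (t, 1) - g (0, 0)) = D (t, 1)"
        using that gD[of "(t, 1)"] by (simp add: exp_diff e00)
      also have "\<dots> = Determinant.det (M t)" using lin1[OF M] by (simp add: D_def)
      also have "\<dots> = Determinant.det (lin A t) * Determinant.det (lin B t)"
        unfolding M_def by (rule det_mult[OF lin[OF A(1)] lin[OF B(1)]])
      finally show ?thesis using that hA(4) hB(4) by (simp add: exp_add lin_def)
    qed
  qed (use g01 hA hB in auto)
  ultimately show ?thesis by simp
qed

lemma log_det_one: "log_det (1\<^sub>m n) = 0"
proof -
  have "e = 1" if "e \<in> set (eig_list (1\<^sub>m n))" for e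
  proof -
    have "1\<^sub>m n - 1 \<cdot>\<^sub>m 1\<^sub>m n = (0\<^sub>m n n :: complex mat)" by (intro eq_matI) auto
    then have "op_norm (1\<^sub>m n - 1 \<cdot>\<^sub>m 1\<^sub>m n) = 0" by (simp only: op_norm_zero)
    moreover have "cmod (e - 1) \<le> op_norm (1\<^sub>m n - 1 \<cdot>\<^sub>m 1\<^sub>m n)"
      by (rule eig_list_dist[OF one_carrier_mat that])
    ultimately have "cmod (e - 1) = 0" by (simp only: order_antisym norm_ge_zero)
    then show ?thesis by simp
  qed
  then have "map Ln (eig_list (1\<^sub>m n)) = map (\<lambda>_. 0) (eig_list (1\<^sub>m n))"
    by (intro map_cong refl) (metis Ln_1)
  then have "log_det (1\<^sub>m n) = (\<Sum>_\<leftarrow>eig_list (1\<^sub>m n). 0)" by (simp only: log_det_def)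
  then show ?thesis by simp
qed

text \<open>On the disc of radius 1/2 around 1, which is convex and avoids the cut, the derivative
  1/u has modulus at most 2.\<close>

lemma Ln_lipschitz:
  assumes "cmod (z - 1) \<le> 1 / 2" "cmod (w - 1) \<le> 1 / 2"
  shows "cmod (Ln z - Ln w) \<le> 2 * cmod (z - w)"
proof (rule field_differentiable_bound[of "cball 1 (1 / 2)" Ln inverse])
  fix u :: complex assume u: "u \<in> cball 1 (1 / 2)"
  then have c: "cmod (u - 1) \<le> 1 / 2" by (simp add: dist_norm norm_minus_commute)
  then have "\<bar>Re (u - 1)\<bar> \<le> 1 / 2" using abs_Re_le_cmod order_trans by blast
  then have "\<bar>Re u - 1\<bar> \<le> 1 / 2" by simp
  then have "0 < Re u" by linarith
  then show "(Ln has_field_derivative inverse u) (at u within cball 1 (1 / 2))"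
    by (intro has_field_derivative_Ln has_field_derivative_at_within) (auto simp: complex_nonpos_Reals_iff)
  have "1 / 2 \<le> cmod u" using c norm_triangle_ineq2[of 1 "1 - u"] by (simp add: norm_minus_commute)
  then have "inverse (cmod u) \<le> inverse (1 / 2)" by (intro le_imp_inverse_le) auto
  then show "cmod (inverse u) \<le> 2" by (simp add: norm_inverse)
qed (use assms in \<open>auto simp: dist_norm norm_minus_commute\<close>)

text \<open>All n eigenvalues lie within \<epsilon> of \<open>w\<close>, and 1/4 + 1/4 keeps them in
  the disc where \<open>Ln\<close> has Lipschitz constant 2. The factor n in the bound cancels later
  against the same factor in the main term.\<close>

lemma log_det_near_scalar:
  assumes A: "A \<in> carrier_mat n n" and w: "cmod (w - 1) \<le> 1 / 4"
    and e: "op_norm (A - w \<cdot>\<^sub>m 1\<^sub>m n) \<le> \<epsilon>" "\<epsilon> \<le> 1 / 4"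
  shows "cmod (log_det A - of_nat n * Ln w) \<le> 2 * real n * \<epsilon>"
proof -
  have "cmod (Ln u - Ln w) \<le> 2 * \<epsilon>" if "u \<in> set (eig_list A)" for u
  proof -
    have d: "cmod (u - w) \<le> \<epsilon>" using eig_list_dist[OF A that, of w] e by linarith
    have "cmod (u - 1) \<le> cmod (u - w) + cmod (w - 1)"
      using norm_triangle_ineq[of "u - w" "w - 1"] by simp
    then have "cmod (Ln u - Ln w) \<le> 2 * cmod (u - w)"
      using d e w by (intro Ln_lipschitz) linarith+
    then show ?thesis using d by linarith
  qed
  \<comment> \<open>Stated for all lists with entries among the eigenvalues, so that induction on
    the list applies.\<close>
  then have "cmod ((\<Sum>u\<leftarrow>es. Ln u) - of_nat (length es) * Ln w) \<le> 2 * real (length es) * \<epsilon>"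
    if "set es \<subseteq> set (eig_list A)" for es
    using that
  proof (induction es)
    case (Cons u es)
    have "(\<Sum>v\<leftarrow>u # es. Ln v) - of_nat (length (u # es)) * Ln w =
        (Ln u - Ln w) + ((\<Sum>u\<leftarrow>es. Ln u) - of_nat (length es) * Ln w)"
      by (simp add: algebra_simps)
    also have "cmod \<dots> \<le> cmod (Ln u - Ln w) + cmod ((\<Sum>u\<leftarrow>es. Ln u) - of_nat (length es) * Ln w)"
      by (rule norm_triangle_ineq)
    also have "\<dots> \<le> 2 * \<epsilon> + 2 * real (length es) * \<epsilon>"
      using Cons by (intro add_mono) auto
    finally show ?case by (simp add: algebra_simps)
  qed simp
  from this[of "eig_list A"] show ?thesis by (simp add: log_det_def eig_list(2)[OF A])
qed

section \<open>Bounded sequences of matrices and the corona algebra\<close>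

text \<open>Row and column sizes vary separately because the isometries used for compression are
  rectangular.\<close>

definition bounded_mats :: "(nat \<Rightarrow> nat) \<Rightarrow> (nat \<Rightarrow> nat) \<Rightarrow> (nat \<Rightarrow> complex mat) \<Rightarrow> bool" where
  "bounded_mats d e X \<longleftrightarrow> (\<forall>i. X i \<in> carrier_mat (d i) (e i)) \<and> bdd_above (range (\<lambda>i. op_norm (X i)))"

text \<open>Equality modulo null sequences, at the level of representatives. Boundedness of both
  sides is built in, since it makes the relation compatible with products.\<close>

definition asymp_mats :: "(nat \<Rightarrow> nat) \<Rightarrow> (nat \<Rightarrow> nat) \<Rightarrow> (nat \<Rightarrow> complex mat) \<Rightarrow> (nat \<Rightarrow> complex mat) \<Rightarrow> bool" where
  "asymp_mats d e X Y \<longleftrightarrow> bounded_mats d e X \<and> bounded_mats d e Y \<and> (\<lambda>i. op_norm (X i - Y i)) \<longlonglongrightarrow> 0"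

lemma op_norm_tendsto_zeroI:
  assumes "\<And>i. op_norm (X i) \<le> g i" "g \<longlonglongrightarrow> 0"
  shows "(\<lambda>i. op_norm (X i)) \<longlonglongrightarrow> 0"
  by (rule Lim_null_comparison[OF always_eventually assms(2)]) (simp add: assms(1) op_norm_nonneg)

lemma bounded_matsD: "bounded_mats d e X \<Longrightarrow> X i \<in> carrier_mat (d i) (e i)"
  by (simp add: bounded_mats_def)

lemma bounded_matsI:
  assumes "\<And>i. X i \<in> carrier_mat (d i) (e i)" "\<And>i. op_norm (X i) \<le> K"
  shows "bounded_mats d e X"
  using assms by (auto simp: bounded_mats_def intro!: bdd_aboveI2)

lemma bounded_matsE:
  assumes "bounded_mats d e X"
  obtains K where "0 \<le> K" "\<And>i. op_norm (X i) \<le> K"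
proof -
  obtain K where "\<And>i. op_norm (X i) \<le> K"
    using assms by (auto simp: bounded_mats_def bdd_above_def)
  moreover from this[of 0] have "0 \<le> K" using op_norm_nonneg order_trans by blast
  ultimately show ?thesis using that by blast
qed

lemma bounded_mats_mult:
  assumes X: "bounded_mats d e X" and Y: "bounded_mats e f Y"
  shows "bounded_mats d f (\<lambda>i. X i * Y i)"
proof -
  obtain K L where K: "0 \<le> K" "\<And>i. op_norm (X i) \<le> K" and L: "0 \<le> L" "\<And>i. op_norm (Y i) \<le> L"
    using bounded_matsE[OF X] bounded_matsE[OF Y] by metis
  show ?thesis
  proof (rule bounded_matsI)
    fix i
    show "X i * Y i \<in> carrier_mat (d i) (f i)"
      by (rule mult_carrier_mat[OF bounded_matsD[OF X] bounded_matsD[OF Y]])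
    have "op_norm (X i * Y i) \<le> op_norm (X i) * op_norm (Y i)"
      by (rule op_norm_mult[OF bounded_matsD[OF X] bounded_matsD[OF Y]])
    also have "\<dots> \<le> K * L"
      using K L by (intro mult_mono) (auto simp: op_norm_nonneg)
    finally show "op_norm (X i * Y i) \<le> K * L" .
  qed
qed

lemma bounded_mats_smult:
  assumes X: "bounded_mats d e X"
  shows "bounded_mats d e (\<lambda>i. c \<cdot>\<^sub>m X i)"
proof -
  obtain K where K: "0 \<le> K" "\<And>i. op_norm (X i) \<le> K" using bounded_matsE[OF X] by metis
  show ?thesis
  proof (rule bounded_matsI)
    fix i
    show "c \<cdot>\<^sub>m X i \<in> carrier_mat (d i) (e i)" using bounded_matsD[OF X] by simp
    show "op_norm (c \<cdot>\<^sub>m X i) \<le> cmod c * K"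
      using op_norm_smult_le[OF bounded_matsD[OF X]] K(2)[of i]
      by (meson mult_left_mono norm_ge_zero order_trans)
  qed
qed

lemma bounded_mats_adjoint:
  assumes X: "bounded_mats d e X"
  shows "bounded_mats e d (\<lambda>i. mat_adjoint (X i))"
proof -
  obtain K where K: "0 \<le> K" "\<And>i. op_norm (X i) \<le> K" using bounded_matsE[OF X] by metis
  show ?thesis
    by (rule bounded_matsI[of _ _ _ K])
      (use bounded_matsD[OF X] K op_norm_adjoint[OF bounded_matsD[OF X]] in auto)
qed

text \<open>Boundedness of \<open>X\<close> comes for free: a convergent sequence of distances is
  bounded.\<close>

lemma asymp_matsI:
  assumes Y: "bounded_mats d e Y" and X: "\<And>i. X i \<in> carrier_mat (d i) (e i)"
    and lim: "(\<lambda>i. op_norm (X i - Y i)) \<longlonglongrightarrow> 0"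
  shows "asymp_mats d e X Y"
proof -
  obtain K where K: "0 \<le> K" "\<And>i. op_norm (Y i) \<le> K" using bounded_matsE[OF Y] by metis
  obtain L where L: "\<And>i. op_norm (X i - Y i) \<le> L"
    using convergent_imp_Bseq[OF convergentI[OF lim]] op_norm_nonneg by (auto simp: Bseq_def)
  have "bounded_mats d e X"
  proof (rule bounded_matsI[OF X])
    fix i
    have "X i = (X i - Y i) + Y i"
      using X[of i] bounded_matsD[OF Y, of i] by (intro eq_matI) auto
    then have "op_norm (X i) \<le> op_norm (X i - Y i) + op_norm (Y i)"
      using op_norm_add[of "X i - Y i" "d i" "e i" "Y i"] bounded_matsD[OF Y, of i]
      by (metis minus_carrier_mat)
    then show "op_norm (X i) \<le> L + K" using K(2)[of i] L[of i] by linarith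
  qed
  then show ?thesis using Y lim by (simp add: asymp_mats_def)
qed

lemma asymp_mats_refl: "bounded_mats d e X \<Longrightarrow> asymp_mats d e X X"
proof (rule asymp_matsI)
  assume X: "bounded_mats d e X"
  have "X i - X i = 0\<^sub>m (d i) (e i)" for i using bounded_matsD[OF X, of i] by (intro eq_matI) auto
  then show "(\<lambda>i. op_norm (X i - X i)) \<longlonglongrightarrow> 0" by simp
qed (auto dest: bounded_matsD)

lemma asymp_mats_sym:
  assumes "asymp_mats d e X Y"
  shows "asymp_mats d e Y X"
proof -
  have b: "bounded_mats d e X" "bounded_mats d e Y" and l: "(\<lambda>i. op_norm (X i - Y i)) \<longlonglongrightarrow> 0"
    using assms by (auto simp: asymp_mats_def)
  have "op_norm (Y i - X i) = op_norm (X i - Y i)" for i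
    by (rule op_norm_minus_commute[OF bounded_matsD[OF b(2)] bounded_matsD[OF b(1)]])
  then show ?thesis using b l by (simp add: asymp_mats_def)
qed

lemma asymp_mats_trans [trans]:
  assumes "asymp_mats d e X Y" "asymp_mats d e Y Z"
  shows "asymp_mats d e X Z"
proof -
  have b: "bounded_mats d e X" "bounded_mats d e Y" "bounded_mats d e Z"
    and l: "(\<lambda>i. op_norm (X i - Y i)) \<longlonglongrightarrow> 0" "(\<lambda>i. op_norm (Y i - Z i)) \<longlonglongrightarrow> 0"
    using assms by (auto simp: asymp_mats_def)
  have "(\<lambda>i. op_norm (X i - Y i) + op_norm (Y i - Z i)) \<longlonglongrightarrow> 0"
    using tendsto_add[OF l] by simp
  then have "(\<lambda>i. op_norm (X i - Z i)) \<longlonglongrightarrow> 0"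
    by (rule op_norm_tendsto_zeroI[rotated])
      (rule op_norm_triangle[OF bounded_matsD[OF b(1)] bounded_matsD[OF b(2)] bounded_matsD[OF b(3)]])
  then show ?thesis using b by (simp add: asymp_mats_def)
qed

lemma asymp_mats_mult:
  assumes "asymp_mats d e X X'" "asymp_mats e f Y Y'"
  shows "asymp_mats d f (\<lambda>i. X i * Y i) (\<lambda>i. X' i * Y' i)"
proof -
  have b: "bounded_mats d e X" "bounded_mats d e X'" "bounded_mats e f Y" "bounded_mats e f Y'"
    and l: "(\<lambda>i. op_norm (X i - X' i)) \<longlonglongrightarrow> 0" "(\<lambda>i. op_norm (Y i - Y' i)) \<longlonglongrightarrow> 0"
    using assms by (auto simp: asymp_mats_def)
  note c = bounded_matsD[OF b(1)] bounded_matsD[OF b(2)] bounded_matsD[OF b(3)] bounded_matsD[OF b(4)]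
  obtain K L where K: "0 \<le> K" "\<And>i. op_norm (X' i) \<le> K" and L: "0 \<le> L" "\<And>i. op_norm (Y i) \<le> L"
    using bounded_matsE[OF b(2)] bounded_matsE[OF b(3)] by metis
  have bound: "op_norm (X i * Y i - X' i * Y' i) \<le> op_norm (X i - X' i) * L + K * op_norm (Y i - Y' i)" for i
  proof -
    have "op_norm (X i * Y i - X' i * Y' i) \<le>
        op_norm (X i * Y i - X' i * Y i) + op_norm (X' i * Y i - X' i * Y' i)"
      by (rule op_norm_triangle) (auto intro!: mult_carrier_mat c)
    also have "X i * Y i - X' i * Y i = (X i - X' i) * Y i"
      by (rule minus_mult_distrib_mat[symmetric, OF c(1) c(2) c(3)])
    also have "X' i * Y i - X' i * Y' i = X' i * (Y i - Y' i)"
      by (rule mult_minus_distrib_mat[symmetric, OF c(2) c(3) c(4)])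
    also have "op_norm ((X i - X' i) * Y i) + op_norm (X' i * (Y i - Y' i)) \<le>
        op_norm (X i - X' i) * op_norm (Y i) + op_norm (X' i) * op_norm (Y i - Y' i)"
      by (intro add_mono op_norm_mult[OF minus_carrier_mat[OF c(2)] c(3)]
          op_norm_mult[OF c(2) minus_carrier_mat[OF c(4)]])
    also have "\<dots> \<le> op_norm (X i - X' i) * L + K * op_norm (Y i - Y' i)"
      using K L by (intro add_mono mult_mono) (auto simp: op_norm_nonneg)
    finally show ?thesis .
  qed
  have "(\<lambda>i. op_norm (X i - X' i) * L + K * op_norm (Y i - Y' i)) \<longlonglongrightarrow> 0 * L + K * 0"
    by (intro tendsto_intros l)
  then have "(\<lambda>i. op_norm (X i * Y i - X' i * Y' i)) \<longlonglongrightarrow> 0"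
    by (intro op_norm_tendsto_zeroI[OF bound]) simp
  then show ?thesis using b by (simp add: asymp_mats_def bounded_mats_mult)
qed

lemma asymp_mats_smult:
  assumes "asymp_mats d e X Y"
  shows "asymp_mats d e (\<lambda>i. c \<cdot>\<^sub>m X i) (\<lambda>i. c \<cdot>\<^sub>m Y i)"
proof -
  have b: "bounded_mats d e X" "bounded_mats d e Y" and l: "(\<lambda>i. op_norm (X i - Y i)) \<longlonglongrightarrow> 0"
    using assms by (auto simp: asymp_mats_def)
  have "op_norm (c \<cdot>\<^sub>m X i - c \<cdot>\<^sub>m Y i) \<le> cmod c * op_norm (X i - Y i)" for i
  proof -
    have "c \<cdot>\<^sub>m X i - c \<cdot>\<^sub>m Y i = c \<cdot>\<^sub>m (X i - Y i)"
      using bounded_matsD[OF b(1), of i] bounded_matsD[OF b(2), of i]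
      by (intro eq_matI) (auto simp: algebra_simps)
    then show ?thesis
      using op_norm_smult_le[OF minus_carrier_mat[OF bounded_matsD[OF b(2)]]] by simp
  qed
  moreover have "(\<lambda>i. cmod c * op_norm (X i - Y i)) \<longlonglongrightarrow> cmod c * 0"
    by (intro tendsto_intros l)
  ultimately have "(\<lambda>i. op_norm (c \<cdot>\<^sub>m X i - c \<cdot>\<^sub>m Y i)) \<longlonglongrightarrow> 0"
    by (intro op_norm_tendsto_zeroI) simp_all
  then show ?thesis using b by (simp add: asymp_mats_def bounded_mats_smult)
qed

lemma asymp_mats_adjoint:
  assumes "asymp_mats d e X Y"
  shows "asymp_mats e d (\<lambda>i. mat_adjoint (X i)) (\<lambda>i. mat_adjoint (Y i))"
proof -
  have b: "bounded_mats d e X" "bounded_mats d e Y" and l: "(\<lambda>i. op_norm (X i - Y i)) \<longlonglongrightarrow> 0"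
    using assms by (auto simp: asymp_mats_def)
  have "op_norm (mat_adjoint (X i) - mat_adjoint (Y i)) = op_norm (X i - Y i)" for i
    using op_norm_adjoint[OF minus_carrier_mat[OF bounded_matsD[OF b(2)]], of "X i" i]
    by (simp add: mat_adjoint_minus[OF bounded_matsD[OF b(1)] bounded_matsD[OF b(2)]])
  then show ?thesis using b l by (simp add: asymp_mats_def bounded_mats_adjoint)
qed

section \<open>The corona algebra in terms of representatives\<close>

definition corona_class :: "(nat \<Rightarrow> nat) \<Rightarrow> (nat \<Rightarrow> complex mat) \<Rightarrow> (nat \<Rightarrow> complex mat) set" where
  "corona_class k x = {y. asymp_mats k k y x}"

lemma carrier_mat_prod: "x \<in> carrier (mat_prod k) \<longleftrightarrow> bounded_mats k k x"
  by (auto simp: mat_prod_def bounded_mats_def)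

lemma bounded_mats_zero: "bounded_mats d e (\<lambda>i. 0\<^sub>m (d i) (e i))"
  by (rule bounded_matsI[of _ _ _ 0]) auto

lemma mat_sum_coset:
  assumes x: "bounded_mats k k x"
  shows "mat_sum k +>\<^bsub>mat_prod k\<^esub> x = corona_class k x"
proof -
  have "mat_sum k +>\<^bsub>mat_prod k\<^esub> x = {y. \<exists>h\<in>mat_sum k. y = (\<lambda>i. h i + x i)}"
    by (auto simp: a_r_coset_def' mat_prod_def)
  also have "\<dots> = corona_class k x"
  proof (intro equalityI subsetI)
    fix y assume "y \<in> {y. \<exists>h\<in>mat_sum k. y = (\<lambda>i. h i + x i)}"
    then obtain h where h: "bounded_mats k k h" "(\<lambda>i. op_norm (h i)) \<longlonglongrightarrow> 0" and y: "y = (\<lambda>i. h i + x i)"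
      by (auto simp: mat_sum_def carrier_mat_prod)
    have "h i + x i - x i = h i" for i
      using bounded_matsD[OF h(1), of i] bounded_matsD[OF x, of i] by (intro eq_matI) auto
    then have "asymp_mats k k y x"
      using h(2) bounded_matsD[OF x] unfolding y by (intro asymp_matsI[OF x]) auto
    then show "y \<in> corona_class k x" by (simp add: corona_class_def)
  next
    fix y assume "y \<in> corona_class k x"
    then have y: "asymp_mats k k y x" by (simp add: corona_class_def)
    define h where "h = (\<lambda>i. y i - x i)"
    have yb: "bounded_mats k k y" using y by (simp add: asymp_mats_def)
    have lim: "(\<lambda>i. op_norm (h i)) \<longlonglongrightarrow> 0" using y by (simp add: asymp_mats_def h_def)
    have h0: "h i - 0\<^sub>m (k i) (k i) = h i" for i
      using bounded_matsD[OF x, of i] bounded_matsD[OF yb, of i] by (intro eq_matI) (auto simp: h_def)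
    have "asymp_mats k k h (\<lambda>i. 0\<^sub>m (k i) (k i))"
      by (rule asymp_matsI[OF bounded_mats_zero])
        (use lim h0 in \<open>auto simp: h_def minus_carrier_mat bounded_matsD[OF x]\<close>)
    then have "h \<in> mat_sum k"
      using lim by (simp add: mat_sum_def carrier_mat_prod asymp_mats_def)
    moreover have "y = (\<lambda>i. h i + x i)"
    proof
      fix i
      show "y i = h i + x i"
        using bounded_matsD[OF x, of i] bounded_matsD[OF yb, of i]
        by (intro eq_matI) (auto simp: h_def)
    qed
    ultimately show "y \<in> {y. \<exists>h\<in>mat_sum k. y = (\<lambda>i. h i + x i)}" by blast
  qed
  finally show ?thesis .
qed

lemma corona_class_self: "bounded_mats k k x \<Longrightarrow> x \<in> corona_class k x"
  by (simp add: corona_class_def asymp_mats_refl)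

lemma corona_class_cong: "asymp_mats k k x y \<Longrightarrow> corona_class k x = corona_class k y"
  unfolding corona_class_def using asymp_mats_trans asymp_mats_sym by blast

lemma corona_class_eqD:
  "corona_class k x = corona_class k y \<Longrightarrow> bounded_mats k k x \<Longrightarrow> asymp_mats k k x y"
  using corona_class_self[of k x] by (auto simp: corona_class_def)

lemma carrier_mat_corona: "X \<in> carrier (mat_corona k) \<longleftrightarrow> (\<exists>x. bounded_mats k k x \<and> X = corona_class k x)"
  by (auto simp: mat_corona_def cstar_quot_def FactRing_def A_RCOSETS_def' carrier_mat_prod mat_sum_coset)

text \<open>Scalar multiplication and involution of the quotient are defined as unions over
  representatives. If \<open>f\<close> respects asymptotic equality, all members of the union are
  the same coset; nonemptiness of the class gives the value.\<close>

lemma corona_UN_eq: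
  assumes "\<And>y. asymp_mats k k y x \<Longrightarrow> asymp_mats k k (f y) (f x)" "bounded_mats k k x"
  shows "(\<Union>y\<in>corona_class k x. mat_sum k +>\<^bsub>mat_prod k\<^esub> f y) = corona_class k (f x)"
proof -
  have "mat_sum k +>\<^bsub>mat_prod k\<^esub> f y = corona_class k (f x)" if "y \<in> corona_class k x" for y
  proof -
    have a: "asymp_mats k k (f y) (f x)" using that assms(1) by (simp add: corona_class_def)
    then have "bounded_mats k k (f y)" by (simp add: asymp_mats_def)
    then show ?thesis using mat_sum_coset corona_class_cong[OF a] by simp
  qed
  then show ?thesis using corona_class_self[OF assms(2)] by auto
qed

lemma corona_scl:
  assumes "bounded_mats k k x"
  shows "scl (mat_corona k) c (corona_class k x) = corona_class k (\<lambda>i. c \<cdot>\<^sub>m x i)"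
proof -
  have "(\<Union>y\<in>corona_class k x. mat_sum k +>\<^bsub>mat_prod k\<^esub> (\<lambda>i. c \<cdot>\<^sub>m y i)) = corona_class k (\<lambda>i. c \<cdot>\<^sub>m x i)"
    by (rule corona_UN_eq) (use assms in \<open>auto intro: asymp_mats_smult\<close>)
  then show ?thesis by (simp add: mat_corona_def cstar_quot_def) (simp add: mat_prod_def)
qed

lemma corona_star:
  assumes "bounded_mats k k x"
  shows "star (mat_corona k) (corona_class k x) = corona_class k (\<lambda>i. mat_adjoint (x i))"
proof -
  have "(\<Union>y\<in>corona_class k x. mat_sum k +>\<^bsub>mat_prod k\<^esub> (\<lambda>i. mat_adjoint (y i))) = corona_class k (\<lambda>i. mat_adjoint (x i))"
    by (rule corona_UN_eq) (use assms in \<open>auto intro: asymp_mats_adjoint\<close>)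
  then show ?thesis by (simp add: mat_corona_def cstar_quot_def) (simp add: mat_prod_def)
qed

lemma corona_mult:
  assumes x: "bounded_mats k k x" and y: "bounded_mats k k y"
  shows "corona_class k x \<otimes>\<^bsub>mat_corona k\<^esub> corona_class k y = corona_class k (\<lambda>i. x i * y i)"
proof -
  have "(\<Union>b\<in>corona_class k y. mat_sum k +>\<^bsub>mat_prod k\<^esub> (\<lambda>i. a i * b i)) = corona_class k (\<lambda>i. x i * y i)"
    if "a \<in> corona_class k x" for a
  proof -
    have a: "asymp_mats k k a x" using that by (simp add: corona_class_def)
    then have ab: "bounded_mats k k a" by (simp add: asymp_mats_def)
    have "(\<Union>b\<in>corona_class k y. mat_sum k +>\<^bsub>mat_prod k\<^esub> (\<lambda>i. a i * b i)) = corona_class k (\<lambda>i. a i * y i)"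
      by (rule corona_UN_eq) (use y ab in \<open>auto intro: asymp_mats_mult asymp_mats_refl\<close>)
    also have "\<dots> = corona_class k (\<lambda>i. x i * y i)"
      by (rule corona_class_cong[OF asymp_mats_mult[OF a asymp_mats_refl[OF y]]])
    finally show ?thesis .
  qed
  then have "(\<Union>a\<in>corona_class k x. \<Union>b\<in>corona_class k y. mat_sum k +>\<^bsub>mat_prod k\<^esub> (\<lambda>i. a i * b i)) =
      corona_class k (\<lambda>i. x i * y i)"
    using corona_class_self[OF x] by auto
  then show ?thesis
    by (simp add: mat_corona_def cstar_quot_def FactRing_def rcoset_mult_def) (simp add: mat_prod_def)
qed

section \<open>From an MF quotient to sequences of matrices\<close>

context unital_cstar_algebra
begin

lemma scl_zero: "scl A 0 \<zero> = \<zero>"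
proof -
  have "scl A 0 \<zero> \<oplus> scl A 0 \<zero> = scl A 0 \<zero>"
    using scl_add_left[of \<zero> 0 0] by simp
  then show ?thesis using scl_closed[of \<zero> 0] by (metis add.r_cancel_one zero_closed)
qed

text \<open>Multiplication by c is multiplication by the element c 1 of the algebra.\<close>

lemma scl_mem_ideal:
  assumes "ideal I A" "h \<in> I"
  shows "scl A c h \<in> I"
proof -
  interpret I: ideal I A by fact
  have h: "h \<in> carrier A" using assms I.Icarr by blast
  have "scl A c \<one> \<otimes> h = scl A c h" using scl_mult_left[of \<one> h c] h by simp
  then show ?thesis using I.I_l_closed[OF assms(2), of "scl A c \<one>"] scl_closed by simp
qed

text \<open>An additive map that preserves \<open>I\<close> is constant modulo \<open>I\<close> on
  cosets, so the unions defining the operations of the quotient collapse; this is applied to scalars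
  and to the involution.\<close>

lemma cstar_quot_class_hom:
  assumes "closed_ideal I A"
  shows "(\<lambda>x. I +> x) \<in> star_hom A (cstar_quot A I)"
proof -
  interpret I: ideal I A using assms by (simp add: closed_ideal_def)
  have star_I: "star A h \<in> I" if "h \<in> I" for h using assms that by (simp add: closed_ideal_def)
  have scl_I: "scl A c h \<in> I" if "h \<in> I" for c h using scl_mem_ideal[OF I.ideal_axioms that] .
  have coset: "I +> f y = I +> f x"
    if x: "x \<in> carrier A" and y: "y \<in> I +> x"
      and f: "\<And>x. x \<in> carrier A \<Longrightarrow> f x \<in> carrier A"
        "\<And>x y. x \<in> carrier A \<Longrightarrow> y \<in> carrier A \<Longrightarrow> f (x \<oplus> y) = f x \<oplus> f y"
        "\<And>h. h \<in> I \<Longrightarrow> f h \<in> I" for f x y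
  proof -
    obtain h where h: "h \<in> I" "y = h \<oplus> x" using y by (auto simp: a_r_coset_def')
    then have "f y = f h \<oplus> f x" using f(2) x I.Icarr by blast
    then have "f y \<in> I +> f x" using f(3)[OF h(1)] f(1)[OF x] I.a_subset by (simp add: a_rcosI)
    then show ?thesis using I.a_repr_independence'[OF _ f(1)[OF x]] by simp
  qed
  have UN: "(\<Union>y\<in>I +> x. I +> f y) = I +> f x"
    if x: "x \<in> carrier A"
      and f: "\<And>x. x \<in> carrier A \<Longrightarrow> f x \<in> carrier A"
        "\<And>x y. x \<in> carrier A \<Longrightarrow> y \<in> carrier A \<Longrightarrow> f (x \<oplus> y) = f x \<oplus> f y"
        "\<And>h. h \<in> I \<Longrightarrow> f h \<in> I" for f x
    using coset[OF x _ f] I.a_rcos_self[OF x] by blast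
  show ?thesis
    unfolding star_hom_def
  proof (intro CollectI conjI ballI allI funcsetI)
    fix x assume x: "x \<in> carrier A"
    show "I +> x \<in> carrier (cstar_quot A I)"
      using x I.a_subset by (simp add: cstar_quot_def FactRing_def a_rcosetsI)
    show "I +> scl A c x = scl (cstar_quot A I) c (I +> x)" for c
      using UN[OF x, of "scl A c"] scl_closed scl_add_right scl_I by (simp add: cstar_quot_def)
    show "I +> star A x = star (cstar_quot A I) (I +> x)"
      using UN[OF x, of "star A"] star_closed star_add star_I by (simp add: cstar_quot_def)
    fix y assume y: "y \<in> carrier A"
    show "I +> (x \<oplus> y) = (I +> x) \<oplus>\<^bsub>cstar_quot A I\<^esub> (I +> y)"
      using x y by (simp add: cstar_quot_def FactRing_def I.a_rcos_sum)
    show "I +> (x \<otimes> y) = (I +> x) \<otimes>\<^bsub>cstar_quot A I\<^esub> (I +> y)"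
      using x y by (simp add: cstar_quot_def FactRing_def I.rcoset_mult_add)
  qed
qed

lemma one_not_in_proper_ideal:
  assumes "closed_ideal I A" "carrier (cstar_quot A I) \<noteq> {\<zero>\<^bsub>cstar_quot A I\<^esub>}"
  shows "\<one> \<notin> I"
proof
  assume 1: "\<one> \<in> I"
  interpret I: ideal I A using assms by (simp add: closed_ideal_def)
  have IA: "I = carrier A" using I.one_imp_carrier[OF 1] .
  have "carrier (cstar_quot A I) = {I}"
    using a_rcos_zero[OF I.ideal_axioms] zero_closed
    by (auto simp: cstar_quot_def FactRing_def A_RCOSETS_def' IA)
  then show False using assms(2) by (simp add: cstar_quot_def FactRing_def)
qed

end

text \<open>\<open>T\<close> chooses a representing sequence for the image of each element under the
  composite of the quotient map and the embedding, so the algebraic laws survive only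
  asymptotically. The last property retains what nonzeroness and injectivity provide.\<close>

lemma MF_quotient_lifts:
  assumes A: "unital_cstar_algebra A" and MF: "has_nonzero_MF_quotient A"
  obtains k T where
    "\<And>x. x \<in> carrier A \<Longrightarrow> bounded_mats k k (T x)"
    "\<And>x y. x \<in> carrier A \<Longrightarrow> y \<in> carrier A \<Longrightarrow> asymp_mats k k (T (x \<otimes>\<^bsub>A\<^esub> y)) (\<lambda>i. T x i * T y i)"
    "\<And>x c. x \<in> carrier A \<Longrightarrow> asymp_mats k k (T (scl A c x)) (\<lambda>i. c \<cdot>\<^sub>m T x i)"
    "\<And>x. x \<in> carrier A \<Longrightarrow> asymp_mats k k (T (star A x)) (\<lambda>i. mat_adjoint (T x i))"
    "\<not> (\<lambda>i. op_norm (T \<one>\<^bsub>A\<^esub> i)) \<longlonglongrightarrow> 0"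
proof -
  interpret unital_cstar_algebra A by fact
  obtain I k \<phi> where I: "closed_ideal I A" "carrier (cstar_quot A I) \<noteq> {\<zero>\<^bsub>cstar_quot A I\<^esub>}"
    and \<phi>: "\<phi> \<in> star_hom (cstar_quot A I) (mat_corona k)" "inj_on \<phi> (carrier (cstar_quot A I))"
    using MF unfolding has_nonzero_MF_quotient_def MF_def by blast
  interpret I: ideal I A using I by (simp add: closed_ideal_def)
  note q = cstar_quot_class_hom[OF I(1), unfolded star_hom_def]
  note p = \<phi>(1)[unfolded star_hom_def]
  define \<psi> where "\<psi> = (\<lambda>x. \<phi> (I +>\<^bsub>A\<^esub> x))"
  have qc: "I +>\<^bsub>A\<^esub> x \<in> carrier (cstar_quot A I)" if "x \<in> carrier A" for x
    using q that by blast
  have \<psi>c: "\<psi> x \<in> carrier (mat_corona k)" if "x \<in> carrier A" for x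
    using p qc[OF that] unfolding \<psi>_def by blast
  have \<psi>_mult: "\<psi> (x \<otimes>\<^bsub>A\<^esub> y) = \<psi> x \<otimes>\<^bsub>mat_corona k\<^esub> \<psi> y" if "x \<in> carrier A" "y \<in> carrier A" for x y
    using q p qc that unfolding \<psi>_def by auto
  have \<psi>_scl: "\<psi> (scl A c x) = scl (mat_corona k) c (\<psi> x)" if "x \<in> carrier A" for x c
    using q p qc that unfolding \<psi>_def by auto
  have \<psi>_star: "\<psi> (star A x) = star (mat_corona k) (\<psi> x)" if "x \<in> carrier A" for x
    using q p qc that unfolding \<psi>_def by auto
  have "\<forall>x\<in>carrier A. \<exists>t. bounded_mats k k t \<and> \<psi> x = corona_class k t"
    using \<psi>c carrier_mat_corona by blast
  then obtain T where T: "\<And>x. x \<in> carrier A \<Longrightarrow> bounded_mats k k (T x)"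
    "\<And>x. x \<in> carrier A \<Longrightarrow> \<psi> x = corona_class k (T x)"
    by metis
  show ?thesis
  proof (rule that[of k T])
    show "bounded_mats k k (T x)" if "x \<in> carrier A" for x using T(1)[OF that] .
    show "asymp_mats k k (T (x \<otimes>\<^bsub>A\<^esub> y)) (\<lambda>i. T x i * T y i)" if "x \<in> carrier A" "y \<in> carrier A" for x y
      using \<psi>_mult[OF that] that T corona_mult by (intro corona_class_eqD) auto
    show scl: "asymp_mats k k (T (scl A c x)) (\<lambda>i. c \<cdot>\<^sub>m T x i)" if "x \<in> carrier A" for x c
      using \<psi>_scl[OF that] that T corona_scl scl_closed by (intro corona_class_eqD) auto
    show "asymp_mats k k (T (star A x)) (\<lambda>i. mat_adjoint (T x i))" if "x \<in> carrier A" for x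
      using \<psi>_star[OF that] that T corona_star star_closed by (intro corona_class_eqD) auto
    show "\<not> (\<lambda>i. op_norm (T \<one>\<^bsub>A\<^esub> i)) \<longlonglongrightarrow> 0"
    proof
      assume lim: "(\<lambda>i. op_norm (T \<one>\<^bsub>A\<^esub> i)) \<longlonglongrightarrow> 0"
      have T1: "T \<one>\<^bsub>A\<^esub> i \<in> carrier_mat (k i) (k i)" for i by (rule bounded_matsD[OF T(1)]) simp
      have T0: "T \<zero>\<^bsub>A\<^esub> i \<in> carrier_mat (k i) (k i)" for i by (rule bounded_matsD[OF T(1)]) simp
      have "T \<one>\<^bsub>A\<^esub> i - 0\<^sub>m (k i) (k i) = T \<one>\<^bsub>A\<^esub> i" for i
        using T1[of i] by (intro eq_matI) auto
      then have "asymp_mats k k (T \<one>\<^bsub>A\<^esub>) (\<lambda>i. 0\<^sub>m (k i) (k i))"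
        using lim T1 by (intro asymp_matsI[OF bounded_mats_zero]) auto
      \<comment> \<open>The representative chosen for 0 need not be 0; it is a null sequence because
        0 is its own multiple by the scalar 0.\<close>
      moreover have "0 \<cdot>\<^sub>m T \<zero>\<^bsub>A\<^esub> i = 0\<^sub>m (k i) (k i)" for i
        using T0[of i] by (intro eq_matI) auto
      then have "asymp_mats k k (T \<zero>\<^bsub>A\<^esub>) (\<lambda>i. 0\<^sub>m (k i) (k i))"
        using scl[of "\<zero>\<^bsub>A\<^esub>" 0] by (simp add: scl_zero)
      ultimately have "asymp_mats k k (T \<one>\<^bsub>A\<^esub>) (T \<zero>\<^bsub>A\<^esub>)"
        using asymp_mats_sym asymp_mats_trans by blast
      then have "\<phi> (I +>\<^bsub>A\<^esub> \<one>\<^bsub>A\<^esub>) = \<phi> (I +>\<^bsub>A\<^esub> \<zero>\<^bsub>A\<^esub>)"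
        using T(2) corona_class_cong by (simp add: \<psi>_def)
      then have "I +>\<^bsub>A\<^esub> \<one>\<^bsub>A\<^esub> = I +>\<^bsub>A\<^esub> \<zero>\<^bsub>A\<^esub>"
        using \<phi>(2) qc by (simp add: inj_on_eq_iff)
      then have "\<one>\<^bsub>A\<^esub> \<in> I"
        using I.a_rcos_self[of "\<one>\<^bsub>A\<^esub>"] a_rcos_zero[OF I.ideal_axioms, of "\<zero>\<^bsub>A\<^esub>"] I.zero_closed by simp
      then show False using one_not_in_proper_ideal[OF I] by simp
    qed
  qed
qed

text \<open>Polar parts are taken wherever the defect is below 1; the finitely many other indices
  receive the identity as a placeholder, invisible in the limit.\<close>

lemma near_unitary_seq:
  assumes X: "bounded_mats r r X" and XX: "asymp_mats r r (\<lambda>i. mat_adjoint (X i) * X i) (\<lambda>i. 1\<^sub>m (r i))"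
  obtains Y where "\<And>i. Y i \<in> carrier (unitary_group (r i))" "asymp_mats r r Y X"
proof -
  define e where "e = (\<lambda>i. op_norm (mat_adjoint (X i) * X i - 1\<^sub>m (r i)))"
  have e: "e \<longlonglongrightarrow> 0" using XX by (simp add: asymp_mats_def e_def)
  have "\<exists>Y. Y \<in> carrier (unitary_group (r i)) \<and> (e i < 1 \<longrightarrow> op_norm (X i - Y) \<le> e i)" for i
  proof (cases "e i < 1")
    case True
    then show ?thesis
      using near_unitary[OF bounded_matsD[OF X], of i] unfolding e_def by metis
  next
    case False
    then show ?thesis by (intro exI[of _ "1\<^sub>m (r i)"]) (simp add: unitary_group_carrier)
  qed
  then obtain Y where Y: "\<And>i. Y i \<in> carrier (unitary_group (r i))"
    "\<And>i. e i < 1 \<Longrightarrow> op_norm (X i - Y i) \<le> e i"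
    by metis
  have Yc: "Y i \<in> carrier_mat (r i) (r i)" for i using Y(1) by (simp add: unitary_group_carrier)
  have "\<forall>\<^sub>F i in sequentially. e i < 1" using order_tendstoD(2)[OF e] by simp
  then have "\<forall>\<^sub>F i in sequentially. norm (op_norm (Y i - X i)) \<le> e i"
    by eventually_elim
      (simp add: op_norm_nonneg op_norm_minus_commute[OF Yc bounded_matsD[OF X]] Y(2))
  then have "(\<lambda>i. op_norm (Y i - X i)) \<longlonglongrightarrow> 0"
    by (rule Lim_null_comparison[OF _ e])
  then have "asymp_mats r r Y X" by (intro asymp_matsI[OF X Yc])
  then show ?thesis using that Y(1) by blast
qed

section \<open>Asymptotic projective representations\<close>

text \<open>The twisted relation makes the unitary at the group identity idempotent, and an
  idempotent unitary is 1.\<close>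

lemma twisted_unit_eq_one:
  assumes "unital_cstar_algebra A" "group G" "twisted_unitary_rep G \<omega> A u" "\<omega> \<one>\<^bsub>G\<^esub> \<one>\<^bsub>G\<^esub> = 1"
  shows "u \<one>\<^bsub>G\<^esub> = \<one>\<^bsub>A\<^esub>"
proof -
  interpret A: unital_cstar_algebra A by fact
  interpret G: group G by fact
  let ?u = "u \<one>\<^bsub>G\<^esub>"
  have u: "?u \<in> carrier A" "star A ?u \<otimes>\<^bsub>A\<^esub> ?u = \<one>\<^bsub>A\<^esub>"
    using assms(3) G.one_closed by (auto simp: twisted_unitary_rep_def)
  have "?u \<otimes>\<^bsub>A\<^esub> ?u = scl A (\<omega> \<one>\<^bsub>G\<^esub> \<one>\<^bsub>G\<^esub>) (u (\<one>\<^bsub>G\<^esub> \<otimes>\<^bsub>G\<^esub> \<one>\<^bsub>G\<^esub>))"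
    using assms(3) G.one_closed by (simp only: twisted_unitary_rep_def)
  then have "?u \<otimes>\<^bsub>A\<^esub> ?u = ?u"
    using assms(4) u A.scl_one by simp
  then have "(star A ?u \<otimes>\<^bsub>A\<^esub> ?u) \<otimes>\<^bsub>A\<^esub> ?u = star A ?u \<otimes>\<^bsub>A\<^esub> ?u"
    by (simp only: A.m_assoc[OF A.star_closed[OF u(1)] u(1) u(1)])
  then show ?thesis unfolding u(2) using u(1) by simp
qed

text \<open>The lift of the unit is close to a Hermitian almost idempotent, hence to a projection
  \<open>V V\<^sup>*\<close> with \<open>V\<close> an isometry; compressing the lifts of the generators with \<open>V\<close> gives almost
  unitary matrices, which are then replaced by unitary ones.\<close>

lemma asymptotic_projective_reps:
  assumes G: "group G" and A: "unital_cstar_algebra A" and MF: "has_nonzero_MF_quotient A"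
    and u: "twisted_unitary_rep G \<omega> A u" and \<omega>: "\<omega> \<one>\<^bsub>G\<^esub> \<one>\<^bsub>G\<^esub> = 1"
  obtains r \<rho> where
    "\<And>i s. s \<in> carrier G \<Longrightarrow> \<rho> i s \<in> carrier (unitary_group (r i))"
    "\<And>i. \<rho> i \<one>\<^bsub>G\<^esub> = 1\<^sub>m (r i)"
    "\<And>s t. s \<in> carrier G \<Longrightarrow> t \<in> carrier G \<Longrightarrow>
      (\<lambda>i. op_norm (\<rho> i s * \<rho> i t - \<omega> s t \<cdot>\<^sub>m \<rho> i (s \<otimes>\<^bsub>G\<^esub> t))) \<longlonglongrightarrow> 0"
    "\<exists>\<^sub>F i in sequentially. 1 \<le> r i"
proof -
  interpret A: unital_cstar_algebra A by fact
  interpret G: group G by fact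
  obtain k T where T: "\<And>x. x \<in> carrier A \<Longrightarrow> bounded_mats k k (T x)"
    and T_mult: "\<And>x y. x \<in> carrier A \<Longrightarrow> y \<in> carrier A \<Longrightarrow> asymp_mats k k (T (x \<otimes>\<^bsub>A\<^esub> y)) (\<lambda>i. T x i * T y i)"
    and T_scl: "\<And>x c. x \<in> carrier A \<Longrightarrow> asymp_mats k k (T (scl A c x)) (\<lambda>i. c \<cdot>\<^sub>m T x i)"
    and T_star: "\<And>x. x \<in> carrier A \<Longrightarrow> asymp_mats k k (T (star A x)) (\<lambda>i. mat_adjoint (T x i))"
    and T_one: "\<not> (\<lambda>i. op_norm (T \<one>\<^bsub>A\<^esub> i)) \<longlonglongrightarrow> 0"
    by (rule MF_quotient_lifts[OF A MF]) (rule that)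
  have uc: "u s \<in> carrier A" and uu: "star A (u s) \<otimes>\<^bsub>A\<^esub> u s = \<one>\<^bsub>A\<^esub>" if "s \<in> carrier G" for s
    using u that by (auto simp: twisted_unitary_rep_def)
  have umult: "u s \<otimes>\<^bsub>A\<^esub> u t = scl A (\<omega> s t) (u (s \<otimes>\<^bsub>G\<^esub> t))" if "s \<in> carrier G" "t \<in> carrier G" for s t
    using u that by (auto simp: twisted_unitary_rep_def)
  have ue: "u \<one>\<^bsub>G\<^esub> = \<one>\<^bsub>A\<^esub>" by (rule twisted_unit_eq_one[OF A G u \<omega>])
  define W where "W = (\<lambda>s. T (u s))"
  have W: "bounded_mats k k (W s)" if "s \<in> carrier G" for s
    using T uc[OF that] by (simp add: W_def)
  have We: "W \<one>\<^bsub>G\<^esub> = T \<one>\<^bsub>A\<^esub>" by (simp add: W_def ue)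
  \<comment> \<open>A lift of 1 that is exactly Hermitian, as the spectral theorem demands; the
    chosen lift of 1 is self-adjoint only asymptotically.\<close>
  define P where "P = (\<lambda>i. mat_adjoint (W \<one>\<^bsub>G\<^esub> i) * W \<one>\<^bsub>G\<^esub> i)"
  have W_star: "asymp_mats k k (\<lambda>i. mat_adjoint (W s i) * W s i) (T \<one>\<^bsub>A\<^esub>)" if s: "s \<in> carrier G" for s
  proof -
    have "asymp_mats k k (T (star A (u s) \<otimes>\<^bsub>A\<^esub> u s)) (\<lambda>i. T (star A (u s)) i * T (u s) i)"
      by (rule T_mult[OF A.star_closed[OF uc[OF s]] uc[OF s]])
    also have "asymp_mats k k \<dots> (\<lambda>i. mat_adjoint (W s i) * W s i)"
      unfolding W_def by (rule asymp_mats_mult[OF T_star[OF uc[OF s]] asymp_mats_refl[OF T[OF uc[OF s]]]])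
    finally show ?thesis unfolding uu[OF s] by (rule asymp_mats_sym)
  qed
  have PT: "asymp_mats k k P (T \<one>\<^bsub>A\<^esub>)" unfolding P_def by (rule W_star) simp
  then have Pb: "bounded_mats k k P" by (simp add: asymp_mats_def)
  have P_left: "asymp_mats k k (\<lambda>i. P i * T x i) (T x)" if x: "x \<in> carrier A" for x
  proof -
    have "asymp_mats k k (\<lambda>i. P i * T x i) (\<lambda>i. T \<one>\<^bsub>A\<^esub> i * T x i)"
      by (rule asymp_mats_mult[OF PT asymp_mats_refl[OF T[OF x]]])
    also have "asymp_mats k k \<dots> (T (\<one>\<^bsub>A\<^esub> \<otimes>\<^bsub>A\<^esub> x))"
      by (rule asymp_mats_sym[OF T_mult[OF A.one_closed x]])
    finally show ?thesis using x by simp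
  qed
  have PP: "asymp_mats k k (\<lambda>i. P i * P i) P"
  proof -
    have "asymp_mats k k (\<lambda>i. P i * P i) (\<lambda>i. P i * T \<one>\<^bsub>A\<^esub> i)"
      by (rule asymp_mats_mult[OF asymp_mats_refl[OF Pb] PT])
    also have "asymp_mats k k \<dots> (T \<one>\<^bsub>A\<^esub>)" by (rule P_left) simp
    also have "asymp_mats k k \<dots> P" by (rule asymp_mats_sym[OF PT])
    finally show ?thesis .
  qed
  have Psym: "mat_adjoint (P i) = P i" for i
    using bounded_matsD[OF W[OF G.one_closed], of i] by (simp add: P_def mat_adjoint_mult[of _ "k i" "k i" _ "k i"])
  have "\<exists>r V. V \<in> carrier_mat (k i) r \<and> mat_adjoint V * V = 1\<^sub>m r \<and>
      op_norm (V * mat_adjoint V - P i) \<le> 2 * op_norm (P i * P i - P i)" for i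
    using hermitian_near_projection[OF bounded_matsD[OF Pb] Psym, of i] by metis
  then obtain r V where V: "\<And>i. V i \<in> carrier_mat (k i) (r i)"
    and VV: "\<And>i. mat_adjoint (V i) * V i = 1\<^sub>m (r i)"
    and VP: "\<And>i. op_norm (V i * mat_adjoint (V i) - P i) \<le> 2 * op_norm (P i * P i - P i)"
    by metis
  note aV = mat_adjoint_carrier[OF V]
  have Vb: "bounded_mats k r V" by (rule bounded_matsI[OF V op_norm_isometry_le[OF V VV]])
  have aVb: "bounded_mats r k (\<lambda>i. mat_adjoint (V i))" by (rule bounded_mats_adjoint[OF Vb])
  have E: "asymp_mats k k (\<lambda>i. V i * mat_adjoint (V i)) P"
  proof (rule asymp_matsI[OF Pb])
    have "(\<lambda>i. 2 * op_norm (P i * P i - P i)) \<longlonglongrightarrow> 2 * 0"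
      using PP unfolding asymp_mats_def by (intro tendsto_intros) simp
    then show "(\<lambda>i. op_norm (V i * mat_adjoint (V i) - P i)) \<longlonglongrightarrow> 0"
      by (intro op_norm_tendsto_zeroI[OF VP]) simp
  qed (rule mult_carrier_mat[OF V aV])
  \<comment> \<open>Compression to the range of the projection. It turns the asymptotic unit of size
    \<open>k\<close> into the identity of size \<open>r\<close>.\<close>
  define cmp where "cmp = (\<lambda>Y i. mat_adjoint (V i) * (Y i * V i))"
  have cmp: "asymp_mats r r (cmp Y) (cmp Z)" if "asymp_mats k k Y Z" for Y Z
    unfolding cmp_def
    by (rule asymp_mats_mult[OF asymp_mats_refl[OF aVb] asymp_mats_mult[OF that asymp_mats_refl[OF Vb]]])
  have cmp_one: "asymp_mats r r (cmp (T \<one>\<^bsub>A\<^esub>)) (\<lambda>i. 1\<^sub>m (r i))"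
  proof -
    have "asymp_mats k k (T \<one>\<^bsub>A\<^esub>) (\<lambda>i. V i * mat_adjoint (V i))"
      by (rule asymp_mats_trans[OF asymp_mats_sym[OF PT] asymp_mats_sym[OF E]])
    note cmp[OF this]
    also have "cmp (\<lambda>i. V i * mat_adjoint (V i)) = (\<lambda>i. 1\<^sub>m (r i))"
    proof
      fix i
      have "mat_adjoint (V i) * (V i * mat_adjoint (V i) * V i) = (mat_adjoint (V i) * V i) * (mat_adjoint (V i) * V i)"
        using V[of i] aV[of i]
        by (simp add: assoc_mult_mat[OF V aV V] assoc_mult_mat[OF aV V mult_carrier_mat[OF aV V]])
      then show "cmp (\<lambda>i. V i * mat_adjoint (V i)) i = 1\<^sub>m (r i)"
        by (simp add: cmp_def VV)
    qed
    finally show ?thesis .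
  qed
  \<comment> \<open>Compression is not multiplicative in general. Here the product of two
    compressions contains the projection between the factors, and by \<open>P_left\<close> it acts
    asymptotically as a left unit on every lift \<open>T x\<close>.\<close>
  have cmp_mult: "asymp_mats r r (\<lambda>i. cmp Y i * cmp (T x) i) (cmp (\<lambda>i. Y i * T x i))"
    if Y: "bounded_mats k k Y" and x: "x \<in> carrier A" for Y x
  proof -
    note Yc = bounded_matsD[OF Y] and Tc = bounded_matsD[OF T[OF x]]
    have "cmp Y i * cmp (T x) i = cmp (\<lambda>i. Y i * ((V i * mat_adjoint (V i)) * T x i)) i" for i
      unfolding cmp_def using V[of i] aV[of i] Yc[of i] Tc[of i]
      by (simp add: mult_carrier_mat[of _ "k i" "k i" _ "k i"] mult_carrier_mat[of _ "k i" "k i" _ "r i"]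
          mult_carrier_mat[of _ "r i" "k i" _ "k i"] mult_carrier_mat[of _ "r i" "k i" _ "r i"]
          mult_carrier_mat[of _ "k i" "r i" _ "k i"] mult_carrier_mat[of _ "k i" "r i" _ "r i"]
          assoc_mult_mat[of _ "k i" "k i" _ "k i" _ "k i"] assoc_mult_mat[of _ "k i" "k i" _ "k i" _ "r i"]
          assoc_mult_mat[of _ "r i" "k i" _ "r i" _ "r i"] assoc_mult_mat[of _ "r i" "k i" _ "k i" _ "r i"]
          assoc_mult_mat[of _ "k i" "r i" _ "k i" _ "k i"] assoc_mult_mat[of _ "k i" "r i" _ "k i" _ "r i"]
          assoc_mult_mat[of _ "k i" "k i" _ "r i" _ "r i"] assoc_mult_mat[of _ "k i" "k i" _ "r i" _ "k i"])
    then have eq: "(\<lambda>i. cmp Y i * cmp (T x) i) = cmp (\<lambda>i. Y i * ((V i * mat_adjoint (V i)) * T x i))"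
      by blast
    have "asymp_mats k k (\<lambda>i. (V i * mat_adjoint (V i)) * T x i) (T x)"
      by (rule asymp_mats_trans[OF asymp_mats_mult[OF E asymp_mats_refl[OF T[OF x]]] P_left[OF x]])
    then show ?thesis
      unfolding eq by (intro cmp asymp_mats_mult[OF asymp_mats_refl[OF Y]])
  qed
  define X where "X = (\<lambda>s. cmp (W s))"
  have Xb: "bounded_mats r r (X s)" if "s \<in> carrier G" for s
    using cmp[OF asymp_mats_refl[OF W[OF that]]] by (simp add: asymp_mats_def X_def)
  have X_adj: "asymp_mats r r (\<lambda>i. mat_adjoint (X s i) * X s i) (\<lambda>i. 1\<^sub>m (r i))" if s: "s \<in> carrier G" for s
  proof -
    have "mat_adjoint (X s i) = cmp (\<lambda>i. mat_adjoint (W s i)) i" for i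
    proof -
      note c = bounded_matsD[OF W[OF s], of i] V[of i] aV[of i]
      have "mat_adjoint (X s i) = (mat_adjoint (V i) * mat_adjoint (W s i)) * mat_adjoint (mat_adjoint (V i))"
        unfolding X_def cmp_def
        by (simp only: mat_adjoint_mult[OF c(3) mult_carrier_mat[OF c(1) c(2)]] mat_adjoint_mult[OF c(1) c(2)])
      also have "\<dots> = mat_adjoint (V i) * (mat_adjoint (W s i) * V i)"
        by (simp only: mat_adjoint_adjoint assoc_mult_mat[OF c(3) mat_adjoint_carrier[OF c(1)] c(2)])
      finally show ?thesis by (simp add: cmp_def)
    qed
    then have eq: "(\<lambda>i. mat_adjoint (X s i) * X s i) = (\<lambda>i. cmp (\<lambda>i. mat_adjoint (W s i)) i * cmp (T (u s)) i)"
      by (simp add: X_def W_def)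
    have "asymp_mats r r (\<lambda>i. cmp (\<lambda>i. mat_adjoint (W s i)) i * cmp (T (u s)) i) (cmp (\<lambda>i. mat_adjoint (W s i) * T (u s) i))"
      by (rule cmp_mult[OF bounded_mats_adjoint[OF W[OF s]] uc[OF s]])
    also have "asymp_mats r r \<dots> (cmp (T \<one>\<^bsub>A\<^esub>))"
      using cmp[OF W_star[OF s]] by (simp add: W_def)
    also note cmp_one
    finally show ?thesis unfolding eq .
  qed
  have X_mult: "asymp_mats r r (\<lambda>i. X s i * X t i) (\<lambda>i. \<omega> s t \<cdot>\<^sub>m X (s \<otimes>\<^bsub>G\<^esub> t) i)"
    if s: "s \<in> carrier G" and t: "t \<in> carrier G" for s t
  proof -
    have st: "s \<otimes>\<^bsub>G\<^esub> t \<in> carrier G" using s t by simp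
    have eq: "(\<lambda>i. X s i * X t i) = (\<lambda>i. cmp (W s) i * cmp (T (u t)) i)" by (simp add: X_def W_def)
    have "asymp_mats r r (\<lambda>i. cmp (W s) i * cmp (T (u t)) i) (cmp (\<lambda>i. W s i * T (u t) i))"
      by (rule cmp_mult[OF W[OF s] uc[OF t]])
    also have "asymp_mats r r \<dots> (cmp (T (u s \<otimes>\<^bsub>A\<^esub> u t)))"
      unfolding W_def by (rule cmp[OF asymp_mats_sym[OF T_mult[OF uc[OF s] uc[OF t]]]])
    also have "asymp_mats r r \<dots> (cmp (\<lambda>i. \<omega> s t \<cdot>\<^sub>m W (s \<otimes>\<^bsub>G\<^esub> t) i))"
      unfolding umult[OF s t] W_def by (rule cmp[OF T_scl[OF uc[OF st]]])
    also have "cmp (\<lambda>i. \<omega> s t \<cdot>\<^sub>m W (s \<otimes>\<^bsub>G\<^esub> t) i) = (\<lambda>i. \<omega> s t \<cdot>\<^sub>m X (s \<otimes>\<^bsub>G\<^esub> t) i)"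
    proof
      fix i
      note c = bounded_matsD[OF W[OF st], of i] V[of i] aV[of i]
      show "cmp (\<lambda>i. \<omega> s t \<cdot>\<^sub>m W (s \<otimes>\<^bsub>G\<^esub> t) i) i = \<omega> s t \<cdot>\<^sub>m X (s \<otimes>\<^bsub>G\<^esub> t) i"
        by (simp only: cmp_def X_def mult_smult_assoc_mat[OF c(1) c(2)] mult_smult_distrib[OF c(3) mult_carrier_mat[OF c(1) c(2)]])
    qed
    finally show ?thesis unfolding eq .
  qed
  \<comment> \<open>At the group identity the value is set to exactly 1, because matricial stability
    speaks of unital maps.\<close>
  have "\<exists>Y. (\<forall>i. Y i \<in> carrier (unitary_group (r i))) \<and> asymp_mats r r Y (X s) \<and>
      (s = \<one>\<^bsub>G\<^esub> \<longrightarrow> Y = (\<lambda>i. 1\<^sub>m (r i)))" if s: "s \<in> carrier G" for s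
  proof (cases "s = \<one>\<^bsub>G\<^esub>")
    case True
    have "asymp_mats r r (\<lambda>i. 1\<^sub>m (r i)) (X s)"
      unfolding X_def True We by (rule asymp_mats_sym[OF cmp_one])
    then show ?thesis by (intro exI[of _ "\<lambda>i. 1\<^sub>m (r i)"]) (simp add: unitary_group_carrier)
  next
    case False
    then show ?thesis using near_unitary_seq[OF Xb[OF s] X_adj[OF s]] by metis
  qed
  then obtain Y where Y: "\<And>s i. s \<in> carrier G \<Longrightarrow> Y s i \<in> carrier (unitary_group (r i))"
    "\<And>s. s \<in> carrier G \<Longrightarrow> asymp_mats r r (Y s) (X s)"
    "Y \<one>\<^bsub>G\<^esub> = (\<lambda>i. 1\<^sub>m (r i))"
    by (metis G.one_closed)
  show ?thesis
  proof (rule that[of "\<lambda>i s. Y s i" r])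
    show "Y s i \<in> carrier (unitary_group (r i))" if "s \<in> carrier G" for i s using Y(1)[OF that] .
    show "Y \<one>\<^bsub>G\<^esub> i = 1\<^sub>m (r i)" for i by (simp add: Y(3))
    fix s t assume s: "s \<in> carrier G" and t: "t \<in> carrier G"
    then have st: "s \<otimes>\<^bsub>G\<^esub> t \<in> carrier G" by simp
    have "asymp_mats r r (\<lambda>i. Y s i * Y t i) (\<lambda>i. X s i * X t i)"
      by (rule asymp_mats_mult[OF Y(2)[OF s] Y(2)[OF t]])
    also note X_mult[OF s t]
    also have "asymp_mats r r (\<lambda>i. \<omega> s t \<cdot>\<^sub>m X (s \<otimes>\<^bsub>G\<^esub> t) i) (\<lambda>i. \<omega> s t \<cdot>\<^sub>m Y (s \<otimes>\<^bsub>G\<^esub> t) i)"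
      by (rule asymp_mats_smult[OF asymp_mats_sym[OF Y(2)[OF st]]])
    finally show "(\<lambda>i. op_norm (Y s i * Y t i - \<omega> s t \<cdot>\<^sub>m Y (s \<otimes>\<^bsub>G\<^esub> t) i)) \<longlonglongrightarrow> 0"
      by (simp add: asymp_mats_def)
  next
    \<comment> \<open>If almost all ranks were 0, the projections would vanish there and the lift of
      1, asymptotic to them, would be a null sequence.\<close>
    show "\<exists>\<^sub>F i in sequentially. 1 \<le> r i"
    proof (rule ccontr)
      assume "\<not> (\<exists>\<^sub>F i in sequentially. 1 \<le> r i)"
      then have ev: "\<forall>\<^sub>F i in sequentially. r i = 0"
        by (simp add: not_frequently not_le)
      have "asymp_mats k k (T \<one>\<^bsub>A\<^esub>) (\<lambda>i. V i * mat_adjoint (V i))"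
        by (rule asymp_mats_trans[OF asymp_mats_sym[OF PT] asymp_mats_sym[OF E]])
      then have lim: "(\<lambda>i. op_norm (T \<one>\<^bsub>A\<^esub> i - V i * mat_adjoint (V i))) \<longlonglongrightarrow> 0"
        by (simp add: asymp_mats_def)
      have "T \<one>\<^bsub>A\<^esub> i - V i * mat_adjoint (V i) = T \<one>\<^bsub>A\<^esub> i" if "r i = 0" for i
        using that V[of i] aV[of i] bounded_matsD[OF T[OF A.one_closed], of i]
        by (intro eq_matI) (auto simp: scalar_prod_def)
      then have "\<forall>\<^sub>F i in sequentially. op_norm (T \<one>\<^bsub>A\<^esub> i - V i * mat_adjoint (V i)) = op_norm (T \<one>\<^bsub>A\<^esub> i)"
        using ev by (auto elim: eventually_mono)
      then have "(\<lambda>i. op_norm (T \<one>\<^bsub>A\<^esub> i)) \<longlonglongrightarrow> 0"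
        using lim by (simp cong: filterlim_cong add: tendsto_cong)
      then show False using T_one by simp
    qed
  qed
qed

section \<open>Coboundaries and their limits\<close>

lemma unitary_group_mult:
  assumes "R \<in> carrier (unitary_group k)" "S \<in> carrier (unitary_group k)"
  shows "R * S \<in> carrier (unitary_group k)"
proof (rule unitary_groupI)
  have R: "R \<in> carrier_mat k k" "mat_adjoint R \<in> carrier_mat k k" "mat_adjoint R * R = 1\<^sub>m k"
    and S: "S \<in> carrier_mat k k" "mat_adjoint S \<in> carrier_mat k k" "mat_adjoint S * S = 1\<^sub>m k"
    using assms by (auto simp: unitary_group_carrier)
  show "R * S \<in> carrier_mat k k" by (rule mult_carrier_mat[OF R(1) S(1)])
  have "mat_adjoint (R * S) * (R * S) = mat_adjoint S * (mat_adjoint R * (R * S))"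
    unfolding mat_adjoint_mult[OF R(1) S(1)]
    by (rule assoc_mult_mat[OF S(2) R(2) mult_carrier_mat[OF R(1) S(1)]])
  also have "mat_adjoint R * (R * S) = S"
    unfolding assoc_mult_mat[OF R(2) R(1) S(1), symmetric] R(3) by (rule left_mult_one_mat[OF S(1)])
  finally show "mat_adjoint (R * S) * (R * S) = 1\<^sub>m k" using S(3) by simp
qed

lemma unitary_group_adjoint:
  "R \<in> carrier (unitary_group k) \<Longrightarrow> mat_adjoint R \<in> carrier (unitary_group k)"
  by (simp add: unitary_group_carrier)

lemma op_norm_mult_unitary_right:
  assumes "M \<in> carrier_mat k k" "R \<in> carrier (unitary_group k)"
  shows "op_norm (M * R) \<le> op_norm M"
  using op_norm_mult[OF assms(1) unitary_carrier(1)[OF assms(2)]]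
    mult_left_le[OF op_norm_unitary_le(1)[OF assms(2)] op_norm_nonneg[of M]] by linarith

lemma op_norm_mult_unitary_left:
  assumes "M \<in> carrier_mat k k" "R \<in> carrier (unitary_group k)"
  shows "op_norm (R * M) \<le> op_norm M"
  using op_norm_mult[OF unitary_carrier(1)[OF assms(2)] assms(1)]
    mult_left_le_one_le[OF op_norm_nonneg[of M] op_norm_nonneg op_norm_unitary_le(1)[OF assms(2)]] by linarith

text \<open>The matrix on the left is R - w S times the unitary adjoint of \<open>S\<close>. With w
  = 1 it measures closeness to 1, with w a cocycle value the projective defect.\<close>

lemma op_norm_mult_adjoint_minus_one:
  assumes R: "R \<in> carrier_mat k k" and S: "S \<in> carrier (unitary_group k)"
  shows "op_norm (R * mat_adjoint S - w \<cdot>\<^sub>m 1\<^sub>m k) \<le> op_norm (R - w \<cdot>\<^sub>m S)"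
proof -
  note Sc = unitary_carrier[OF S]
  have wS: "w \<cdot>\<^sub>m S \<in> carrier_mat k k" using Sc by simp
  have "(R - w \<cdot>\<^sub>m S) * mat_adjoint S = R * mat_adjoint S - (w \<cdot>\<^sub>m S) * mat_adjoint S"
    by (rule minus_mult_distrib_mat[OF R wS Sc(2)])
  also have "(w \<cdot>\<^sub>m S) * mat_adjoint S = w \<cdot>\<^sub>m 1\<^sub>m k"
    by (simp only: mult_smult_assoc_mat[OF Sc] unitary_eqs[OF S])
  finally show ?thesis
    using op_norm_mult_unitary_right[OF minus_carrier_mat[OF wS, of R] unitary_group_adjoint[OF S]] by simp
qed

lemma op_norm_unitary_conj_minus_one:
  assumes M: "M \<in> carrier_mat k k" and p: "p \<in> carrier (unitary_group k)"
  shows "op_norm (p * M * mat_adjoint p - 1\<^sub>m k) \<le> op_norm (M - 1\<^sub>m k)"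
proof -
  note pc = unitary_carrier[OF p]
  have "p * (M - 1\<^sub>m k) * mat_adjoint p = p * M * mat_adjoint p - 1\<^sub>m k"
    using M pc unitary_eqs[OF p]
    by (simp add: mult_minus_distrib_mat[OF pc(1) M one_carrier_mat]
        minus_mult_distrib_mat[OF mult_carrier_mat[OF pc(1) M] pc(1) pc(2)])
  then have "op_norm (p * M * mat_adjoint p - 1\<^sub>m k) \<le> op_norm (p * (M - 1\<^sub>m k))"
    using op_norm_mult_unitary_right[OF mult_carrier_mat[OF pc(1) minus_carrier_mat[OF one_carrier_mat, of M]]
        unitary_group_adjoint[OF p]] by simp
  also have "\<dots> \<le> op_norm (M - 1\<^sub>m k)"
    by (rule op_norm_mult_unitary_left[OF minus_carrier_mat[OF one_carrier_mat] p])
  finally show ?thesis .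
qed

text \<open>\<open>R S T\<^sup>*\<close> is the product of \<open>R p\<^sup>*\<close>, \<open>p (S q\<^sup>*) p\<^sup>*\<close> and \<open>p q T\<^sup>*\<close>, which are all close to \<open>1\<close>.\<close>

lemma log_det_coboundary:
  assumes U: "R \<in> carrier (unitary_group k)" "S \<in> carrier (unitary_group k)" "T \<in> carrier (unitary_group k)"
    "p \<in> carrier (unitary_group k)" "q \<in> carrier (unitary_group k)"
    and close: "op_norm (R - p) \<le> 1 / 9" "op_norm (S - q) \<le> 1 / 9" "op_norm (T - p * q) \<le> 1 / 9"
  shows "log_det (R * S * mat_adjoint T) =
    log_det (R * mat_adjoint p) + log_det (S * mat_adjoint q) - log_det (T * mat_adjoint (p * q))"
proof -
  have pq: "p * q \<in> carrier (unitary_group k)" by (rule unitary_group_mult[OF U(4,5)])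
  note c = unitary_carrier[OF U(1)] unitary_carrier[OF U(2)] unitary_carrier[OF U(3)]
    unitary_carrier[OF U(4)] unitary_carrier[OF U(5)] unitary_carrier[OF pq]
  note mc = mult_carrier_mat[of _ k k _ k]
  note ass = assoc_mult_mat[of _ k k _ k _ k]
  define A where "A = R * mat_adjoint p"
  define B0 where "B0 = S * mat_adjoint q"
  define B where "B = p * B0 * mat_adjoint p"
  define C where "C = (p * q) * mat_adjoint T"
  define D where "D = T * mat_adjoint (p * q)"
  have carr: "A \<in> carrier_mat k k" "B0 \<in> carrier_mat k k" "B \<in> carrier_mat k k" "C \<in> carrier_mat k k" "D \<in> carrier_mat k k"
    using c by (auto simp: A_def B0_def B_def C_def D_def intro!: mc)
  have near: "op_norm (X * mat_adjoint Y - 1\<^sub>m k) \<le> op_norm (X - Y)"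
    if "X \<in> carrier_mat k k" "Y \<in> carrier (unitary_group k)" for X Y
    using op_norm_mult_adjoint_minus_one[OF that, of 1] by simp
  have nA: "op_norm (A - 1\<^sub>m k) \<le> 1 / 9" unfolding A_def using near[OF c(1) U(4)] close(1) by linarith
  have nB0: "op_norm (B0 - 1\<^sub>m k) \<le> 1 / 9" unfolding B0_def using near[OF c(3) U(5)] close(2) by linarith
  have nB: "op_norm (B - 1\<^sub>m k) \<le> 1 / 9"
    unfolding B_def using op_norm_unitary_conj_minus_one[OF carr(2) U(4)] nB0 by linarith
  have nD: "op_norm (D - 1\<^sub>m k) \<le> 1 / 9" unfolding D_def using near[OF c(5) pq] close(3) by linarith
  have nC: "op_norm (C - 1\<^sub>m k) \<le> 1 / 9"
    unfolding C_def using near[OF c(11) U(3)] close(3) op_norm_minus_commute[OF c(5) c(11)] by linarith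
  \<comment> \<open>Since \<open>B\<close> is unitary the two errors add without a cross term: 1/9 +
    1/9 is below the threshold 1/3 of \<open>log_det_mult\<close>.\<close>
  have nAB: "op_norm (A * B - 1\<^sub>m k) \<le> 1 / 3"
  proof -
    have "A * B - 1\<^sub>m k = (A * B - 1\<^sub>m k * B) + (B - 1\<^sub>m k)"
      using carr by (intro eq_matI) auto
    also have "A * B - 1\<^sub>m k * B = (A - 1\<^sub>m k) * B"
      by (rule minus_mult_distrib_mat[symmetric, OF carr(1) one_carrier_mat carr(3)])
    finally have "op_norm (A * B - 1\<^sub>m k) \<le> op_norm ((A - 1\<^sub>m k) * B) + op_norm (B - 1\<^sub>m k)"
      using op_norm_add[OF mult_carrier_mat[OF minus_carrier_mat[OF one_carrier_mat] carr(3)] minus_carrier_mat[OF one_carrier_mat], of A B]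
      by simp
    also have "op_norm ((A - 1\<^sub>m k) * B) \<le> op_norm (A - 1\<^sub>m k)"
    proof (rule op_norm_mult_unitary_right[OF minus_carrier_mat[OF one_carrier_mat]])
      show "B \<in> carrier (unitary_group k)"
        unfolding B_def B0_def by (intro unitary_group_mult unitary_group_adjoint U)
    qed
    finally show ?thesis using nA nB by linarith
  qed
  have "A * B * C = R * (mat_adjoint p * p) * B0 * (mat_adjoint p * p) * (q * mat_adjoint T)"
    unfolding A_def B_def C_def using c carr by (simp add: mc ass)
  also have "\<dots> = R * (B0 * (q * mat_adjoint T))"
    unfolding unitary_eqs[OF U(4)] using c carr by (simp add: mc ass)
  also have "B0 * (q * mat_adjoint T) = S * ((mat_adjoint q * q) * mat_adjoint T)"
    unfolding B0_def using c by (simp add: mc ass)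
  also have "R * \<dots> = R * S * mat_adjoint T"
    unfolding unitary_eqs[OF U(5)] using c by (simp add: mc ass left_mult_one_mat[of _ k k])
  finally have "log_det (R * S * mat_adjoint T) = log_det (A * B * C)" by simp
  also have "\<dots> = log_det (A * B) + log_det C"
    using nC by (intro log_det_mult[OF mc[OF carr(1,3)] nAB carr(4)]) simp
  also have "log_det (A * B) = log_det A + log_det B"
    using nA nB by (intro log_det_mult[OF carr(1) _ carr(3)]) simp_all
  also have "log_det B = log_det B0"
    using carr c unitary_eqs[OF U(4)]
    by (intro log_det_similar similar_matI[of _ _ p "mat_adjoint p" k]) (auto simp: B_def)
  \<comment> \<open>\<open>C\<close> and \<open>D\<close> are mutually inverse unitaries near 1, so
    additivity applies to their product 1.\<close>
  also have "log_det C = - log_det D"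
  proof -
    have "C * D = (p * q) * ((mat_adjoint T * T) * mat_adjoint (p * q))"
      unfolding C_def D_def using c by (simp only: mc ass)
    also have "\<dots> = 1\<^sub>m k"
      unfolding unitary_eqs[OF U(3)] left_mult_one_mat[OF c(12)] by (rule unitary_eqs(2)[OF pq])
    finally have "log_det C + log_det D = 0"
      using log_det_mult[OF carr(4) _ carr(5)] nC nD by (simp add: log_det_one)
    then show ?thesis by (simp add: eq_neg_iff_add_eq_0)
  qed
  finally show ?thesis by (simp add: A_def B0_def D_def)
qed

text \<open>The defect matrix is within \<epsilon> of the scalar \<open>w\<close>, so its log det is
  near k \<open>Ln w\<close>. The bound by pi on the angle makes \<open>Ln w\<close> equal to 2 pi i
  \<theta> c, not a shifted value. Dividing by 2 pi k \<theta> removes the dimension from the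
  error.\<close>

lemma log_det_projective_defect:
  assumes U: "R \<in> carrier (unitary_group k)" "S \<in> carrier (unitary_group k)" "T \<in> carrier (unitary_group k)"
    and k: "1 \<le> k" and \<theta>: "0 < \<theta>" "\<bar>2 * pi * \<theta> * c\<bar> < pi"
    and w: "w = exp (2 * complex_of_real pi * \<i> * complex_of_real \<theta> * complex_of_real c)" "cmod (w - 1) \<le> 1 / 4"
    and \<epsilon>: "op_norm (R * S - w \<cdot>\<^sub>m T) \<le> \<epsilon>" "\<epsilon> \<le> 1 / 4"
  shows "\<bar>Im (log_det (R * S * mat_adjoint T)) / (2 * pi * real k * \<theta>) - c\<bar> \<le> \<epsilon> / \<theta>"
proof -
  let ?Z = "R * S * mat_adjoint T"
  have RS: "R * S \<in> carrier_mat k k" by (rule unitary_carrier(1)[OF unitary_group_mult[OF U(1,2)]])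
  have Z: "?Z \<in> carrier_mat k k" by (rule mult_carrier_mat[OF RS unitary_carrier(2)[OF U(3)]])
  have "op_norm (?Z - w \<cdot>\<^sub>m 1\<^sub>m k) \<le> \<epsilon>"
    using op_norm_mult_adjoint_minus_one[OF RS U(3), of w] \<epsilon> by linarith
  then have est: "cmod (log_det ?Z - of_nat k * Ln w) \<le> 2 * real k * \<epsilon>"
    using log_det_near_scalar[OF Z w(2) _ \<epsilon>(2)] by blast
  have "w = exp (\<i> * complex_of_real (2 * pi * \<theta> * c))"
    unfolding w(1) by (simp add: mult_ac)
  moreover have "Ln (exp (\<i> * complex_of_real (2 * pi * \<theta> * c))) = \<i> * complex_of_real (2 * pi * \<theta> * c)"
    by (rule Ln_exp) (use \<theta>(2) in \<open>auto simp: abs_less_iff\<close>)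
  ultimately have "Im (of_nat k * Ln w) = real k * (2 * pi * \<theta> * c)" by simp
  moreover have "\<bar>Im (log_det ?Z - of_nat k * Ln w)\<bar> \<le> 2 * real k * \<epsilon>"
    using abs_Im_le_cmod est by (rule order_trans)
  ultimately have "\<bar>Im (log_det ?Z) - real k * (2 * pi * \<theta> * c)\<bar> \<le> 2 * real k * \<epsilon>"
    by (simp only: minus_complex.sel)
  moreover define K where "K = 2 * pi * real k * \<theta>"
  moreover have K: "0 < K" using k \<theta> by (simp add: K_def)
  ultimately have "\<bar>Im (log_det ?Z) - K * c\<bar> \<le> 2 * real k * \<epsilon>" by (simp add: mult_ac)
  moreover have "Im (log_det ?Z) / K - c = (Im (log_det ?Z) - K * c) / K" using K by (simp add: field_simps)
  ultimately have "\<bar>Im (log_det ?Z) / K - c\<bar> \<le> 2 * real k * \<epsilon> / K"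
    using K by (simp add: abs_divide divide_right_mono)
  also have "\<dots> = \<epsilon> / (pi * \<theta>)" using k \<theta> by (simp add: K_def)
  also have "\<dots> \<le> \<epsilon> / \<theta>"
  proof -
    have "0 \<le> \<epsilon>" using \<epsilon>(1) op_norm_nonneg order_trans by blast
    moreover have "1 * \<theta> \<le> pi * \<theta>" using pi_gt3 \<theta> by (intro mult_right_mono) auto
    ultimately show ?thesis using \<theta> by (intro divide_left_mono) auto
  qed
  finally show ?thesis by (simp add: K_def)
qed

section \<open>Pointwise limits of coboundaries\<close>

lemma sum_fun_apply: "sum f S x = (\<Sum>i\<in>S. f i x)" for f :: "'i \<Rightarrow> 'b \<Rightarrow> real"
  by (induction S rule: infinite_finite_induct) auto

text \<open>Each coboundary equation involves finitely many unknowns, so by linear algebra solvability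
  of the whole system only requires that \<open>\<sigma>\<close> respects every finite linear relation between the
  left-hand sides; this condition passes to pointwise limits.\<close>

lemma coboundary_limit:
  fixes G :: "('g, 'm) monoid_scheme" and h :: "nat \<Rightarrow> 'g \<Rightarrow> real"
  assumes lim: "\<And>a b. a \<in> carrier G \<Longrightarrow> b \<in> carrier G \<Longrightarrow>
    (\<lambda>n. h n a - h n (a \<otimes>\<^bsub>G\<^esub> b) + h n b) \<longlonglongrightarrow> \<sigma> a b"
  shows "\<sigma> \<in> coboundaries2 G"
proof -
  define scale where "scale = (\<lambda>c (f :: 'g \<Rightarrow> real) x. c * f x)"
  interpret F: vector_space scale
    by standard (auto simp: scale_def algebra_simps fun_eq_iff)
  interpret FR: vector_space_pair scale "(*) :: real \<Rightarrow> real \<Rightarrow> real"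
    by standard
  define \<delta> where "\<delta> = (\<lambda>a x :: 'g. if x = a then 1 else 0 :: real)"
  \<comment> \<open>\<open>v a b\<close> is the left-hand side of the coboundary equation at (a, b),
    as a formal combination of the unknowns. Summing against \<open>g\<close> over a finite set
    containing a, b and their product evaluates it at \<open>g\<close>; coinciding indices are
    accounted for because it is a combination of point masses.\<close>
  define v where "v = (\<lambda>a b. \<delta> a - \<delta> (a \<otimes>\<^bsub>G\<^esub> b) + \<delta> b)"
  have \<delta>_sum: "(\<Sum>x\<in>S. \<delta> a x * g x) = g a" if "finite S" "a \<in> S" for S a and g :: "'g \<Rightarrow> real"
  proof -
    have "(\<Sum>x\<in>S. \<delta> a x * g x) = (\<Sum>x\<in>S. if x = a then g x else 0)"
      by (intro sum.cong) (auto simp: \<delta>_def)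
    then show ?thesis using that by simp
  qed
  have v_sum: "(\<Sum>x\<in>S. v a b x * g x) = g a - g (a \<otimes>\<^bsub>G\<^esub> b) + g b"
    if "finite S" "a \<in> S" "b \<in> S" "a \<otimes>\<^bsub>G\<^esub> b \<in> S" for S a b and g :: "'g \<Rightarrow> real"
    using that by (simp add: v_def distrib_right left_diff_distrib sum.distrib sum_subtractf \<delta>_sum)
  define D where "D = {v a b |a b. a \<in> carrier G \<and> b \<in> carrier G}"
  have "\<exists>ab. fst ab \<in> carrier G \<and> snd ab \<in> carrier G \<and> w = v (fst ab) (snd ab)" if "w \<in> D" for w
    using that by (force simp: D_def)
  then obtain ab where ab: "\<And>w. w \<in> D \<Longrightarrow> fst (ab w) \<in> carrier G \<and> snd (ab w) \<in> carrier G \<and> w = v (fst (ab w)) (snd (ab w))"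
    by metis
  define f0 where "f0 = (\<lambda>w. \<sigma> (fst (ab w)) (snd (ab w)))"
  \<comment> \<open>A linear relation among left-hand sides holds for the coboundary of every
    \<open>h n\<close>, and being finite it survives the limit. In particular \<open>f0\<close> does
    not depend on the pair that \<open>ab\<close> picks for a given vector.\<close>
  have rel: "\<sigma> a b = (\<Sum>w\<in>t. r w * f0 w)"
    if a: "a \<in> carrier G" and b: "b \<in> carrier G" and t: "finite t" "t \<subseteq> D"
      and eq: "v a b = (\<Sum>w\<in>t. scale (r w) w)" for a b t r
  proof -
    define sup where "sup = (\<lambda>a b. {a, b, a \<otimes>\<^bsub>G\<^esub> b})"
    define S where "S = sup a b \<union> (\<Union>w\<in>t. sup (fst (ab w)) (snd (ab w)))"
    have S: "finite S" using t by (auto simp: S_def sup_def)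
    have "h n a - h n (a \<otimes>\<^bsub>G\<^esub> b) + h n b =
        (\<Sum>w\<in>t. r w * (h n (fst (ab w)) - h n (fst (ab w) \<otimes>\<^bsub>G\<^esub> snd (ab w)) + h n (snd (ab w))))" for n
    proof -
      have "h n a - h n (a \<otimes>\<^bsub>G\<^esub> b) + h n b = (\<Sum>x\<in>S. v a b x * h n x)"
        by (rule v_sum[symmetric, OF S]) (auto simp: S_def sup_def)
      also have "\<dots> = (\<Sum>x\<in>S. \<Sum>w\<in>t. r w * (w x * h n x))"
        unfolding eq sum_fun_apply scale_def by (simp add: sum_distrib_right mult.assoc)
      also have "\<dots> = (\<Sum>w\<in>t. r w * (\<Sum>x\<in>S. w x * h n x))"
        by (subst sum.swap) (simp add: sum_distrib_left)
      also have "\<dots> = (\<Sum>w\<in>t. r w * (h n (fst (ab w)) - h n (fst (ab w) \<otimes>\<^bsub>G\<^esub> snd (ab w)) + h n (snd (ab w))))"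
      proof (rule sum.cong[OF refl])
        fix w assume w: "w \<in> t"
        have "(\<Sum>x\<in>S. w x * h n x) = (\<Sum>x\<in>S. v (fst (ab w)) (snd (ab w)) x * h n x)"
          using ab[of w] w t by (metis subsetD)
        also have "\<dots> = h n (fst (ab w)) - h n (fst (ab w) \<otimes>\<^bsub>G\<^esub> snd (ab w)) + h n (snd (ab w))"
          by (rule v_sum[OF S]) (use w in \<open>auto simp: S_def sup_def\<close>)
        finally show "r w * (\<Sum>x\<in>S. w x * h n x) =
          r w * (h n (fst (ab w)) - h n (fst (ab w) \<otimes>\<^bsub>G\<^esub> snd (ab w)) + h n (snd (ab w)))" by simp
      qed
      finally show ?thesis .
    qed
    moreover have "(\<lambda>n. \<Sum>w\<in>t. r w * (h n (fst (ab w)) - h n (fst (ab w) \<otimes>\<^bsub>G\<^esub> snd (ab w)) + h n (snd (ab w)))) \<longlonglongrightarrow>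
        (\<Sum>w\<in>t. r w * f0 w)"
      unfolding f0_def by (intro tendsto_intros lim) (use ab t in auto)
    ultimately show ?thesis using LIMSEQ_unique[OF lim[OF a b]] by simp
  qed
  \<comment> \<open>Prescribe the right-hand sides on a basis of the span of the left-hand sides and
    extend linearly to all functions; \<open>rel\<close> then yields the remaining equations. The
    values of \<open>f\<close> at the point masses form the cochain.\<close>
  obtain B where B: "B \<subseteq> D" "F.independent B" "D \<subseteq> F.span B"
    using F.maximal_independent_subset[of D] by metis
  obtain f where f: "Vector_Spaces.linear scale (*) f" "\<And>w. w \<in> B \<Longrightarrow> f w = f0 w"
    using FR.linear_independent_extend[OF B(2)] by metis
  interpret f: Vector_Spaces.linear scale "(*)" f by fact
  have "\<sigma> a b = f (\<delta> a) - f (\<delta> (a \<otimes>\<^bsub>G\<^esub> b)) + f (\<delta> b)"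
    if a: "a \<in> carrier G" and b: "b \<in> carrier G" for a b
  proof -
    have "v a b \<in> F.span B" using a b B(3) by (auto simp: D_def)
    then obtain t r where t: "finite t" "t \<subseteq> B" and eq: "v a b = (\<Sum>w\<in>t. scale (r w) w)"
      by (auto simp: F.span_explicit)
    have "f (v a b) = (\<Sum>w\<in>t. r w * f w)" unfolding eq by (simp add: f.sum f.scale)
    also have "\<dots> = (\<Sum>w\<in>t. r w * f0 w)" using f(2) t by (intro sum.cong) auto
    also have "\<dots> = \<sigma> a b" by (rule rel[symmetric, OF a b t(1) _ eq]) (use t B in auto)
    finally show ?thesis by (simp add: v_def f.add f.diff)
  qed
  then show ?thesis
    unfolding coboundaries2_def by (intro CollectI exI[of _ "\<lambda>x. f (\<delta> x)"]) simp
qed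

text \<open>Translating the coboundaries by one of them permutes them; the auxiliary fact
  \<open>add\<close> is used with coefficients 1 and -1.\<close>

lemma H2_class_coboundary:
  assumes "\<sigma> \<in> coboundaries2 G"
  shows "H2_class G \<sigma> = \<one>\<^bsub>H2 G\<^esub>"
proof -
  obtain g where g: "\<And>a b. a \<in> carrier G \<Longrightarrow> b \<in> carrier G \<Longrightarrow> \<sigma> a b = g a - g (a \<otimes>\<^bsub>G\<^esub> b) + g b"
    using assms by (auto simp: coboundaries2_def)
  have add: "(\<lambda>a b. \<tau> a b + c * \<sigma> a b) \<in> coboundaries2 G" if \<tau>: "\<tau> \<in> coboundaries2 G" for \<tau> and c :: real
  proof -
    obtain g' where g': "\<And>a b. a \<in> carrier G \<Longrightarrow> b \<in> carrier G \<Longrightarrow> \<tau> a b = g' a - g' (a \<otimes>\<^bsub>G\<^esub> b) + g' b"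
      using \<tau> by (auto simp: coboundaries2_def)
    then show ?thesis
      unfolding coboundaries2_def
      by (intro CollectI exI[of _ "\<lambda>x. g' x + c * g x"]) (simp add: g g' algebra_simps)
  qed
  have "H2_class G \<sigma> = (\<lambda>\<tau> a b. \<tau> a b + \<sigma> a b) ` coboundaries2 G"
    by (auto simp: H2_class_def r_coset_def cocycles2_def)
  also have "\<dots> = coboundaries2 G"
  proof (intro equalityI subsetI)
    fix \<tau> assume "\<tau> \<in> coboundaries2 G"
    then have "(\<lambda>a b. \<tau> a b - \<sigma> a b) \<in> coboundaries2 G" using add[of \<tau> "-1"] by simp
    then show "\<tau> \<in> (\<lambda>\<tau> a b. \<tau> a b + \<sigma> a b) ` coboundaries2 G"
      by (intro image_eqI[of _ _ "\<lambda>a b. \<tau> a b - \<sigma> a b"]) auto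
  qed (use add[of _ 1] in auto)
  finally show ?thesis by (simp add: H2_def FactGroup_def)
qed

section \<open>Choice of the approximate representations and conclusion\<close>

text \<open>A single index is extracted: finitely many estimates hold eventually, positive rank
  holds frequently, so some index satisfies both.\<close>

lemma finite_projective_rep:
  assumes G: "group G" and A: "unital_cstar_algebra A" and MF: "has_nonzero_MF_quotient A"
    and u: "twisted_unitary_rep G \<omega> A u" and \<omega>: "\<omega> \<one>\<^bsub>G\<^esub> \<one>\<^bsub>G\<^esub> = 1"
    and F: "finite F" "F \<subseteq> carrier G" and \<epsilon>: "0 < (\<epsilon> :: real)"
  shows "\<exists>k \<rho>. 1 \<le> k \<and> \<rho> \<in> carrier G \<rightarrow> carrier (unitary_group k) \<and> \<rho> \<one>\<^bsub>G\<^esub> = 1\<^sub>m k \<and>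
    (\<forall>s\<in>F. \<forall>t\<in>F. op_norm (\<rho> s * \<rho> t - \<omega> s t \<cdot>\<^sub>m \<rho> (s \<otimes>\<^bsub>G\<^esub> t)) \<le> \<epsilon>)"
proof -
  obtain r \<rho> where \<rho>: "\<And>i s. s \<in> carrier G \<Longrightarrow> \<rho> i s \<in> carrier (unitary_group (r i))"
    "\<And>i. \<rho> i \<one>\<^bsub>G\<^esub> = 1\<^sub>m (r i)"
    and lim: "\<And>s t. s \<in> carrier G \<Longrightarrow> t \<in> carrier G \<Longrightarrow>
      (\<lambda>i. op_norm (\<rho> i s * \<rho> i t - \<omega> s t \<cdot>\<^sub>m \<rho> i (s \<otimes>\<^bsub>G\<^esub> t))) \<longlonglongrightarrow> 0"
    and freq: "\<exists>\<^sub>F i in sequentially. 1 \<le> r i"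
    by (rule asymptotic_projective_reps[OF G A MF u \<omega>]) (rule that)
  have "\<forall>\<^sub>F i in sequentially. \<forall>s\<in>F. \<forall>t\<in>F. op_norm (\<rho> i s * \<rho> i t - \<omega> s t \<cdot>\<^sub>m \<rho> i (s \<otimes>\<^bsub>G\<^esub> t)) < \<epsilon>"
    using F \<epsilon> by (intro eventually_ball_finite ballI order_tendstoD(2)[OF lim]) auto
  then obtain i where "1 \<le> r i" "\<forall>s\<in>F. \<forall>t\<in>F. op_norm (\<rho> i s * \<rho> i t - \<omega> s t \<cdot>\<^sub>m \<rho> i (s \<otimes>\<^bsub>G\<^esub> t)) < \<epsilon>"
    using frequently_ex[OF frequently_eventually_conj[OF freq]] by blast
  then show ?thesis
    using \<rho> by (intro exI[of _ "r i"] exI[of _ "\<rho> i"]) (auto intro: less_imp_le)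
qed

lemma exp_cocycle_tendsto_one:
  assumes "\<theta> \<longlonglongrightarrow> 0"
  shows "(\<lambda>n. exp_cocycle \<sigma> (\<theta> n) s t) \<longlonglongrightarrow> 1"
proof -
  have "(\<lambda>n. exp (2 * complex_of_real pi * \<i> * complex_of_real (\<theta> n) * complex_of_real (\<sigma> s t))) \<longlonglongrightarrow>
      exp (2 * complex_of_real pi * \<i> * complex_of_real 0 * complex_of_real (\<sigma> s t))"
    by (intro tendsto_intros assms)
  then show ?thesis by (simp add: exp_cocycle_def)
qed

theorem theorem1p4:
  fixes G :: "('g, 'm) monoid_scheme"
    and \<sigma> :: "'g \<Rightarrow> 'g \<Rightarrow> real"
    and \<theta> :: "nat \<Rightarrow> real"
  assumes "group G"
    and "countable (carrier G)"
    and "\<sigma> \<in> carrier (cocycles2 G)"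
    and "normalized2 G \<sigma>"
    and "H2_class G \<sigma> \<in> carrier (H2 G) - {\<one>\<^bsub>H2 G\<^esub>}"
    and "\<And>n. 0 < \<theta> n \<and> \<theta> n \<le> 1"
    and "decseq \<theta>"
    and "\<theta> \<longlonglongrightarrow> 0"
    and "\<And>n. \<exists>(A :: 'a cstar) u.
           full_twisted_group_cstar G (exp_cocycle \<sigma> (\<theta> n)) A u \<and> has_nonzero_MF_quotient A"
  shows "\<not> matricially_stable G"
proof
  assume stable: "matricially_stable G"
  interpret G: group G by fact
  note \<theta>pos = conjunct1[OF assms(6)]
  let ?w = "\<lambda>n s t. exp_cocycle \<sigma> (\<theta> n) s t"
  obtain enum :: "nat \<Rightarrow> 'g" where enum: "range enum = carrier G"
    using range_from_nat_into[OF _ assms(2)] G.one_closed by blast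
  \<comment> \<open>The tolerance is small relative to \<theta>: the error in the coboundary
    identity will be at most \<epsilon> / \<theta> = 1 / (n+1).\<close>
  define \<epsilon> where "\<epsilon> = (\<lambda>n. \<theta> n / real (Suc n))"
  have \<epsilon>pos: "0 < \<epsilon> n" for n using \<theta>pos by (simp add: \<epsilon>_def)
  \<comment> \<open>For each n one map is drawn from the algebra of \<theta>_n, accurate on the
    first n+1 terms of the enumeration. It is defined on the whole group, so products leaving this
    finite set cause no trouble.\<close>
  have "\<exists>k \<rho>. 1 \<le> k \<and> \<rho> \<in> carrier G \<rightarrow> carrier (unitary_group k) \<and> \<rho> \<one>\<^bsub>G\<^esub> = 1\<^sub>m k \<and>
      (\<forall>s\<in>enum ` {..n}. \<forall>t\<in>enum ` {..n}. op_norm (\<rho> s * \<rho> t - ?w n s t \<cdot>\<^sub>m \<rho> (s \<otimes>\<^bsub>G\<^esub> t)) \<le> \<epsilon> n)" for n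
  proof -
    obtain A :: "'a cstar" and u where A: "full_twisted_group_cstar G (exp_cocycle \<sigma> (\<theta> n)) A u"
      "has_nonzero_MF_quotient A"
      using assms(9) by blast
    have "exp_cocycle \<sigma> (\<theta> n) \<one>\<^bsub>G\<^esub> \<one>\<^bsub>G\<^esub> = 1"
      using assms(4) by (simp add: normalized2_def exp_cocycle_def)
    then show ?thesis
      using A enum \<epsilon>pos unfolding full_twisted_group_cstar_def
      by (intro finite_projective_rep[OF G.group_axioms, of A _ u]) auto
  qed
  then obtain k \<rho> where k: "\<And>n. 1 \<le> k n"
    and \<rho>: "\<And>n. \<rho> n \<in> carrier G \<rightarrow> carrier (unitary_group (k n))" "\<And>n. \<rho> n \<one>\<^bsub>G\<^esub> = 1\<^sub>m (k n)"
    and defect: "\<And>n s t. s \<in> enum ` {..n} \<Longrightarrow> t \<in> enum ` {..n} \<Longrightarrow>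
      op_norm (\<rho> n s * \<rho> n t - ?w n s t \<cdot>\<^sub>m \<rho> n (s \<otimes>\<^bsub>G\<^esub> t)) \<le> \<epsilon> n"
    by metis
  have \<rho>U: "\<rho> n s \<in> carrier (unitary_group (k n))" if "s \<in> carrier G" for n s
    using \<rho>(1) that by blast
  have \<epsilon>0: "\<epsilon> \<longlonglongrightarrow> 0"
  proof (rule Lim_null_comparison[OF always_eventually assms(8)], rule allI)
    fix n
    have "\<theta> n / real (Suc n) \<le> \<theta> n / 1" using \<theta>pos[of n] by (intro divide_left_mono) auto
    then show "norm (\<epsilon> n) \<le> \<theta> n" using \<theta>pos[of n] by (simp add: \<epsilon>_def)
  qed
  have ev_enum: "\<forall>\<^sub>F n in sequentially. s \<in> enum ` {..n}" if s: "s \<in> carrier G" for s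
  proof -
    obtain m where "s = enum m" using enum s by blast
    then show ?thesis
      by (intro eventually_sequentiallyI[of m]) auto
  qed
  \<comment> \<open>The defect splits into the projective one, at most \<epsilon>, and the distance
    of the cocycle value from 1.\<close>
  have asymp_hom: "(\<lambda>n. op_norm (\<rho> n (s \<otimes>\<^bsub>G\<^esub> t) - \<rho> n s * \<rho> n t)) \<longlonglongrightarrow> 0"
    if s: "s \<in> carrier G" and t: "t \<in> carrier G" for s t
  proof (rule Lim_null_comparison)
    have "(\<lambda>n. cmod (1 - ?w n s t) + \<epsilon> n) \<longlonglongrightarrow> cmod (1 - 1) + 0"
      by (intro tendsto_intros exp_cocycle_tendsto_one assms(8) \<epsilon>0)
    then show "(\<lambda>n. cmod (1 - ?w n s t) + \<epsilon> n) \<longlonglongrightarrow> 0" by simp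
    show "\<forall>\<^sub>F n in sequentially. norm (op_norm (\<rho> n (s \<otimes>\<^bsub>G\<^esub> t) - \<rho> n s * \<rho> n t)) \<le> cmod (1 - ?w n s t) + \<epsilon> n"
      using ev_enum[OF s] ev_enum[OF t]
    proof eventually_elim
      case (elim n)
      let ?T = "\<rho> n (s \<otimes>\<^bsub>G\<^esub> t)" and ?RS = "\<rho> n s * \<rho> n t"
      have TU: "?T \<in> carrier (unitary_group (k n))" using \<rho>U s t by simp
      note T = unitary_carrier(1)[OF TU]
      have RS: "?RS \<in> carrier_mat (k n) (k n)"
        using unitary_group_mult[OF \<rho>U[OF s] \<rho>U[OF t]] by (rule unitary_carrier(1))
      have wT: "?w n s t \<cdot>\<^sub>m ?T \<in> carrier_mat (k n) (k n)" using T by simp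
      have "op_norm (?T - ?RS) \<le> op_norm (?T - ?w n s t \<cdot>\<^sub>m ?T) + op_norm (?w n s t \<cdot>\<^sub>m ?T - ?RS)"
        by (rule op_norm_triangle[OF T wT RS])
      also have "?T - ?w n s t \<cdot>\<^sub>m ?T = (1 - ?w n s t) \<cdot>\<^sub>m ?T"
        using T by (intro eq_matI) (auto simp: algebra_simps)
      also have "op_norm ((1 - ?w n s t) \<cdot>\<^sub>m ?T) \<le> cmod (1 - ?w n s t)"
        using op_norm_smult_le[OF T, of "1 - ?w n s t"]
          mult_left_le[OF op_norm_unitary_le(1)[OF TU] norm_ge_zero[of "1 - ?w n s t"]] by linarith
      also have "op_norm (?w n s t \<cdot>\<^sub>m ?T - ?RS) \<le> \<epsilon> n"
        using defect[OF elim] op_norm_minus_commute[OF wT RS] by simp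
      finally show ?case by (simp add: op_norm_nonneg)
    qed
  qed
  have "\<exists>\<pi>. (\<forall>n. \<pi> n \<in> hom G (unitary_group (k n))) \<and>
      (\<forall>s\<in>carrier G. (\<lambda>n. op_norm (\<rho> n s - \<pi> n s)) \<longlonglongrightarrow> 0)"
    by (rule stable[unfolded matricially_stable_def, THEN spec[of _ k], THEN spec[of _ \<rho>], THEN mp])
      (intro conjI allI ballI k \<rho> asymp_hom)
  then obtain \<pi> where hom: "\<And>n. \<pi> n \<in> hom G (unitary_group (k n))"
    and near: "\<And>s. s \<in> carrier G \<Longrightarrow> (\<lambda>n. op_norm (\<rho> n s - \<pi> n s)) \<longlonglongrightarrow> 0"
    by blast
  have \<pi>U: "\<pi> n s \<in> carrier (unitary_group (k n))" if "s \<in> carrier G" for n s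
    using hom that by (auto simp: hom_def)
  have \<pi>mult: "\<pi> n (s \<otimes>\<^bsub>G\<^esub> t) = \<pi> n s * \<pi> n t" if "s \<in> carrier G" "t \<in> carrier G" for n s t
    using hom[of n] that by (simp add: hom_def unitary_group_def)
  \<comment> \<open>The candidate cochains: the angle of the determinant of the discrepancy between
    \<rho> and \<pi>, in the scale in which the cocycle appears with coefficient 1.\<close>
  define h where "h = (\<lambda>n s. Im (log_det (\<rho> n s * mat_adjoint (\<pi> n s))) / (2 * pi * real (k n) * \<theta> n))"
  have "(\<lambda>n. h n s - h n (s \<otimes>\<^bsub>G\<^esub> t) + h n t) \<longlonglongrightarrow> \<sigma> s t"
    if s: "s \<in> carrier G" and t: "t \<in> carrier G" for s t
  proof -
    have st: "s \<otimes>\<^bsub>G\<^esub> t \<in> carrier G" using s t by simp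
    \<comment> \<open>The next four facts secure the thresholds eventually: 1/9 for the coboundary
      identity of \<open>log_det\<close>, 1/4 twice for the estimate near a scalar, and the angle
      below pi for the principal branch.\<close>
    have nearD: "\<forall>\<^sub>F n in sequentially. op_norm (\<rho> n x - \<pi> n x) < 1 / 9" if "x \<in> carrier G" for x
      by (rule order_tendstoD(2)[OF near[OF that]]) simp
    have w1: "\<forall>\<^sub>F n in sequentially. cmod (?w n s t - 1) < 1 / 4"
      using tendstoD[OF exp_cocycle_tendsto_one[OF assms(8)], of "1 / 4" \<sigma> s t] by (simp add: dist_norm)
    have ang: "\<forall>\<^sub>F n in sequentially. \<bar>2 * pi * \<theta> n * \<sigma> s t\<bar> < pi"
    proof (rule order_tendstoD(2))
      have "(\<lambda>n. \<bar>2 * pi * \<theta> n * \<sigma> s t\<bar>) \<longlonglongrightarrow> \<bar>2 * pi * 0 * \<sigma> s t\<bar>"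
        by (intro tendsto_intros assms(8))
      then show "(\<lambda>n. \<bar>2 * pi * \<theta> n * \<sigma> s t\<bar>) \<longlonglongrightarrow> 0" by simp
    qed simp
    have \<epsilon>4: "\<forall>\<^sub>F n in sequentially. \<epsilon> n < 1 / 4"
      by (rule order_tendstoD(2)[OF \<epsilon>0]) simp
    have "(\<lambda>n. (h n s - h n (s \<otimes>\<^bsub>G\<^esub> t) + h n t) - \<sigma> s t) \<longlonglongrightarrow> 0"
    proof (rule Lim_null_comparison[OF _ LIMSEQ_inverse_real_of_nat])
      show "\<forall>\<^sub>F n in sequentially. norm (h n s - h n (s \<otimes>\<^bsub>G\<^esub> t) + h n t - \<sigma> s t) \<le> inverse (real (Suc n))"
        using ev_enum[OF s] ev_enum[OF t] nearD[OF s] nearD[OF t] nearD[OF st] w1 ang \<epsilon>4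
      proof eventually_elim
        case (elim n)
        let ?Z = "\<rho> n s * \<rho> n t * mat_adjoint (\<rho> n (s \<otimes>\<^bsub>G\<^esub> t))"
        have "log_det ?Z = log_det (\<rho> n s * mat_adjoint (\<pi> n s)) + log_det (\<rho> n t * mat_adjoint (\<pi> n t))
            - log_det (\<rho> n (s \<otimes>\<^bsub>G\<^esub> t) * mat_adjoint (\<pi> n (s \<otimes>\<^bsub>G\<^esub> t)))"
          using elim unfolding \<pi>mult[OF s t]
          by (intro log_det_coboundary[of _ "k n"] \<rho>U \<pi>U s t st) simp_all
        then have "h n s - h n (s \<otimes>\<^bsub>G\<^esub> t) + h n t = Im (log_det ?Z) / (2 * pi * real (k n) * \<theta> n)"
          by (simp add: h_def add_divide_distrib diff_divide_distrib)
        moreover have "\<bar>Im (log_det ?Z) / (2 * pi * real (k n) * \<theta> n) - \<sigma> s t\<bar> \<le> \<epsilon> n / \<theta> n"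
          by (rule log_det_projective_defect[OF \<rho>U[OF s] \<rho>U[OF t] \<rho>U[OF st] k \<theta>pos, where c = "\<sigma> s t" and w = "?w n s t"])
            (use elim defect[of s n t] in \<open>simp_all add: exp_cocycle_def\<close>)
        moreover have "\<epsilon> n / \<theta> n = inverse (real (Suc n))"
          using less_imp_neq[OF \<theta>pos[of n]] by (simp add: \<epsilon>_def inverse_eq_divide)
        ultimately show ?case by simp
      qed
    qed
    then show ?thesis by (simp add: LIM_zero_iff)
  qed
  then have "\<sigma> \<in> coboundaries2 G" by (rule coboundary_limit)
  then show False using H2_class_coboundary assms(5) by blast
qed

end
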